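(* In the linear model with Markov-dependent data described in the context, suppose Assumptions A1, A2, A3 and A4 stated there hold and that, as $n\to\infty$, $$s\sqrt{\frac{1+\gamma}{1-\gamma}\cdot\frac{\log d}{n}}=o(1).$$ Then there exist constants $c_\tau,c_\lambda,c_0>0$ not depending on $n$ such that, with the robustification and regularization parameters $$\tau=c_\tau\left(\frac{1-\gamma}{1+\gamma}\cdot\frac{n}{\log d}\right)^{1/(1+\min\{\delta,1\})},\qquad \lambda=c_\lambda\left(\frac{1+\gamma}{1-\gamma}\cdot\frac{\log d}{n}\right)^{\min\{\delta,1\}/(1+\min\{\delta,1\})},$$ the adaptive Huber regression estimator $$\widehat{\boldsymbol\beta}_{\tau,\lambda}\in\arg\min_{\boldsymbol\beta\in\mathbb{R}^d}\left\{H_\tau(\boldsymbol\beta)+\lambda\|\boldsymbol\beta\|_1\right\}$$ satisfies, with probability $1-o(1)$ as $n\to\infty$, $$\|\widehat{\boldsymbol\beta}_{\tau,\lambda}-\boldsymbol\beta^\star\|_1\le c_0\,s\lambda\quad\text{and}\quad\|\widehat{\boldsymbol\beta}_{\tau,\lambda}-\boldsymbol\beta^\star\|_2\le c_0\sqrt{s}\,\lambda.$$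
   Context: Model. For each sample size $n$ one observes $(y_i,\boldsymbol x_i)$, $i=1,\dots,n$, with $y_i=\boldsymbol x_i^{T}\boldsymbol\beta^\star+\varepsilon_i$, $y_i\in\mathbb{R}$, $\boldsymbol x_i=(x_{i1},\dots,x_{id})^{T}\in\mathbb{R}^d$, where $\boldsymbol\beta^\star\in\mathbb{R}^d$ has at most $s\ge 1$ nonzero entries. Put $S=\{j:\beta^\star_j\ne 0\}$. The covariates are functions of a stationary Markov chain $\{Z_i\}_{i=1}^n$ on a general state space: $x_{ij}=f_{ij}(Z_i)$ for measurable real functions $f_{ij}$. Conditionally on $\{Z_i\}_{i=1}^n$ the errors $\varepsilon_1,\dots,\varepsilon_n$ are independent and $\varepsilon_i\mid Z_i\sim g(\cdot\mid Z_i)$ for a conditional distribution $g(\cdot\mid z)$. Asymptotics. Limits are as $n\to\infty$ in the high-dimensional regime $d\ge n$. The quantities $d,s,\boldsymbol\beta^\star,f_{ij},\tau,\lambda$, and also the chain and its $\gamma$ (which may tend to 1), may depend on $n$; $\sigma,\delta,v_\delta,\kappa$ are constants not depending on $n$. Huber loss. For $\tau>0$, $h_\tau(w)=w^2/2$ if $|w|\le\tau$ and $h_\tau(w)=\tau|w|-\tau^2/2$ if $|w|>\tau$; $H_\tau(\boldsymbol\beta)=\frac1n\sum_{i=1}^n h_\tau(y_i-\boldsymbol x_i^{T}\boldsymbol\beta)$. Assumptions. A1. $\{Z_i\}_{i=1}^n$ is stationary with unique invariant probability measure $\pi$ and has nonzero spectral gap $1-\gamma>0$, where $\gamma\in[0,1]$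 is the operator norm of the Markov operator (induced by the transition kernel) acting on the Hilbert space of $\pi$-square-integrable, $\pi$-mean-zero functions. A2. There is an envelope function $M$ with $M(z)\ge\max_{1\le i\le n,1\le j\le d}|f_{ij}(z)|$ for $\pi$-almost every $z$, and $\sigma^4:=\int M^4(z)\,\pi(dz)<\infty$. A3. $E[\varepsilon_i\mid Z_i]=0$ almost surely, and for some $\delta>0$ and $v_\delta>0$, $E[|\varepsilon_i|^{1+\delta}\mid Z_i]<v_\delta$ almost surely. A4. Let $\mathcal C=\{\boldsymbol u\in\mathbb{R}^d:\|\boldsymbol u_{S^c}\|_1\le 3\|\boldsymbol u_S\|_1\}$ (where $\boldsymbol u_A$ is the subvector with indices in $A$) and $\boldsymbol\Sigma_n=\frac1n\sum_{i=1}^n E[\boldsymbol x_i\boldsymbol x_i^{T}]$. There is a constant $\kappa>0$ such that for all sufficiently large $n$, $\inf\{\boldsymbol u^{T}\boldsymbol\Sigma_n\boldsymbol u:\|\boldsymbol u\|_2=1,\ \boldsymbol u\in\mathcal C\}\ge 2\kappa$. *)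

theory Defs
  imports "HOL-Probability.Probability"
begin

text \<open>
  Vectors in \<open>\<real>\<^sup>d\<close>, with \<open>d\<close> varying along a sequence of models, are functions
  \<open>nat \<Rightarrow> real\<close> of which only the components with index in \<open>{1..d}\<close> matter. The Euclidean
  norm is \<open>L2_set u {1..d}\<close>.
\<close>

definition l1_norm_on :: "(nat \<Rightarrow> real) \<Rightarrow> nat set \<Rightarrow> real" where
  "l1_norm_on u A = (\<Sum>j\<in>A. \<bar>u j\<bar>)"

definition supp_vec :: "nat \<Rightarrow> (nat \<Rightarrow> real) \<Rightarrow> nat set" where
  "supp_vec d b = {j \<in> {1..d}. b j \<noteq> 0}"

text \<open>The measure \<open>E\<close> serves as the measurable state space; only its \<open>\<sigma>\<close>-algebra is used.\<close>

definition invariant_prob :: "'z measure \<Rightarrow> ('z \<Rightarrow> 'z measure) \<Rightarrow> 'z measure \<Rightarrow> bool" where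
  "invariant_prob E K \<mu> \<longleftrightarrow> \<mu> \<in> space (prob_algebra E) \<and> bind \<mu> K = \<mu>"

text \<open>The \<open>\<sigma>\<close>-algebra on the sample space generated by \<open>(Z i)\<close>, \<open>i \<in> I\<close>.\<close>

definition generated_by ::
    "'w measure \<Rightarrow> 'z measure \<Rightarrow> nat set \<Rightarrow> (nat \<Rightarrow> 'w \<Rightarrow> 'z) \<Rightarrow> 'w measure" where
  "generated_by P E I Z =
     vimage_algebra (space P) (\<lambda>\<omega>. \<lambda>i\<in>I. Z i \<omega>) (\<Pi>\<^sub>M i\<in>I. E)"

definition stationary_markov_chain ::
    "'w measure \<Rightarrow> 'z measure \<Rightarrow> ('z \<Rightarrow> 'z measure) \<Rightarrow> 'z measure \<Rightarrow> nat
      \<Rightarrow> (nat \<Rightarrow> 'w \<Rightarrow> 'z) \<Rightarrow> bool" where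
  "stationary_markov_chain P E K \<pi> n Z \<longleftrightarrow>
     K \<in> E \<rightarrow>\<^sub>M prob_algebra E \<and>
     invariant_prob E K \<pi> \<and>
     (\<forall>i\<in>{1..n}. Z i \<in> P \<rightarrow>\<^sub>M E) \<and>
     (\<forall>i\<in>{1..n}. distr P E (Z i) = \<pi>) \<and>
     (\<forall>i. 1 \<le> i \<and> i < n \<longrightarrow> (\<forall>A\<in>sets E.
        AE \<omega> in P. real_cond_exp P (generated_by P E {1..i} Z)
                      (indicat_real (Z (Suc i) -` A \<inter> space P)) \<omega>
                    = measure (K (Z i \<omega>)) A))"

definition L2_norm_of :: "'z measure \<Rightarrow> ('z \<Rightarrow> real) \<Rightarrow> real" where
  "L2_norm_of \<pi> h = sqrt (\<integral>z. (h z)\<^sup>2 \<partial>\<pi>)"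

definition mean_zero_L2 :: "'z measure \<Rightarrow> ('z \<Rightarrow> real) set" where
  "mean_zero_L2 \<pi> =
     {h \<in> borel_measurable \<pi>. integrable \<pi> (\<lambda>z. (h z)\<^sup>2) \<and> (\<integral>z. h z \<partial>\<pi>) = 0}"

definition markov_op :: "('z \<Rightarrow> 'z measure) \<Rightarrow> ('z \<Rightarrow> real) \<Rightarrow> 'z \<Rightarrow> real" where
  "markov_op K h = (\<lambda>z. \<integral>y. h y \<partial>(K z))"

text \<open>
  For \<open>\<pi>\<close> invariant under \<open>K\<close> the set below is bounded by \<open>1\<close> (Jensen) and contains \<open>0\<close>,
  so that the real supremum is the genuine operator norm and lies in \<open>[0,1]\<close>.
\<close>

definition markov_op_norm :: "('z \<Rightarrow> 'z measure) \<Rightarrow> 'z measure \<Rightarrow> real" where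
  "markov_op_norm K \<pi> =
     (SUP h\<in>{h \<in> mean_zero_L2 \<pi>. L2_norm_of \<pi> h \<le> 1}. L2_norm_of \<pi> (markov_op K h))"

text \<open>
  The conditional law of \<open>(\<epsilon> 1, \<dots>, \<epsilon> n)\<close> given the whole chain \<open>(Z 1, \<dots>, Z n)\<close> is the product
  of the \<open>g (Z i)\<close>.
\<close>

definition cond_indep_errors ::
    "'w measure \<Rightarrow> 'z measure \<Rightarrow> nat \<Rightarrow> (nat \<Rightarrow> 'w \<Rightarrow> 'z) \<Rightarrow> ('z \<Rightarrow> real measure)
      \<Rightarrow> (nat \<Rightarrow> 'w \<Rightarrow> real) \<Rightarrow> bool" where
  "cond_indep_errors P E n Z g \<epsilon> \<longleftrightarrow>
     g \<in> E \<rightarrow>\<^sub>M prob_algebra borel \<and>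
     (\<forall>i\<in>{1..n}. \<epsilon> i \<in> borel_measurable P) \<and>
     (\<forall>B. (\<forall>i\<in>{1..n}. B i \<in> sets borel) \<longrightarrow>
        (AE \<omega> in P. real_cond_exp P (generated_by P E {1..n} Z)
                      (indicat_real {\<omega> \<in> space P. \<forall>i\<in>{1..n}. \<epsilon> i \<omega> \<in> B i}) \<omega>
                    = (\<Prod>i=1..n. measure (g (Z i \<omega>)) (B i))))"

text \<open>
  The moment bound uses the \<open>ennreal\<close>-valued conditional expectation, which is infinite where the
  moment is; \<open>real_cond_exp\<close> would be \<open>0\<close> there. With the bound, the errors are integrable, so
  \<open>real_cond_exp\<close> is the genuine conditional mean.
\<close>

definition error_moments ::
    "'w measure \<Rightarrow> 'z measure \<Rightarrow> nat \<Rightarrow> (nat \<Rightarrow> 'w \<Rightarrow> 'z) \<Rightarrow> (nat \<Rightarrow> 'w \<Rightarrow> real)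
      \<Rightarrow> real \<Rightarrow> real \<Rightarrow> bool" where
  "error_moments P E n Z \<epsilon> \<delta> v \<longleftrightarrow>
     (\<forall>i\<in>{1..n}.
        (AE \<omega> in P. real_cond_exp P (vimage_algebra (space P) (Z i) E) (\<epsilon> i) \<omega> = 0) \<and>
        (AE \<omega> in P. nn_cond_exp P (vimage_algebra (space P) (Z i) E)
                      (\<lambda>\<omega>. ennreal (\<bar>\<epsilon> i \<omega>\<bar> powr (1 + \<delta>))) \<omega> < ennreal v))"

definition second_moment_matrix ::
    "'w measure \<Rightarrow> nat \<Rightarrow> (nat \<Rightarrow> nat \<Rightarrow> 'w \<Rightarrow> real) \<Rightarrow> nat \<Rightarrow> nat \<Rightarrow> real" where
  "second_moment_matrix P n x j k = (1 / real n) * (\<Sum>i=1..n. \<integral>\<omega>. x i j \<omega> * x i k \<omega> \<partial>P)"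

definition quad_form :: "nat \<Rightarrow> (nat \<Rightarrow> nat \<Rightarrow> real) \<Rightarrow> (nat \<Rightarrow> real) \<Rightarrow> real" where
  "quad_form d A u = (\<Sum>j=1..d. \<Sum>k=1..d. u j * A j k * u k)"

definition lasso_cone :: "nat \<Rightarrow> nat set \<Rightarrow> (nat \<Rightarrow> real) set" where
  "lasso_cone d S = {u. l1_norm_on u ({1..d} - S) \<le> 3 * l1_norm_on u S}"

text \<open>
  The infimum is taken in \<open>ereal\<close>, because it ranges over the empty set when \<open>S\<close> is empty.
\<close>

definition restricted_eigenvalue :: "nat \<Rightarrow> nat set \<Rightarrow> (nat \<Rightarrow> nat \<Rightarrow> real) \<Rightarrow> ereal" where
  "restricted_eigenvalue d S A =
     (INF u\<in>{u \<in> lasso_cone d S. L2_set u {1..d} = 1}. ereal (quad_form d A u))"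

definition huber :: "real \<Rightarrow> real \<Rightarrow> real" where
  "huber \<tau> w = (if \<bar>w\<bar> \<le> \<tau> then w\<^sup>2 / 2 else \<tau> * \<bar>w\<bar> - \<tau>\<^sup>2 / 2)"

definition huber_risk ::
    "nat \<Rightarrow> nat \<Rightarrow> real \<Rightarrow> (nat \<Rightarrow> nat \<Rightarrow> real) \<Rightarrow> (nat \<Rightarrow> real) \<Rightarrow> (nat \<Rightarrow> real) \<Rightarrow> real" where
  "huber_risk n d \<tau> x y b = (1 / real n) * (\<Sum>i=1..n. huber \<tau> (y i - (\<Sum>j=1..d. x i j * b j)))"

definition huber_estimator ::
    "'w measure \<Rightarrow> nat \<Rightarrow> nat \<Rightarrow> real \<Rightarrow> real \<Rightarrow> (nat \<Rightarrow> nat \<Rightarrow> 'w \<Rightarrow> real)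
      \<Rightarrow> (nat \<Rightarrow> 'w \<Rightarrow> real) \<Rightarrow> ('w \<Rightarrow> nat \<Rightarrow> real) \<Rightarrow> bool" where
  "huber_estimator P n d \<tau> l x y bhat \<longleftrightarrow>
     (\<forall>j\<in>{1..d}. (\<lambda>\<omega>. bhat \<omega> j) \<in> borel_measurable P) \<and>
     (\<forall>\<omega>\<in>space P.
        is_arg_min
          (\<lambda>b. huber_risk n d \<tau> (\<lambda>i j. x i j \<omega>) (\<lambda>i. y i \<omega>) b + l * l1_norm_on b {1..d})
          (\<lambda>b. True) (bhat \<omega>))"

end

theory Submission
  imports Defs
begin

text \<open>
  Write \<open>\<rho> = (1 + \<gamma>)/(1 - \<gamma>) \<sqdot> log d / n\<close>, so that \<open>\<tau> = \<rho>\<^bsup>-1/(1+a)\<^esup>\<close> and \<open>\<lambda>\<close> is a multiple of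
  \<open>\<tau>\<rho> = \<rho>\<^bsup>a/(1+a)\<^esup>\<close> with \<open>a = min \<delta> 1\<close>. A Bernstein inequality for the chain, proved by tracking the
  mean and the centred L2 norm of the backward recursion for the moment generating function, controls
  the Gram matrix truncated at \<open>M\<^sup>2 \<le> 1/sqrt \<rho>\<close> to accuracy \<open>O(sqrt \<rho>)\<close>; as \<open>s sqrt \<rho> \<rightarrow> 0\<close>, the
  restricted eigenvalue condition survives on the cone, also after discarding the few large errors.

  For the gradient, one conditions on the chain. As the envelope has only four moments, \<open>x \<psi>(\<epsilon>)\<close> is
  split at the random levels \<open>|\<epsilon>| = \<tau>/M\<close> and \<open>k\<tau>/M\<close> with \<open>k = sqrt (log d)\<close>. The first part is bounded
  by \<open>\<tau>\<close> and allows an exponential union bound over the coordinates; the other two are dominated by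
  quantities that do not depend on the coordinate and need only a small deviation probability.
  The standard argument for convex penalized estimators then yields the two rates.
\<close>

section \<open>Huber loss and the penalized estimator\<close>

text \<open>Heavy-tailed covariates shape the proof: multiplied by an error clipped at
  \<open>\<tau>\<close>, a covariate leaves no usable exponential moment at scale
  \<open>\<tau>\<close>. Clipping at \<open>t = \<tau> / m\<close>, with \<open>m\<close> the
  envelope raised to at least 1, costs \<open>t powr (- (1 + a)) \<le> \<rho> * m\<^sup>2\<close>.
  As \<open>1 + a \<le> 2\<close>, the chain enters the gradient bound only through the average of
  \<open>m\<^sup>2\<close>; the random variance bounds are subtracted inside the exponent, so
  deterministic thresholds suffice. The level \<open>k\<close> must tend to infinity, since the
  middle and far parts fail with probability \<open>1 / k\<close> and of order
  \<open>k powr (- a)\<close>, but slowly enough that \<open>k * ln k \<le> ln d\<close>; the square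
  root of \<open>ln d\<close> does both. Curvature is needed only from below: the Huber excess is a
  sum of nonnegative terms, so observations with a large envelope or a large error may be dropped.
  Dropping at \<open>m\<^sup>2 > B = 1 / sqrt \<rho>\<close> costs a bias at most
  \<open>sqrt \<rho> * m ^ 4\<close> and leaves Bernstein's inequality with summands bounded by
  \<open>B\<close>; both errors are then of the same order \<open>sqrt \<rho>\<close>.\<close>

definition huber_score :: "real \<Rightarrow> real \<Rightarrow> real" where
  "huber_score \<tau> w = max (- \<tau>) (min \<tau> w)"

text \<open>\<open>huber \<tau>\<close> is the supremum of these affine minorants over the slopes
  \<open>\<bar>p\<bar> \<le> \<tau>\<close>: its convex conjugate is \<open>p\<^sup>2 / 2\<close> on
  that interval. The dual form gives tangents and convexity without any differentiation.\<close>

lemma huber_ge_affine: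
  assumes "\<bar>p\<bar> \<le> \<tau>"
  shows "p * w - p\<^sup>2 / 2 \<le> huber \<tau> w"
proof (cases "\<bar>w\<bar> \<le> \<tau>")
  case True
  have "0 \<le> (w - p)\<^sup>2" by simp
  then show ?thesis using True by (simp add: huber_def power2_eq_square algebra_simps)
next
  case False
  have 1: "p * w \<le> \<bar>p\<bar> * \<bar>w\<bar>" by (metis abs_ge_self abs_mult)
  have 2: "(\<tau> - \<bar>p\<bar>) * \<tau> \<le> (\<tau> - \<bar>p\<bar>) * \<bar>w\<bar>"
    using False assms by (intro mult_left_mono) auto
  have "0 \<le> (\<tau> - \<bar>p\<bar>)\<^sup>2" by simp
  then have 3: "0 \<le> \<tau>\<^sup>2 - 2 * \<tau> * \<bar>p\<bar> + p\<^sup>2" by (simp add: power2_diff)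
  show ?thesis using False 1 2 3
    by (simp add: huber_def algebra_simps power2_eq_square)
qed

text \<open>The supremum over slopes is attained at the clipped residual, which thus serves as the
  derivative of the loss.\<close>

lemma huber_eq_affine:
  assumes "0 < \<tau>"
  shows "huber \<tau> w = huber_score \<tau> w * w - (huber_score \<tau> w)\<^sup>2 / 2"
  using assms by (auto simp: huber_def huber_score_def power2_eq_square abs_if min_def max_def)

lemma abs_huber_score_le: "0 < \<tau> \<Longrightarrow> \<bar>huber_score \<tau> w\<bar> \<le> \<tau>"
  by (auto simp: huber_score_def)

lemma huber_tangent:
  assumes "0 < \<tau>"
  shows "huber \<tau> w + huber_score \<tau> w * (w' - w) \<le> huber \<tau> w'"
  using huber_ge_affine[OF abs_huber_score_le[OF assms], of w w'] huber_eq_affine[OF assms, of w]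
  by (simp add: algebra_simps)

lemma huber_convex:
  assumes "0 < \<tau>" "0 \<le> t" "t \<le> 1"
  shows "huber \<tau> ((1 - t) * a + t * b) \<le> (1 - t) * huber \<tau> a + t * huber \<tau> b"
proof -
  let ?w = "(1 - t) * a + t * b"
  have 1: "huber \<tau> ?w + huber_score \<tau> ?w * (a - ?w) \<le> huber \<tau> a"
    and 2: "huber \<tau> ?w + huber_score \<tau> ?w * (b - ?w) \<le> huber \<tau> b"
    using huber_tangent[OF assms(1)] by auto
  have "(1 - t) * (huber \<tau> ?w + huber_score \<tau> ?w * (a - ?w)) \<le> (1 - t) * huber \<tau> a"
    "t * (huber \<tau> ?w + huber_score \<tau> ?w * (b - ?w)) \<le> t * huber \<tau> b"
    using 1 2 assms by (auto intro!: mult_left_mono)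
  moreover have "(1 - t) * (huber \<tau> ?w + huber_score \<tau> ?w * (a - ?w))
      + t * (huber \<tau> ?w + huber_score \<tau> ?w * (b - ?w)) = huber \<tau> ?w"
    by (simp add: algebra_simps)
  ultimately show ?thesis by linarith
qed

text \<open>Both residuals \<open>e\<close> and \<open>e - u\<close> lie in the quadratic zone, so
  the loss is exactly quadratic along the step. This is the only source of curvature in the
  argument.\<close>

lemma huber_quadratic_growth:
  assumes "\<bar>e\<bar> \<le> \<tau> / 2" "\<bar>u\<bar> \<le> \<tau> / 2"
  shows "huber \<tau> (e - u) - huber \<tau> e + huber_score \<tau> e * u = u\<^sup>2 / 2"
proof -
  have "\<bar>e - u\<bar> \<le> \<tau>" "\<bar>e\<bar> \<le> \<tau>" "huber_score \<tau> e = e"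
    using assms by (auto simp: huber_score_def abs_if split: if_splits)
  then show ?thesis by (simp add: huber_def power2_eq_square field_simps)
qed

section \<open>Quadratic forms, norms and the lasso cone\<close>

lemma quad_form_scale: "quad_form d A (\<lambda>j. c * u j) = c\<^sup>2 * quad_form d A u"
  by (simp add: quad_form_def sum_distrib_left power2_eq_square mult_ac)

lemma l1_norm_on_scale: "l1_norm_on (\<lambda>j. c * u j) A = \<bar>c\<bar> * l1_norm_on u A"
  by (simp add: l1_norm_on_def sum_distrib_left abs_mult)

lemma l1_norm_on_nonneg: "0 \<le> l1_norm_on u A"
  by (simp add: l1_norm_on_def sum_nonneg)

lemma lasso_cone_scale: "u \<in> lasso_cone d S \<Longrightarrow> (\<lambda>j. c * u j) \<in> lasso_cone d S"
  by (simp add: lasso_cone_def l1_norm_on_scale) (metis abs_ge_zero mult.left_commute mult_left_mono)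

text \<open>Homogeneity extends the infimum over unit vectors to the whole cone. A vector of norm
  zero may be nonzero outside \<open>{1..d}\<close>, but the form does not see those
  components.\<close>

lemma restricted_eigenvalueD:
  assumes "ereal \<kappa> \<le> restricted_eigenvalue d S A" "u \<in> lasso_cone d S"
  shows "\<kappa> * (L2_set u {1..d})\<^sup>2 \<le> quad_form d A u"
proof (cases "L2_set u {1..d} = 0")
  case True
  then have "\<forall>j\<in>{1..d}. u j = 0" by (simp add: L2_set_eq_0_iff)
  then have "quad_form d A u = 0" by (simp add: quad_form_def)
  then show ?thesis using True by simp
next
  case False
  define N where "N = L2_set u {1..d}"
  have N: "0 < N" using False L2_set_nonneg[of u "{1..d}"] unfolding N_def by linarith
  define w where "w = (\<lambda>j. (1 / N) * u j)"
  have "L2_set w {1..d} = 1"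
    using N L2_set_right_distrib[of "1 / N" u "{1..d}"] by (simp add: w_def N_def[symmetric] del: One_nat_def)
  moreover have "w \<in> lasso_cone d S"
    unfolding w_def by (rule lasso_cone_scale) fact
  ultimately have "restricted_eigenvalue d S A \<le> ereal (quad_form d A w)"
    unfolding restricted_eigenvalue_def by (intro INF_lower) auto
  then have "\<kappa> \<le> quad_form d A w"
    using assms(1) order_trans by fastforce
  also have "quad_form d A w = (1 / N)\<^sup>2 * quad_form d A u"
    unfolding w_def by (rule quad_form_scale)
  finally have "\<kappa> * N\<^sup>2 \<le> quad_form d A u" using N by (simp add: field_simps power2_eq_square)
  then show ?thesis by (simp only: N_def)
qed

lemma l1_norm_split:
  assumes "S \<subseteq> {1..d}"
  shows "l1_norm_on u {1..d} = l1_norm_on u S + l1_norm_on u ({1..d} - S)"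
  unfolding l1_norm_on_def using assms by (metis add.commute finite_atLeastAtMost sum.subset_diff)

lemma l1_le_sqrt_L2:
  assumes "S \<subseteq> {1..d}" "card S \<le> s"
  shows "l1_norm_on u S \<le> sqrt (real s) * L2_set u {1..d}"
proof -
  have fin: "finite S" using assms(1) finite_subset by auto
  have "l1_norm_on u S = (\<Sum>j\<in>S. \<bar>1\<bar> * \<bar>u j\<bar>)" by (simp add: l1_norm_on_def)
  also have "\<dots> \<le> L2_set (\<lambda>_. 1) S * L2_set u S" by (rule L2_set_mult_ineq)
  also have "\<dots> \<le> sqrt (real s) * L2_set u {1..d}"
  proof (rule mult_mono)
    show "L2_set (\<lambda>_. 1) S \<le> sqrt (real s)" using assms(2) by (simp add: L2_set_def)
    show "L2_set u S \<le> L2_set u {1..d}"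
      unfolding L2_set_def using assms(1) by (auto intro!: sum_mono2)
  qed (auto simp: L2_set_nonneg)
  finally show ?thesis .
qed

lemma lasso_cone_l1_le:
  assumes "S \<subseteq> {1..d}" "card S \<le> s" "u \<in> lasso_cone d S"
  shows "l1_norm_on u {1..d} \<le> 4 * sqrt (real s) * L2_set u {1..d}"
proof -
  have "l1_norm_on u {1..d} \<le> 4 * l1_norm_on u S"
    using assms(3) l1_norm_split[OF assms(1), of u] by (simp add: lasso_cone_def)
  then show ?thesis using l1_le_sqrt_L2[OF assms(1,2), of u] by simp
qed

lemma abs_inner_le_l1:
  assumes "\<And>j. j \<in> A \<Longrightarrow> \<bar>a j\<bar> \<le> m"
  shows "\<bar>\<Sum>j\<in>A. a j * u j\<bar> \<le> m * l1_norm_on u A"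
proof -
  have "\<bar>\<Sum>j\<in>A. a j * u j\<bar> \<le> (\<Sum>j\<in>A. \<bar>a j\<bar> * \<bar>u j\<bar>)"
    by (rule order_trans[OF sum_abs]) (simp add: abs_mult)
  also have "\<dots> \<le> (\<Sum>j\<in>A. m * \<bar>u j\<bar>)" by (intro sum_mono mult_right_mono assms) auto
  finally show ?thesis by (simp add: l1_norm_on_def sum_distrib_left)
qed

lemma power2_sum_eq:
  fixes f :: "'a \<Rightarrow> real"
  shows "(\<Sum>j\<in>A. f j)\<^sup>2 = (\<Sum>j\<in>A. \<Sum>k\<in>A. f j * f k)"
  by (simp add: power2_eq_square sum_product)

lemma abs_quad_form_le:
  assumes "\<And>j k. j \<in> {1..d} \<Longrightarrow> k \<in> {1..d} \<Longrightarrow> \<bar>A j k\<bar> \<le> \<eta>"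
  shows "\<bar>quad_form d A u\<bar> \<le> \<eta> * (l1_norm_on u {1..d})\<^sup>2"
proof -
  have "\<bar>quad_form d A u\<bar> \<le> (\<Sum>j=1..d. \<Sum>k=1..d. \<bar>u j * A j k * u k\<bar>)"
    unfolding quad_form_def by (rule order_trans[OF sum_abs]) (intro sum_mono sum_abs)
  also have "\<dots> \<le> (\<Sum>j=1..d. \<Sum>k=1..d. \<eta> * (\<bar>u j\<bar> * \<bar>u k\<bar>))"
  proof (intro sum_mono)
    fix j k assume "j \<in> {1..d}" "k \<in> {1..d}"
    from mult_right_mono[OF assms[OF this], of "\<bar>u j\<bar> * \<bar>u k\<bar>"]
    show "\<bar>u j * A j k * u k\<bar> \<le> \<eta> * (\<bar>u j\<bar> * \<bar>u k\<bar>)" by (simp add: abs_mult mult_ac)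
  qed
  also have "\<dots> = \<eta> * (l1_norm_on u {1..d})\<^sup>2"
    unfolding l1_norm_on_def power2_sum_eq sum_distrib_left ..
  finally show ?thesis .
qed

text \<open>With a truncation indicator as the weight \<open>w\<close>, this turns the truncated
  Gram matrix back into the squared predictions of the retained observations.\<close>

lemma quad_form_gram:
  "quad_form d (\<lambda>j k. c * (\<Sum>i\<in>I. w i * (x i j * x i k))) u
    = c * (\<Sum>i\<in>I. w i * (\<Sum>j=1..d. x i j * u j)\<^sup>2)"
proof -
  have "(\<Sum>i\<in>I. w i * (\<Sum>j=1..d. x i j * u j)\<^sup>2)
      = (\<Sum>i\<in>I. \<Sum>j=1..d. \<Sum>k=1..d. w i * ((x i j * u j) * (x i k * u k)))"
    unfolding power2_sum_eq sum_distrib_left ..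
  also have "\<dots> = (\<Sum>j=1..d. \<Sum>i\<in>I. \<Sum>k=1..d. w i * ((x i j * u j) * (x i k * u k)))"
    by (rule sum.swap)
  also have "\<dots> = (\<Sum>j=1..d. \<Sum>k=1..d. \<Sum>i\<in>I. w i * ((x i j * u j) * (x i k * u k)))"
    by (intro sum.cong refl sum.swap)
  finally show ?thesis
    by (simp add: quad_form_def sum_distrib_left sum_distrib_right mult_ac)
qed

text \<open>Bregman divergence of the empirical Huber risk at the true parameter in direction
  \<open>u\<close>, expressed through the errors \<open>e\<close>. The last term has a plus sign
  because the residual is \<open>e - x u\<close>.\<close>

definition huber_excess ::
    "nat \<Rightarrow> nat \<Rightarrow> real \<Rightarrow> (nat \<Rightarrow> nat \<Rightarrow> real) \<Rightarrow> (nat \<Rightarrow> real) \<Rightarrow> (nat \<Rightarrow> real) \<Rightarrow> real" where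
  "huber_excess n d \<tau> x e u = (1 / real n) * (\<Sum>i=1..n.
     huber \<tau> (e i - (\<Sum>j=1..d. x i j * u j)) - huber \<tau> (e i)
       + huber_score \<tau> (e i) * (\<Sum>j=1..d. x i j * u j))"

text \<open>Every summand of the excess is nonnegative by convexity, so observations outside the
  quadratic zone can be given up. Half of the restricted eigenvalue \<open>2 * \<kappa>\<close>
  enters through the factor 1/2 of the loss, and half of that is spent on the Gram error
  \<open>\<eta>\<close> and the abandoned mass \<open>W\<close>.\<close>

lemma restricted_strong_convexity:
  fixes x :: "nat \<Rightarrow> nat \<Rightarrow> real" and m e u :: "nat \<Rightarrow> real"
  assumes tau: "0 < \<tau>"
    and S: "S \<subseteq> {1..d}" "card S \<le> s" and u: "u \<in> lasso_cone d S" "l1_norm_on u {1..d} \<le> r"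
    and xm: "\<And>i j. i \<in> {1..n} \<Longrightarrow> j \<in> {1..d} \<Longrightarrow> \<bar>x i j\<bar> \<le> m i"
    and m: "\<And>i. i \<in> {1..n} \<Longrightarrow> 0 \<le> m i"
    and B: "\<And>i. i \<in> {1..n} \<Longrightarrow> (m i)\<^sup>2 \<le> B \<Longrightarrow> m i * r \<le> \<tau> / 2"
    and re: "ereal (2 * \<kappa>) \<le> restricted_eigenvalue d S A"
    and gram: "\<And>j k. j \<in> {1..d} \<Longrightarrow> k \<in> {1..d} \<Longrightarrow>
      \<bar>(1 / real n) * (\<Sum>i=1..n. of_bool ((m i)\<^sup>2 \<le> B) * (x i j * x i k)) - A j k\<bar> \<le> \<eta>"
    and W: "(1 / real n) * (\<Sum>i=1..n. (m i)\<^sup>2 * of_bool (\<bar>e i\<bar> > \<tau> / 2)) \<le> W"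
    and small: "16 * real s * (\<eta> + W) \<le> \<kappa>"
    and nonneg: "0 \<le> \<eta>" "0 \<le> W"
  shows "\<kappa> / 2 * (L2_set u {1..d})\<^sup>2 \<le> huber_excess n d \<tau> x e u"
proof -
  define L where "L = l1_norm_on u {1..d}"
  define q where "q i = (\<Sum>j=1..d. x i j * u j)" for i
  define N where "N = L2_set u {1..d}"
  define G where "G = (\<lambda>j k. (1 / real n) * (\<Sum>i=1..n. of_bool ((m i)\<^sup>2 \<le> B) * (x i j * x i k)))"
  have L0: "0 \<le> L" by (simp add: L_def l1_norm_on_nonneg)
  have ql: "\<bar>q i\<bar> \<le> m i * L" if "i \<in> {1..n}" for i
    unfolding q_def L_def using xm that by (intro abs_inner_le_l1) auto
  have q2: "(q i)\<^sup>2 \<le> (m i)\<^sup>2 * L\<^sup>2" if "i \<in> {1..n}" for i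
    using power_mono[OF ql[OF that], of 2] by (simp add: power_mult_distrib)
  \<comment> \<open>If the envelope is large, the first term on the left is absent; if the error is
    large, the second term outweighs the first because
    \<open>(q i)\<^sup>2 \<le> (m i)\<^sup>2 * L\<^sup>2\<close>. In both cases the left side is at
    most 0.\<close>
  have pointwise: "of_bool ((m i)\<^sup>2 \<le> B) * (q i)\<^sup>2 / 2 - L\<^sup>2 * ((m i)\<^sup>2 * of_bool (\<bar>e i\<bar> > \<tau> / 2)) / 2
      \<le> huber \<tau> (e i - q i) - huber \<tau> (e i) + huber_score \<tau> (e i) * q i"
    (is "?l \<le> ?h") if i: "i \<in> {1..n}" for i
  proof -
    have h0: "0 \<le> ?h" using huber_tangent[OF tau, of "e i" "e i - q i"] by simp
    show ?thesis
    proof (cases "(m i)\<^sup>2 \<le> B \<and> \<bar>e i\<bar> \<le> \<tau> / 2")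
      case True
      have "m i * L \<le> m i * r" using m[OF i] u(2) by (simp add: L_def mult_left_mono)
      then have "\<bar>q i\<bar> \<le> \<tau> / 2" using ql[OF i] B[OF i] True by linarith
      then show ?thesis using True huber_quadratic_growth[of "e i" \<tau> "q i"] by simp
    next
      case False
      have "?l \<le> 0" using False q2[OF i] by (auto simp: mult.commute)
      then show ?thesis using h0 by linarith
    qed
  qed
  have "(1 / real n) * (\<Sum>i=1..n. of_bool ((m i)\<^sup>2 \<le> B) * (q i)\<^sup>2 / 2
            - L\<^sup>2 * ((m i)\<^sup>2 * of_bool (\<bar>e i\<bar> > \<tau> / 2)) / 2) \<le> huber_excess n d \<tau> x e u"
    unfolding huber_excess_def q_def[symmetric]
    by (intro mult_left_mono sum_mono pointwise) auto
  also have "(1 / real n) * (\<Sum>i=1..n. of_bool ((m i)\<^sup>2 \<le> B) * (q i)\<^sup>2 / 2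
            - L\<^sup>2 * ((m i)\<^sup>2 * of_bool (\<bar>e i\<bar> > \<tau> / 2)) / 2)
      = quad_form d G u / 2 - L\<^sup>2 / 2 * ((1 / real n) * (\<Sum>i=1..n. (m i)\<^sup>2 * of_bool (\<bar>e i\<bar> > \<tau> / 2)))"
  proof -
    have "(1 / real n) * (\<Sum>i=1..n. a i / 2 - L\<^sup>2 * b i / 2)
        = ((1 / real n) * (\<Sum>i=1..n. a i)) / 2 - L\<^sup>2 / 2 * ((1 / real n) * (\<Sum>i=1..n. b i))"
      for a b :: "nat \<Rightarrow> real"
      by (simp add: sum_subtractf sum_distrib_left sum_divide_distrib right_diff_distrib mult_ac)
    then show ?thesis unfolding G_def quad_form_gram q_def[symmetric] .
  qed
  finally have 1: "quad_form d G u / 2 - L\<^sup>2 / 2 * ((1 / real n) * (\<Sum>i=1..n. (m i)\<^sup>2 * of_bool (\<bar>e i\<bar> > \<tau> / 2)))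
     \<le> huber_excess n d \<tau> x e u" .
  have 2: "L\<^sup>2 / 2 * ((1 / real n) * (\<Sum>i=1..n. (m i)\<^sup>2 * of_bool (\<bar>e i\<bar> > \<tau> / 2))) \<le> L\<^sup>2 / 2 * W"
    by (intro mult_left_mono W) auto
  have "quad_form d G u - quad_form d A u = quad_form d (\<lambda>j k. G j k - A j k) u"
    by (simp add: quad_form_def sum_subtractf algebra_simps)
  moreover have "\<bar>quad_form d (\<lambda>j k. G j k - A j k) u\<bar> \<le> \<eta> * L\<^sup>2"
    unfolding L_def by (rule abs_quad_form_le) (use gram in \<open>simp add: G_def\<close>)
  ultimately have 3: "quad_form d A u - \<eta> * L\<^sup>2 \<le> quad_form d G u" by linarith
  have 4: "2 * \<kappa> * N\<^sup>2 \<le> quad_form d A u"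
    unfolding N_def by (rule restricted_eigenvalueD[OF re u(1)])
  have N0: "0 \<le> N" by (simp add: N_def L2_set_nonneg)
  \<comment> \<open>On the cone, passing from the l1 norm to the Euclidean norm costs
    \<open>16 * s\<close>. This is where sparsity makes an entrywise accuracy sufficient.\<close>
  have "L\<^sup>2 \<le> (4 * sqrt (real s) * N)\<^sup>2"
    using lasso_cone_l1_le[OF S u(1)] L0 by (intro power_mono) (auto simp: L_def N_def)
  then have "L\<^sup>2 \<le> 16 * real s * N\<^sup>2" by (simp add: power_mult_distrib)
  from mult_right_mono[OF this add_nonneg_nonneg[OF nonneg]]
  have "L\<^sup>2 * (\<eta> + W) \<le> 16 * real s * (\<eta> + W) * N\<^sup>2" by (simp only: mult_ac)
  also have "\<dots> \<le> \<kappa> * N\<^sup>2" using small by (intro mult_right_mono) auto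
  finally have 5: "L\<^sup>2 * (\<eta> + W) \<le> \<kappa> * N\<^sup>2" .
  show ?thesis unfolding N_def[symmetric] using 1 2 3 4 5 by (simp add: algebra_simps)
qed

text \<open>\<open>rsc\<close> is available only in an l1 ball of radius \<open>r\<close>, so the
  error is shrunk along the segment to \<open>\<beta>\<close>; convexity keeps the basic inequality
  valid on the whole segment. The l1 bound obtained inside the ball is strictly below
  \<open>r\<close>, hence the error itself cannot have left the ball.\<close>

lemma huber_lasso_error_bound:
  fixes x :: "nat \<Rightarrow> nat \<Rightarrow> real" and e y \<beta> b :: "nat \<Rightarrow> real"
  assumes tau: "0 < \<tau>" and lam: "0 < lam" and kap: "0 < \<kappa>"
    and S: "card (supp_vec d \<beta>) \<le> s"
    and model: "\<And>i. i \<in> {1..n} \<Longrightarrow> y i = (\<Sum>j=1..d. x i j * \<beta> j) + e i"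
    and opt: "is_arg_min (\<lambda>b. huber_risk n d \<tau> x y b + lam * l1_norm_on b {1..d}) (\<lambda>b. True) b"
    and grad: "\<And>j. j \<in> {1..d} \<Longrightarrow> \<bar>(1 / real n) * (\<Sum>i=1..n. x i j * huber_score \<tau> (e i))\<bar> \<le> lam / 2"
    and rsc: "\<And>u. u \<in> lasso_cone d (supp_vec d \<beta>) \<Longrightarrow> l1_norm_on u {1..d} \<le> r \<Longrightarrow>
      \<kappa> / 2 * (L2_set u {1..d})\<^sup>2 \<le> huber_excess n d \<tau> x e u"
    and r: "12 * real s * lam / \<kappa> < r"
  shows "l1_norm_on (\<lambda>j. b j - \<beta> j) {1..d} \<le> 12 / \<kappa> * real s * lam"
    and "L2_set (\<lambda>j. b j - \<beta> j) {1..d} \<le> 12 / \<kappa> * sqrt (real s) * lam"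
proof -
  define S where "S = supp_vec d \<beta>"
  have Ssub: "S \<subseteq> {1..d}" by (auto simp: S_def supp_vec_def)
  define D where "D = (\<lambda>j. b j - \<beta> j)"
  define Hr where "Hr = huber_risk n d \<tau> x y"
  have resid: "y i - (\<Sum>j=1..d. x i j * (\<beta> j + u j)) = e i - (\<Sum>j=1..d. x i j * u j)"
    if "i \<in> {1..n}" for i u
    using model[OF that] by (simp add: distrib_left sum.distrib)
  have Hr_eq: "Hr (\<lambda>j. \<beta> j + u j) = (1 / real n) * (\<Sum>i=1..n. huber \<tau> (e i - (\<Sum>j=1..d. x i j * u j)))" for u
    unfolding Hr_def huber_risk_def by (intro arg_cong2[of _ _ _ _ "(*)"] refl sum.cong) (simp only: resid)
  have opt': "Hr b + lam * l1_norm_on b {1..d} \<le> Hr b' + lam * l1_norm_on b' {1..d}" for b'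
    using opt unfolding is_arg_min_def Hr_def by (meson not_less)
  \<comment> \<open>Basic inequality: convexity carries the optimality of \<open>b\<close> over to
    each point of the segment, and a gradient of size at most \<open>lam / 2\<close> leaves half of
    the penalty off the support.\<close>
  have key: "huber_excess n d \<tau> x e u + lam / 2 * l1_norm_on u ({1..d} - S) \<le> 3 / 2 * lam * l1_norm_on u S"
    if t: "0 \<le> t" "t \<le> 1" and u_def: "u = (\<lambda>j. t * D j)" for t u
  proof -
    have b_eq: "b = (\<lambda>j. \<beta> j + D j)" by (simp add: D_def)
    have xu: "(\<Sum>j=1..d. x i j * u j) = t * (\<Sum>j=1..d. x i j * D j)" for i
      by (simp add: u_def sum_distrib_left mult_ac)
    have "Hr (\<lambda>j. \<beta> j + u j) \<le> (1 / real n) * (\<Sum>i=1..n. (1 - t) * huber \<tau> (e i)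
          + t * huber \<tau> (e i - (\<Sum>j=1..d. x i j * D j)))"
      unfolding Hr_eq xu
    proof (intro mult_left_mono sum_mono)
      fix i
      have "huber \<tau> ((1 - t) * e i + t * (e i - (\<Sum>j=1..d. x i j * D j)))
          \<le> (1 - t) * huber \<tau> (e i) + t * huber \<tau> (e i - (\<Sum>j=1..d. x i j * D j))"
        by (rule huber_convex[OF tau t])
      then show "huber \<tau> (e i - t * (\<Sum>j=1..d. x i j * D j))
          \<le> (1 - t) * huber \<tau> (e i) + t * huber \<tau> (e i - (\<Sum>j=1..d. x i j * D j))"
        by (simp add: algebra_simps)
    qed simp
    also have "\<dots> = (1 - t) * Hr \<beta> + t * Hr b"
    proof -
      have "(1 / real n) * (\<Sum>i=1..n. (1 - t) * a i + t * c i)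
          = (1 - t) * ((1 / real n) * (\<Sum>i=1..n. a i)) + t * ((1 / real n) * (\<Sum>i=1..n. c i))"
        for a c :: "nat \<Rightarrow> real"
        by (simp add: sum.distrib sum_distrib_left distrib_left mult_ac)
      moreover have "Hr \<beta> = (1 / real n) * (\<Sum>i=1..n. huber \<tau> (e i))"
        using Hr_eq[of "\<lambda>_. 0"] by simp
      moreover have "Hr b = (1 / real n) * (\<Sum>i=1..n. huber \<tau> (e i - (\<Sum>j=1..d. x i j * D j)))"
        using Hr_eq[of D] by (simp only: b_eq[symmetric])
      ultimately show ?thesis by simp
    qed
    finally have c1: "Hr (\<lambda>j. \<beta> j + u j) - Hr \<beta> \<le> t * (Hr b - Hr \<beta>)" by (simp add: algebra_simps)
    have "Hr b - Hr \<beta> \<le> lam * (l1_norm_on \<beta> {1..d} - l1_norm_on b {1..d})"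
      using opt'[of \<beta>] by (simp add: algebra_simps)
    also have "\<dots> \<le> lam * (l1_norm_on D S - l1_norm_on D ({1..d} - S))"
    proof (intro mult_left_mono)
      have off: "\<beta> j = 0" if "j \<in> {1..d} - S" for j using that by (auto simp: S_def supp_vec_def)
      have "l1_norm_on \<beta> ({1..d} - S) = 0" "l1_norm_on D ({1..d} - S) = l1_norm_on b ({1..d} - S)"
        unfolding l1_norm_on_def using off by (auto simp: D_def intro!: sum.neutral sum.cong)
      moreover have "l1_norm_on \<beta> S \<le> l1_norm_on b S + l1_norm_on D S"
        unfolding l1_norm_on_def sum.distrib[symmetric] by (intro sum_mono) (auto simp: D_def)
      ultimately show "l1_norm_on \<beta> {1..d} - l1_norm_on b {1..d} \<le> l1_norm_on D S - l1_norm_on D ({1..d} - S)"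
        using l1_norm_split[OF Ssub, of \<beta>] l1_norm_split[OF Ssub, of b] by linarith
    qed (use lam in simp)
    finally have "t * (Hr b - Hr \<beta>) \<le> t * (lam * (l1_norm_on D S - l1_norm_on D ({1..d} - S)))"
      using t(1) by (rule mult_left_mono)
    also have "\<dots> = lam * (l1_norm_on u S - l1_norm_on u ({1..d} - S))"
      using t(1) by (simp add: u_def l1_norm_on_scale algebra_simps)
    finally have c2: "Hr (\<lambda>j. \<beta> j + u j) - Hr \<beta> \<le> lam * (l1_norm_on u S - l1_norm_on u ({1..d} - S))"
      using c1 by linarith
    have "(1 / real n) * (\<Sum>i=1..n. huber_score \<tau> (e i) * (\<Sum>j=1..d. x i j * u j))
        = (\<Sum>j=1..d. ((1 / real n) * (\<Sum>i=1..n. x i j * huber_score \<tau> (e i))) * u j)"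
    proof -
      have "(\<Sum>i=1..n. huber_score \<tau> (e i) * (\<Sum>j=1..d. x i j * u j))
          = (\<Sum>i=1..n. \<Sum>j=1..d. huber_score \<tau> (e i) * (x i j * u j))" by (simp add: sum_distrib_left)
      also have "\<dots> = (\<Sum>j=1..d. \<Sum>i=1..n. huber_score \<tau> (e i) * (x i j * u j))" by (rule sum.swap)
      finally show ?thesis by (simp add: sum_distrib_left sum_distrib_right mult_ac)
    qed
    also have "\<dots> \<le> lam / 2 * l1_norm_on u {1..d}"
      by (rule order_trans[OF abs_ge_self abs_inner_le_l1]) (rule grad)
    finally have c3: "(1 / real n) * (\<Sum>i=1..n. huber_score \<tau> (e i) * (\<Sum>j=1..d. x i j * u j))
      \<le> lam / 2 * (l1_norm_on u S + l1_norm_on u ({1..d} - S))"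
      unfolding l1_norm_split[OF Ssub] .
    have "huber_excess n d \<tau> x e u = Hr (\<lambda>j. \<beta> j + u j) - Hr \<beta>
        + (1 / real n) * (\<Sum>i=1..n. huber_score \<tau> (e i) * (\<Sum>j=1..d. x i j * u j))"
      using Hr_eq[of u] Hr_eq[of "\<lambda>_. 0"]
      by (simp add: huber_excess_def sum.distrib sum_subtractf diff_divide_distrib add_divide_distrib)
    then show ?thesis using c2 c3 by (simp add: algebra_simps)
  qed
  have pos: "0 \<le> huber_excess n d \<tau> x e u" for u
  proof -
    have "0 \<le> huber \<tau> (e i - q) - huber \<tau> (e i) + huber_score \<tau> (e i) * q" for i q
      using huber_tangent[OF tau, of "e i" "e i - q"] by simp
    then show ?thesis unfolding huber_excess_def by (intro mult_nonneg_nonneg sum_nonneg) auto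
  qed
  \<comment> \<open>Since the excess is nonnegative, the basic inequality at \<open>t = 1\<close>
    yields exactly the ratio 3 that defines the cone.\<close>
  have "lam / 2 * l1_norm_on D ({1..d} - S) \<le> 3 / 2 * lam * l1_norm_on D S"
    using key[of 1 D] pos[of D] by simp
  then have coneD: "D \<in> lasso_cone d S" using lam by (simp add: lasso_cone_def)
  have local: "L2_set u {1..d} \<le> 3 / \<kappa> * sqrt (real s) * lam" "l1_norm_on u {1..d} \<le> 12 / \<kappa> * real s * lam"
    if t: "0 \<le> t" "t \<le> 1" and u_def: "u = (\<lambda>j. t * D j)" and ur: "l1_norm_on u {1..d} \<le> r" for t u
  proof -
    let ?N = "L2_set u {1..d}"
    have uc: "u \<in> lasso_cone d S" unfolding u_def using coneD by (rule lasso_cone_scale)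
    have "lam * l1_norm_on u S \<le> lam * (sqrt (real s) * ?N)"
      using l1_le_sqrt_L2[OF Ssub] assms(4) lam by (intro mult_left_mono) (auto simp: S_def)
    moreover have "0 \<le> lam / 2 * l1_norm_on u ({1..d} - S)"
      using lam l1_norm_on_nonneg[of u "{1..d} - S"] by simp
    ultimately have "\<kappa> / 2 * ?N\<^sup>2 \<le> 3 / 2 * (lam * (sqrt (real s) * ?N))"
      using rsc[OF uc[unfolded S_def] ur] key[OF t u_def] by (simp add: algebra_simps)
    then have q: "?N * (\<kappa> * ?N) \<le> ?N * (3 * sqrt (real s) * lam)" by (simp add: power2_eq_square algebra_simps)
    have "\<kappa> * ?N \<le> 3 * sqrt (real s) * lam"
    proof (cases "?N = 0")
      case False
      then have "0 < ?N" using L2_set_nonneg[of u "{1..d}"] by linarith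
      then show ?thesis using q by (metis mult_le_cancel_left_pos)
    qed (use lam in simp)
    then show N: "?N \<le> 3 / \<kappa> * sqrt (real s) * lam" using kap by (simp add: field_simps)
    have "l1_norm_on u {1..d} \<le> 4 * sqrt (real s) * ?N"
      using lasso_cone_l1_le[OF Ssub _ uc] assms(4) by (simp add: S_def)
    also have "\<dots> \<le> 4 * sqrt (real s) * (3 / \<kappa> * sqrt (real s) * lam)"
      by (intro mult_left_mono N) auto
    also have "\<dots> = 12 / \<kappa> * (sqrt (real s) * sqrt (real s)) * lam" by (simp add: mult_ac)
    finally show "l1_norm_on u {1..d} \<le> 12 / \<kappa> * real s * lam" by simp
  qed
  have Dr: "l1_norm_on D {1..d} \<le> r"
  proof (rule ccontr)
    assume "\<not> ?thesis"
    then have big: "r < l1_norm_on D {1..d}" by simp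
    have r0: "0 \<le> r" using r lam kap by (smt (verit) divide_nonneg_pos mult_nonneg_nonneg of_nat_0_le_iff)
    \<comment> \<open>The factor that puts the shrunken error exactly on the sphere of radius
      \<open>r\<close>, where the local l1 bound falls short of \<open>r\<close>.\<close>
    define t where "t = r / l1_norm_on D {1..d}"
    have t: "0 \<le> t" "t \<le> 1" using big r0 by (auto simp: t_def)
    have eq: "l1_norm_on (\<lambda>j. t * D j) {1..d} = r"
      using big r0 t(1) unfolding l1_norm_on_scale by (simp add: t_def)
    show False using local(2)[OF t refl] eq r by simp
  qed
  have D1: "D = (\<lambda>j. 1 * D j)" by simp
  show "l1_norm_on (\<lambda>j. b j - \<beta> j) {1..d} \<le> 12 / \<kappa> * real s * lam"
    using local(2)[OF _ _ D1 Dr] by (simp add: D_def)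
  \<comment> \<open>The Euclidean constant 3 is inflated to 12 so that both rates share one
    constant.\<close>
  have "3 / \<kappa> * (sqrt (real s) * lam) \<le> 12 / \<kappa> * (sqrt (real s) * lam)"
    using kap lam by (intro mult_right_mono divide_right_mono) auto
  then show "L2_set (\<lambda>j. b j - \<beta> j) {1..d} \<le> 12 / \<kappa> * sqrt (real s) * lam"
    using local(1)[OF _ _ D1 Dr] by (simp add: D_def)
qed

section \<open>Conditionally independent errors\<close>

lemma nn_integral_PiM_prod:
  assumes fin: "finite I" and ps: "\<And>i. i \<in> I \<Longrightarrow> prob_space (K i)"
    and f: "\<And>i. i \<in> I \<Longrightarrow> f i \<in> borel_measurable (K i)"
  shows "(\<integral>\<^sup>+x. (\<Prod>i\<in>I. f i (x i)) \<partial>(\<Pi>\<^sub>M i\<in>I. K i)) = (\<Prod>i\<in>I. \<integral>\<^sup>+y. f i y \<partial>K i)"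
proof -
  \<comment> \<open>The product locale expects a sigma-finite measure at every index, also outside
    \<open>I\<close>; a one-point measure serves there.\<close>
  define K' where "K' i = (if i \<in> I then K i else count_space {undefined})" for i
  have "prob_space (K' i)" for i
    using ps by (auto simp: K'_def intro!: prob_spaceI)
  then interpret product_sigma_finite K'
    by (auto simp: product_sigma_finite_def intro: prob_space_imp_sigma_finite)
  have eq: "(\<Pi>\<^sub>M i\<in>I. K i) = (\<Pi>\<^sub>M i\<in>I. K' i)" by (rule PiM_cong) (auto simp: K'_def)
  show ?thesis unfolding eq
    using product_nn_integral_prod[OF fin, of f] f by (simp add: K'_def)
qed

lemma emeasure_PiM_PiE:
  assumes fin: "finite I" and ps: "\<And>i. i \<in> I \<Longrightarrow> prob_space (K i)"
    and F: "\<And>i. i \<in> I \<Longrightarrow> F i \<in> sets (K i)"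
  shows "emeasure (\<Pi>\<^sub>M i\<in>I. K i) (\<Pi>\<^sub>E i\<in>I. F i) = (\<Prod>i\<in>I. emeasure (K i) (F i))"
proof -
  have "indicator (\<Pi>\<^sub>E i\<in>I. F i) x = (\<Prod>i\<in>I. indicator (F i) (x i) :: ennreal)"
    if "x \<in> space (\<Pi>\<^sub>M i\<in>I. K i)" for x
  proof (cases "x \<in> (\<Pi>\<^sub>E i\<in>I. F i)")
    case False
    moreover have "x \<in> extensional I" using that by (auto simp: space_PiM PiE_iff)
    ultimately obtain i where "i \<in> I" "x i \<notin> F i" by (auto simp: PiE_iff)
    then show ?thesis using False fin by (auto simp: indicator_def intro!: prod_zero[symmetric])
  next
    case True
    then have "(\<Prod>i\<in>I. indicator (F i) (x i) :: ennreal) = 1" by (intro prod.neutral) (auto simp: PiE_iff)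
    then show ?thesis using True by simp
  qed
  then have "(\<integral>\<^sup>+x. indicator (\<Pi>\<^sub>E i\<in>I. F i) x \<partial>(\<Pi>\<^sub>M i\<in>I. K i))
      = (\<integral>\<^sup>+x. (\<Prod>i\<in>I. indicator (F i) (x i)) \<partial>(\<Pi>\<^sub>M i\<in>I. K i))"
    by (rule nn_integral_cong)
  also have "\<dots> = (\<Prod>i\<in>I. emeasure (K i) (F i))"
    using F by (subst nn_integral_PiM_prod[OF fin ps]) auto
  finally show ?thesis using F fin by (simp add: sets_PiM_I_finite)
qed

text \<open>Rectangles are an intersection-stable generator of the product, and on them the product
  measure is a finite product of measurable kernel evaluations.\<close>

lemma measurable_PiM_prob_algebra:
  assumes fin: "finite I" and K: "\<And>i. i \<in> I \<Longrightarrow> K i \<in> N \<rightarrow>\<^sub>M prob_algebra (M i)"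
  shows "(\<lambda>x. \<Pi>\<^sub>M i\<in>I. K i x) \<in> N \<rightarrow>\<^sub>M prob_algebra (\<Pi>\<^sub>M i\<in>I. M i)"
proof (rule measurable_prob_algebra_generated)
  show "sets (\<Pi>\<^sub>M i\<in>I. M i) = sigma_sets (\<Pi>\<^sub>E i\<in>I. space (M i)) (prod_algebra I M)"
    by (rule sets_PiM)
  show "Int_stable (prod_algebra I M)" by (rule Int_stable_prod_algebra)
  show "prod_algebra I M \<subseteq> Pow (\<Pi>\<^sub>E i\<in>I. space (M i))" by (rule prod_algebra_sets_into_space)
next
  fix a assume a: "a \<in> space N"
  have ps: "prob_space (K i a)" if "i \<in> I" for i
    using measurable_space[OF K[OF that] a] by (simp add: space_prob_algebra)
  show "prob_space (\<Pi>\<^sub>M i\<in>I. K i a)" by (rule prob_space_PiM) (rule ps)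
  show "sets (\<Pi>\<^sub>M i\<in>I. K i a) = sets (\<Pi>\<^sub>M i\<in>I. M i)"
    using measurable_space[OF K a] by (intro sets_PiM_cong) (auto simp: space_prob_algebra)
next
  fix A assume "A \<in> prod_algebra I M"
  then obtain F where A: "A = (\<Pi>\<^sub>E i\<in>I. F i)" and F: "\<And>i. i \<in> I \<Longrightarrow> F i \<in> sets (M i)"
    by (elim prod_algebraE_all) (auto simp: Pi_iff)
  have "emeasure (\<Pi>\<^sub>M i\<in>I. K i a) A = (\<Prod>i\<in>I. emeasure (K i a) (F i))" if a: "a \<in> space N" for a
    unfolding A using measurable_space[OF K a] F
    by (intro emeasure_PiM_PiE[OF fin]) (auto simp: space_prob_algebra)
  then show "(\<lambda>a. emeasure (\<Pi>\<^sub>M i\<in>I. K i a) A) \<in> borel_measurable N"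
  proof (subst measurable_cong)
    show "(\<lambda>a. \<Prod>i\<in>I. emeasure (K i a) (F i)) \<in> borel_measurable N"
      using F K by (intro borel_measurable_prod_ennreal measurable_emeasure_kernel measurable_prob_algebraD) auto
  qed simp
qed

lemma generated_by_subalgebra:
  assumes "\<And>i. i \<in> I \<Longrightarrow> Z i \<in> P \<rightarrow>\<^sub>M E"
  shows "subalgebra P (generated_by P E I Z)"
proof -
  have Zv: "(\<lambda>\<omega>. \<lambda>i\<in>I. Z i \<omega>) \<in> P \<rightarrow>\<^sub>M (\<Pi>\<^sub>M i\<in>I. E)"
    by (rule measurable_restrict) (rule assms)
  have "(\<lambda>\<omega>. \<lambda>i\<in>I. Z i \<omega>) \<in> space P \<rightarrow> space (\<Pi>\<^sub>M i\<in>I. E)"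
    using measurable_space[OF Zv] by blast
  then show ?thesis
    unfolding subalgebra_def generated_by_def using measurable_sets[OF Zv]
    by (auto simp: sets_vimage_algebra2)
qed

lemma generated_by_measurable:
  assumes "\<And>i. i \<in> I \<Longrightarrow> Z i \<in> P \<rightarrow>\<^sub>M E"
  shows "(\<lambda>\<omega>. \<lambda>i\<in>I. Z i \<omega>) \<in> generated_by P E I Z \<rightarrow>\<^sub>M (\<Pi>\<^sub>M i\<in>I. E)"
  unfolding generated_by_def
  using measurable_space[OF measurable_restrict[of I Z P "\<lambda>_. E", OF assms]]
  by (intro measurable_vimage_algebra1) auto

lemma prob_space_sigma_finite_subalgebra:
  assumes "prob_space P" "subalgebra P F"
  shows "sigma_finite_subalgebra P F"
  using assms finite_measure_subalgebra_is_sigma_finite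
  unfolding finite_measure_subalgebra_def finite_measure_subalgebra_axioms_def prob_space_def by blast

lemma prob_algebraD:
  assumes "K \<in> M \<rightarrow>\<^sub>M prob_algebra N" "x \<in> space M"
  shows "prob_space (K x)" "sets (K x) = sets N" "space (K x) = space N"
  using measurable_space[OF assms] by (auto simp: space_prob_algebra dest: sets_eq_imp_space_eq)

text \<open>Indicators of chain events are measurable for the conditioning algebra and may be moved
  past the conditional expectation; this turns the almost sure product formula into one for the
  joint law on rectangles.\<close>

lemma cond_indep_rectangle:
  assumes P: "prob_space P" and Z: "\<And>i. i \<in> {1..n} \<Longrightarrow> Z i \<in> P \<rightarrow>\<^sub>M E"
    and err: "cond_indep_errors P E n Z g \<epsilon>"
    and A: "A \<in> sets (\<Pi>\<^sub>M i\<in>{1..n}. E)" and B: "\<And>i. i \<in> {1..n} \<Longrightarrow> B i \<in> sets borel"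
  shows "emeasure P {\<omega> \<in> space P. (\<lambda>i\<in>{1..n}. Z i \<omega>) \<in> A \<and> (\<forall>i\<in>{1..n}. \<epsilon> i \<omega> \<in> B i)}
    = (\<integral>\<^sup>+\<omega>. indicator A (\<lambda>i\<in>{1..n}. Z i \<omega>) * (\<Prod>i=1..n. emeasure (g (Z i \<omega>)) (B i)) \<partial>P)"
proof -
  note One_nat_def[simp del]
  interpret prob_space P by fact
  let ?F = "generated_by P E {1..n} Z"
  let ?Zv = "\<lambda>\<omega>. \<lambda>i\<in>{1..n}. Z i \<omega>"
  have sub: "subalgebra P ?F" using Z by (rule generated_by_subalgebra)
  interpret sigma_finite_subalgebra P ?F
    by (rule prob_space_sigma_finite_subalgebra) fact+
  have g: "g \<in> E \<rightarrow>\<^sub>M prob_algebra borel" and eps[measurable]: "\<And>i. i \<in> {1..n} \<Longrightarrow> \<epsilon> i \<in> borel_measurable P"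
    using err by (auto simp: cond_indep_errors_def)
  define C where "C = {\<omega> \<in> space P. \<forall>i\<in>{1..n}. \<epsilon> i \<omega> \<in> B i}"
  have C[measurable]: "C \<in> sets P" unfolding C_def using B by measurable
  have f[measurable]: "(\<lambda>\<omega>. indicat_real A (?Zv \<omega>)) \<in> borel_measurable ?F"
    using measurable_compose[OF generated_by_measurable[OF Z] borel_measurable_indicator[OF A]] .
  have fP[measurable]: "(\<lambda>\<omega>. indicat_real A (?Zv \<omega>)) \<in> borel_measurable P"
    by (rule measurable_from_subalg[OF sub f])
  have int: "integrable P (\<lambda>\<omega>. indicat_real A (?Zv \<omega>) * indicat_real C \<omega>)"
    by (rule integrable_const_bound[where B=1]) (use fP C in \<open>auto split: split_indicator simp del: One_nat_def intro!: borel_measurable_times\<close>)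
  have ae: "AE \<omega> in P. real_cond_exp P ?F (indicat_real C) \<omega> = (\<Prod>i=1..n. measure (g (Z i \<omega>)) (B i))"
    unfolding C_def
    by (rule err[unfolded cond_indep_errors_def, THEN conjunct2, THEN conjunct2, rule_format]) (rule B)
  have "emeasure P {\<omega> \<in> space P. ?Zv \<omega> \<in> A \<and> (\<forall>i\<in>{1..n}. \<epsilon> i \<omega> \<in> B i)}
      = (\<integral>\<^sup>+\<omega>. ennreal (indicat_real A (?Zv \<omega>) * indicat_real C \<omega>) \<partial>P)"
  proof -
    have "{\<omega> \<in> space P. ?Zv \<omega> \<in> A} \<inter> C \<in> sets P"
      using A Z by measurable
    moreover have "{\<omega> \<in> space P. ?Zv \<omega> \<in> A \<and> (\<forall>i\<in>{1..n}. \<epsilon> i \<omega> \<in> B i)} = {\<omega> \<in> space P. ?Zv \<omega> \<in> A} \<inter> C"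
      by (auto simp: C_def)
    ultimately show ?thesis
      by (simp only: nn_integral_indicator[symmetric]) (auto intro!: nn_integral_cong simp: indicator_def)
  qed
  also have "\<dots> = ennreal (\<integral>\<omega>. indicat_real A (?Zv \<omega>) * indicat_real C \<omega> \<partial>P)"
    by (rule nn_integral_eq_integral[OF int]) auto
  also have "(\<integral>\<omega>. indicat_real A (?Zv \<omega>) * indicat_real C \<omega> \<partial>P)
      = (\<integral>\<omega>. indicat_real A (?Zv \<omega>) * real_cond_exp P ?F (indicat_real C) \<omega> \<partial>P)"
    by (rule real_cond_exp_intg(2)[OF int f, symmetric]) (use C in auto)
  also have "ennreal \<dots> = (\<integral>\<^sup>+\<omega>. ennreal (indicat_real A (?Zv \<omega>) * real_cond_exp P ?F (indicat_real C) \<omega>) \<partial>P)"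
  proof (rule nn_integral_eq_integral[symmetric])
    show "integrable P (\<lambda>\<omega>. indicat_real A (?Zv \<omega>) * real_cond_exp P ?F (indicat_real C) \<omega>)"
      by (rule real_cond_exp_intg(1)[OF int f]) (use C in auto)
    show "AE \<omega> in P. 0 \<le> indicat_real A (?Zv \<omega>) * real_cond_exp P ?F (indicat_real C) \<omega>"
      using ae by eventually_elim (auto intro!: mult_nonneg_nonneg prod_nonneg)
  qed
  also have "\<dots> = (\<integral>\<^sup>+\<omega>. indicator A (?Zv \<omega>) * (\<Prod>i=1..n. emeasure (g (Z i \<omega>)) (B i)) \<partial>P)"
  proof (rule nn_integral_cong_AE)
    show "AE \<omega> in P. ennreal (indicat_real A (?Zv \<omega>) * real_cond_exp P ?F (indicat_real C) \<omega>)
        = indicator A (?Zv \<omega>) * (\<Prod>i=1..n. emeasure (g (Z i \<omega>)) (B i))"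
      using ae AE_space
    proof eventually_elim
      case (elim \<omega>)
      have "emeasure (g (Z i \<omega>)) (B i) = ennreal (measure (g (Z i \<omega>)) (B i))" if "i \<in> {1..n}" for i
      proof -
        interpret gi: prob_space "g (Z i \<omega>)"
          using prob_algebraD(1)[OF g] measurable_space[OF Z[OF that]] elim(2) by blast
        show ?thesis by (rule gi.emeasure_eq_measure)
      qed
      then show ?case using elim(1) by (auto simp: prod_ennreal indicator_def)
    qed
  qed
  finally show ?thesis .
qed

text \<open>Disintegration: the joint law of chain and errors is the law of the chain followed by
  the product kernel. As the rectangle formula restricts the errors coordinatewise, uniqueness of
  measures is used twice: over error sets with the chain event fixed, then over products of
  both.\<close>

lemma cond_indep_nn_integral:
  assumes P: "prob_space P" and Z: "\<And>i. i \<in> {1..n} \<Longrightarrow> Z i \<in> P \<rightarrow>\<^sub>M E"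
    and err: "cond_indep_errors P E n Z g \<epsilon>"
    and Phi: "\<Phi> \<in> borel_measurable ((\<Pi>\<^sub>M i\<in>{1..n}. E) \<Otimes>\<^sub>M (\<Pi>\<^sub>M i\<in>{1..n}. borel))"
  shows "(\<integral>\<^sup>+\<omega>. \<Phi> (\<lambda>i\<in>{1..n}. Z i \<omega>, \<lambda>i\<in>{1..n}. \<epsilon> i \<omega>) \<partial>P)
    = (\<integral>\<^sup>+\<omega>. \<integral>\<^sup>+e. \<Phi> (\<lambda>i\<in>{1..n}. Z i \<omega>, e) \<partial>(\<Pi>\<^sub>M i\<in>{1..n}. g (Z i \<omega>)) \<partial>P)"
proof -
  interpret prob_space P by fact
  define I where "I = {1..n}"
  note Z = Z[folded I_def]
  have fin: "finite I" by (simp add: I_def)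
  have g: "g \<in> E \<rightarrow>\<^sub>M prob_algebra borel" and eps: "\<And>i. i \<in> I \<Longrightarrow> \<epsilon> i \<in> borel_measurable P"
    using err by (auto simp: cond_indep_errors_def I_def)
  let ?EI = "\<Pi>\<^sub>M i\<in>I. E" and ?BI = "\<Pi>\<^sub>M i\<in>I. (borel :: real measure)"
  define Zv where "Zv \<omega> = (\<lambda>i\<in>I. Z i \<omega>)" for \<omega>
  define ev where "ev \<omega> = (\<lambda>i\<in>I. \<epsilon> i \<omega>)" for \<omega>
  define \<kappa> where "\<kappa> z = (\<Pi>\<^sub>M i\<in>I. g (z i))" for z
  have Zv[measurable]: "Zv \<in> P \<rightarrow>\<^sub>M ?EI" unfolding Zv_def by (rule measurable_restrict) (rule Z)
  have ev[measurable]: "ev \<in> P \<rightarrow>\<^sub>M ?BI" unfolding ev_def by (rule measurable_restrict) (rule eps)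
  have \<kappa>[measurable]: "\<kappa> \<in> ?EI \<rightarrow>\<^sub>M prob_algebra ?BI"
    unfolding \<kappa>_def
    by (rule measurable_PiM_prob_algebra[OF fin]) (rule measurable_compose[OF measurable_component_singleton[of _ I "\<lambda>_. E"] g])
  have slice: "emeasure P {\<omega> \<in> space P. Zv \<omega> \<in> A \<and> ev \<omega> \<in> C} = (\<integral>\<^sup>+\<omega>. indicator A (Zv \<omega>) * emeasure (\<kappa> (Zv \<omega>)) C \<partial>P)"
    if A[measurable]: "A \<in> sets ?EI" and C: "C \<in> sets ?BI" for A C
  proof -
    \<comment> \<open>Weighting \<open>P\<close> by the chain event \<open>A\<close> turns both
      sides, as functions of \<open>C\<close>, into finite measures on the error space.\<close>
    define D where "D = density P (\<lambda>\<omega>. indicator A (Zv \<omega>))"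
    have D: "sets D = sets P" by (simp add: D_def)
    have ne: "space (distr D ?EI Zv) \<noteq> {}"
      using not_empty measurable_space[OF Zv] by (metis all_not_in_conv space_distr)
    have Zv': "Zv \<in> D \<rightarrow>\<^sub>M ?EI" "ev \<in> D \<rightarrow>\<^sub>M ?BI" by (simp_all only: measurable_cong_sets[OF D refl] Zv ev)
    have \<kappa>': "\<kappa> \<in> distr D ?EI Zv \<rightarrow>\<^sub>M subprob_algebra ?BI"
      using measurable_prob_algebraD[OF \<kappa>] by (simp only: measurable_distr_eq1)
    have em1: "emeasure (distr D ?BI ev) X = emeasure P {\<omega> \<in> space P. Zv \<omega> \<in> A \<and> ev \<omega> \<in> X}"
      if X[measurable]: "X \<in> sets ?BI" for X
    proof -
      have "emeasure (distr D ?BI ev) X = emeasure D (ev -` X \<inter> space P)"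
        using emeasure_distr[OF Zv'(2) X] by (simp add: D_def)
      also have "\<dots> = (\<integral>\<^sup>+\<omega>. indicator A (Zv \<omega>) * indicator (ev -` X \<inter> space P) \<omega> \<partial>P)"
        unfolding D_def by (rule emeasure_density) measurable
      also have "\<dots> = (\<integral>\<^sup>+\<omega>. indicator {\<omega> \<in> space P. Zv \<omega> \<in> A \<and> ev \<omega> \<in> X} \<omega> \<partial>P)"
        by (intro nn_integral_cong) (auto simp: indicator_def)
      finally show ?thesis by simp
    qed
    have em2: "emeasure (distr D ?EI Zv \<bind> \<kappa>) X = (\<integral>\<^sup>+\<omega>. indicator A (Zv \<omega>) * emeasure (\<kappa> (Zv \<omega>)) X \<partial>P)"
      if X[measurable]: "X \<in> sets ?BI" for X
    proof -
      have "emeasure (distr D ?EI Zv \<bind> \<kappa>) X = (\<integral>\<^sup>+z. emeasure (\<kappa> z) X \<partial>distr D ?EI Zv)"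
        by (rule emeasure_bind[OF ne \<kappa>' X])
      also have "\<dots> = (\<integral>\<^sup>+\<omega>. emeasure (\<kappa> (Zv \<omega>)) X \<partial>D)"
        using measurable_emeasure_kernel[OF measurable_prob_algebraD[OF \<kappa>] X]
        by (intro nn_integral_distr Zv'(1)) auto
      also have "\<dots> = (\<integral>\<^sup>+\<omega>. indicator A (Zv \<omega>) * emeasure (\<kappa> (Zv \<omega>)) X \<partial>P)"
        unfolding D_def using measurable_compose[OF Zv measurable_emeasure_kernel[OF measurable_prob_algebraD[OF \<kappa>] X]]
        by (intro nn_integral_density) auto
      finally show ?thesis .
    qed
    \<comment> \<open>Agreement on rectangles is \<open>cond_indep_rectangle\<close>; the total mass
      is at most 1, so uniqueness applies.\<close>
    have "distr D ?BI ev = distr D ?EI Zv \<bind> \<kappa>"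
    proof (rule measure_eqI_PiM_finite[OF fin, where A="\<lambda>_. \<Pi>\<^sub>E i\<in>I. UNIV"])
      show "sets (distr D ?BI ev) = sets ?BI" by simp
      show "sets (distr D ?EI Zv \<bind> \<kappa>) = sets ?BI"
        using ne sets_kernel[OF \<kappa>'] by (intro sets_bind) auto
    next
      fix B :: "nat \<Rightarrow> real set" assume B: "\<And>i. i \<in> I \<Longrightarrow> B i \<in> sets borel"
      then have BX: "Pi\<^sub>E I B \<in> sets ?BI" by (intro sets_PiM_I_finite fin)
      have "emeasure (distr D ?BI ev) (Pi\<^sub>E I B) = emeasure P {\<omega> \<in> space P. Zv \<omega> \<in> A \<and> (\<forall>i\<in>I. \<epsilon> i \<omega> \<in> B i)}"
        unfolding em1[OF BX] by (simp add: ev_def PiE_iff)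
      also have "\<dots> = (\<integral>\<^sup>+\<omega>. indicator A (Zv \<omega>) * (\<Prod>i\<in>I. emeasure (g (Z i \<omega>)) (B i)) \<partial>P)"
        using cond_indep_rectangle[OF P _ err, of A B] Z B A unfolding I_def Zv_def by simp
      also have "\<dots> = (\<integral>\<^sup>+\<omega>. indicator A (Zv \<omega>) * emeasure (\<kappa> (Zv \<omega>)) (Pi\<^sub>E I B) \<partial>P)"
      proof (intro nn_integral_cong)
        fix \<omega> assume w: "\<omega> \<in> space P"
        have "emeasure (\<kappa> (Zv \<omega>)) (Pi\<^sub>E I B) = (\<Prod>i\<in>I. emeasure (g (Zv \<omega> i)) (B i))"
          unfolding \<kappa>_def using B prob_algebraD[OF g] measurable_space[OF Z w]
          by (intro emeasure_PiM_PiE[OF fin]) (auto simp: Zv_def)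
        then show "indicator A (Zv \<omega>) * (\<Prod>i\<in>I. emeasure (g (Z i \<omega>)) (B i))
            = indicator A (Zv \<omega>) * emeasure (\<kappa> (Zv \<omega>)) (Pi\<^sub>E I B)"
          by (simp add: Zv_def)
      qed
      finally show "emeasure (distr D ?BI ev) (Pi\<^sub>E I B) = emeasure (distr D ?EI Zv \<bind> \<kappa>) (Pi\<^sub>E I B)"
        by (simp only: em2[OF BX])
    next
      show "range (\<lambda>_. \<Pi>\<^sub>E i\<in>I. UNIV :: real set) \<subseteq> prod_algebra I (\<lambda>_. borel)"
        using fin by (auto intro!: prod_algebraI_finite)
      show "(\<Union>i. \<Pi>\<^sub>E i\<in>I. UNIV :: real set) = space ?BI" by (simp add: space_PiM)
      have "emeasure (distr D ?BI ev) X \<le> 1" if "X \<in> sets ?BI" for X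
        unfolding em1[OF that] by (rule emeasure_le_1)
      then have "emeasure (distr D ?BI ev) (\<Pi>\<^sub>E i\<in>I. UNIV) \<le> 1"
        using sets_PiM_I_finite[OF fin, of "\<lambda>_. UNIV" "\<lambda>_. borel"] by simp
      then show "emeasure (distr D ?BI ev) (\<Pi>\<^sub>E i\<in>I. UNIV) \<noteq> \<infinity>"
        using ennreal_one_less_top by (metis infinity_ennreal_def leD)
    qed
    then show ?thesis using em1[OF C] em2[OF C] by simp
  qed
  let ?N = "distr P (?EI \<Otimes>\<^sub>M ?BI) (\<lambda>\<omega>. (Zv \<omega>, ev \<omega>))"
  \<comment> \<open>Keeping the state next to the errors allows the integrand to depend on
    both.\<close>
  let ?k = "\<lambda>z. return ?EI z \<Otimes>\<^sub>M \<kappa> z"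
  have dZ: "distr P ?EI Zv \<in> space (prob_algebra ?EI)"
    using prob_space_distr[OF Zv] by (simp add: space_prob_algebra)
  have k[measurable]: "?k \<in> ?EI \<rightarrow>\<^sub>M prob_algebra (?EI \<Otimes>\<^sub>M ?BI)" by measurable
  have law: "?N = distr P ?EI Zv \<bind> ?k"
  proof (rule measure_eqI_generator_eq[OF Int_stable_pair_measure_generator[of ?EI ?BI],
        where \<Omega>="space ?EI \<times> space ?BI" and A="\<lambda>_. space ?EI \<times> space ?BI"])
    show "{a \<times> b |a b. a \<in> sets ?EI \<and> b \<in> sets ?BI} \<subseteq> Pow (space ?EI \<times> space ?BI)"
      by (rule pair_measure_closed)
    show "sets ?N = sigma_sets (space ?EI \<times> space ?BI) {a \<times> b |a b. a \<in> sets ?EI \<and> b \<in> sets ?BI}"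
      by (simp add: sets_pair_measure)
    show "sets (distr P ?EI Zv \<bind> ?k) = sigma_sets (space ?EI \<times> space ?BI) {a \<times> b |a b. a \<in> sets ?EI \<and> b \<in> sets ?BI}"
      using sets_bind'[OF dZ k] by (simp add: sets_pair_measure)
    show "range (\<lambda>_. space ?EI \<times> space ?BI) \<subseteq> {a \<times> b |a b. a \<in> sets ?EI \<and> b \<in> sets ?BI}" by blast
    show "(\<Union>i. space ?EI \<times> space ?BI) = space ?EI \<times> space ?BI" by simp
    interpret N: prob_space ?N by (rule prob_space_distr) measurable
    show "emeasure ?N (space ?EI \<times> space ?BI) \<noteq> \<infinity>" by (simp add: N.emeasure_eq_measure)
  next
    fix X assume "X \<in> {a \<times> b |a b. a \<in> sets ?EI \<and> b \<in> sets ?BI}"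
    then obtain A C where X: "X = A \<times> C" and A[measurable]: "A \<in> sets ?EI" and C[measurable]: "C \<in> sets ?BI" by auto
    have "emeasure ?N X = emeasure P {\<omega> \<in> space P. Zv \<omega> \<in> A \<and> ev \<omega> \<in> C}"
      unfolding X by (subst emeasure_distr) (auto intro!: arg_cong[where f="emeasure P"])
    also have "\<dots> = (\<integral>\<^sup>+\<omega>. indicator A (Zv \<omega>) * emeasure (\<kappa> (Zv \<omega>)) C \<partial>P)" by (rule slice) fact+
    also have "\<dots> = (\<integral>\<^sup>+\<omega>. emeasure (?k (Zv \<omega>)) (A \<times> C) \<partial>P)"
    proof (intro nn_integral_cong)
      fix \<omega> assume w: "\<omega> \<in> space P"
      have z: "Zv \<omega> \<in> space ?EI" using measurable_space[OF Zv w] .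
      interpret k: prob_space "\<kappa> (Zv \<omega>)" by (rule prob_algebraD[OF \<kappa> z])
      show "indicator A (Zv \<omega>) * emeasure (\<kappa> (Zv \<omega>)) C = emeasure (?k (Zv \<omega>)) (A \<times> C)"
        using prob_algebraD(2)[OF \<kappa> z] C A
        by (subst k.emeasure_pair_measure_Times) (auto simp: emeasure_return)
    qed
    also have "\<dots> = (\<integral>\<^sup>+z. emeasure (?k z) (A \<times> C) \<partial>distr P ?EI Zv)"
      by (subst nn_integral_distr) (auto intro!: measurable_emeasure_kernel[OF measurable_prob_algebraD[OF k]])
    also have "\<dots> = emeasure (distr P ?EI Zv \<bind> ?k) X"
      unfolding X by (rule emeasure_bind_prob_algebra[OF dZ k, symmetric]) auto
    finally show "emeasure ?N X = emeasure (distr P ?EI Zv \<bind> ?k) X" .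
  qed
  have Phi'[measurable]: "\<Phi> \<in> borel_measurable (?EI \<Otimes>\<^sub>M ?BI)" using Phi by (simp add: I_def)
  have "(\<integral>\<^sup>+\<omega>. \<Phi> (Zv \<omega>, ev \<omega>) \<partial>P) = (\<integral>\<^sup>+p. \<Phi> p \<partial>?N)"
    by (subst nn_integral_distr) auto
  also have "\<dots> = (\<integral>\<^sup>+z. \<integral>\<^sup>+p. \<Phi> p \<partial>?k z \<partial>distr P ?EI Zv)"
    unfolding law
    by (rule nn_integral_bind[OF Phi']) (simp only: measurable_distr_eq1 measurable_prob_algebraD[OF k])
  also have "\<dots> = (\<integral>\<^sup>+\<omega>. \<integral>\<^sup>+p. \<Phi> p \<partial>?k (Zv \<omega>) \<partial>P)"
    using measurable_compose[OF measurable_prob_algebraD[OF k] nn_integral_measurable_subprob_algebra[OF Phi']]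
    by (intro nn_integral_distr[OF Zv]) simp
  also have "\<dots> = (\<integral>\<^sup>+\<omega>. \<integral>\<^sup>+e. \<Phi> (Zv \<omega>, e) \<partial>\<kappa> (Zv \<omega>) \<partial>P)"
  proof (intro nn_integral_cong)
    fix \<omega> assume w: "\<omega> \<in> space P"
    have z: "Zv \<omega> \<in> space ?EI" using measurable_space[OF Zv w] .
    interpret k: prob_space "\<kappa> (Zv \<omega>)" by (rule prob_algebraD[OF \<kappa> z])
    have sk: "sets (\<kappa> (Zv \<omega>)) = sets ?BI" by (rule prob_algebraD[OF \<kappa> z])
    have m: "\<Phi> \<in> borel_measurable (return ?EI (Zv \<omega>) \<Otimes>\<^sub>M \<kappa> (Zv \<omega>))"
      using Phi' by (simp only: measurable_cong_sets[OF sets_pair_measure_cong[OF sets_return sk] refl])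
    have m2: "(\<lambda>z. \<integral>\<^sup>+e. \<Phi> (z, e) \<partial>\<kappa> (Zv \<omega>)) \<in> borel_measurable ?EI"
      using k.borel_measurable_nn_integral_fst[OF m] by simp
    show "(\<integral>\<^sup>+p. \<Phi> p \<partial>?k (Zv \<omega>)) = (\<integral>\<^sup>+e. \<Phi> (Zv \<omega>, e) \<partial>\<kappa> (Zv \<omega>))"
      using k.nn_integral_fst[OF m] nn_integral_return[OF z m2] by simp
  qed
  moreover have "\<kappa> (Zv \<omega>) = (\<Pi>\<^sub>M i\<in>I. g (Z i \<omega>))" for \<omega>
    unfolding \<kappa>_def by (rule PiM_cong) (auto simp: Zv_def)
  ultimately show ?thesis
    unfolding Zv_def ev_def I_def by simp
qed

section \<open>Markov operators with a spectral gap\<close>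

lemma L2_norm_of_nonneg: "0 \<le> L2_norm_of \<pi> f"
  by (simp add: L2_norm_of_def)

lemma L2_norm_of_sq: "(L2_norm_of \<pi> f)\<^sup>2 = (\<integral>z. (f z)\<^sup>2 \<partial>\<pi>)"
  by (simp add: L2_norm_of_def)

lemma L2_norm_of_scale: "L2_norm_of \<pi> (\<lambda>z. c * f z) = \<bar>c\<bar> * L2_norm_of \<pi> f"
  by (simp add: L2_norm_of_def power_mult_distrib real_sqrt_mult)

lemma integrable_mult_L2:
  fixes f g :: "'z \<Rightarrow> real"
  assumes [measurable]: "f \<in> borel_measurable \<pi>" "g \<in> borel_measurable \<pi>"
    and "integrable \<pi> (\<lambda>z. (f z)\<^sup>2)" "integrable \<pi> (\<lambda>z. (g z)\<^sup>2)"
  shows "integrable \<pi> (\<lambda>z. f z * g z)"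
proof (rule Bochner_Integration.integrable_bound)
  show "integrable \<pi> (\<lambda>z. (f z)\<^sup>2 + (g z)\<^sup>2)" using assms by auto
  have "\<bar>a * b\<bar> \<le> a\<^sup>2 + b\<^sup>2" for a b :: real
  proof -
    have "0 \<le> (\<bar>a\<bar> - \<bar>b\<bar>)\<^sup>2" by simp
    then have "2 * \<bar>a * b\<bar> \<le> a\<^sup>2 + b\<^sup>2" by (simp add: power2_diff abs_mult)
    then show ?thesis by (smt (verit) sum_power2_ge_zero)
  qed
  then show "AE z in \<pi>. norm (f z * g z) \<le> norm ((f z)\<^sup>2 + (g z)\<^sup>2)" by (simp add: abs_mult)
qed measurable

lemma Cauchy_Schwarz_integral:
  fixes f g :: "'z \<Rightarrow> real"
  assumes f[measurable]: "f \<in> borel_measurable \<pi>" and g[measurable]: "g \<in> borel_measurable \<pi>"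
    and f2: "integrable \<pi> (\<lambda>z. (f z)\<^sup>2)" and g2: "integrable \<pi> (\<lambda>z. (g z)\<^sup>2)"
  shows "\<bar>\<integral>z. f z * g z \<partial>\<pi>\<bar> \<le> L2_norm_of \<pi> f * L2_norm_of \<pi> g"
proof -
  have int: "integrable \<pi> (\<lambda>z. \<bar>f z\<bar> * \<bar>g z\<bar>)"
    using integrable_abs[OF integrable_mult_L2[OF assms]] by (simp add: abs_mult)
  let ?I = "\<integral>z. \<bar>f z\<bar> * \<bar>g z\<bar> \<partial>\<pi>"
  have "(ennreal ?I)\<^sup>2 = (\<integral>\<^sup>+z. ennreal \<bar>f z\<bar> * ennreal \<bar>g z\<bar> \<partial>\<pi>)\<^sup>2"
    using nn_integral_eq_integral[OF int] by (simp add: ennreal_mult)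
  also have "\<dots> \<le> (\<integral>\<^sup>+z. (ennreal \<bar>f z\<bar>)\<^sup>2 \<partial>\<pi>) * (\<integral>\<^sup>+z. (ennreal \<bar>g z\<bar>)\<^sup>2 \<partial>\<pi>)"
    by (rule Cauchy_Schwarz_nn_integral) auto
  also have "\<dots> = ennreal (\<integral>z. (f z)\<^sup>2 \<partial>\<pi>) * ennreal (\<integral>z. (g z)\<^sup>2 \<partial>\<pi>)"
    using nn_integral_eq_integral[OF f2] nn_integral_eq_integral[OF g2] by (simp add: ennreal_power)
  finally have "?I\<^sup>2 \<le> (\<integral>z. (f z)\<^sup>2 \<partial>\<pi>) * (\<integral>z. (g z)\<^sup>2 \<partial>\<pi>)"
    by (simp add: ennreal_power ennreal_mult[symmetric])
  then have "?I\<^sup>2 \<le> (L2_norm_of \<pi> f * L2_norm_of \<pi> g)\<^sup>2" by (simp add: power_mult_distrib L2_norm_of_sq)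
  then have "?I \<le> L2_norm_of \<pi> f * L2_norm_of \<pi> g"
    by (rule power2_le_imp_le) (simp add: L2_norm_of_nonneg)
  moreover have "\<bar>\<integral>z. f z * g z \<partial>\<pi>\<bar> \<le> ?I"
    using integral_abs_bound[of \<pi> "\<lambda>z. f z * g z"] by (simp add: abs_mult)
  ultimately show ?thesis by linarith
qed

lemma L2_norm_of_triangle:
  fixes f g :: "'z \<Rightarrow> real"
  assumes f[measurable]: "f \<in> borel_measurable \<pi>" and g[measurable]: "g \<in> borel_measurable \<pi>"
    and f2: "integrable \<pi> (\<lambda>z. (f z)\<^sup>2)" and g2: "integrable \<pi> (\<lambda>z. (g z)\<^sup>2)"
  shows "L2_norm_of \<pi> (\<lambda>z. f z + g z) \<le> L2_norm_of \<pi> f + L2_norm_of \<pi> g"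
proof (rule power2_le_imp_le)
  have fg: "integrable \<pi> (\<lambda>z. f z * g z)" by (rule integrable_mult_L2[OF assms])
  have "(L2_norm_of \<pi> (\<lambda>z. f z + g z))\<^sup>2 = (\<integral>z. (f z)\<^sup>2 + (g z)\<^sup>2 + 2 * (f z * g z) \<partial>\<pi>)"
    by (simp add: L2_norm_of_sq power2_sum mult.assoc)
  also have "\<dots> = (L2_norm_of \<pi> f)\<^sup>2 + (L2_norm_of \<pi> g)\<^sup>2 + 2 * (\<integral>z. f z * g z \<partial>\<pi>)"
    using f2 g2 fg by (simp add: L2_norm_of_sq)
  also have "\<dots> \<le> (L2_norm_of \<pi> f + L2_norm_of \<pi> g)\<^sup>2"
    using Cauchy_Schwarz_integral[OF assms] by (simp add: power2_sum abs_le_iff)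
  finally show "(L2_norm_of \<pi> (\<lambda>z. f z + g z))\<^sup>2 \<le> (L2_norm_of \<pi> f + L2_norm_of \<pi> g)\<^sup>2" .
qed (simp add: L2_norm_of_nonneg)

lemma L2_norm_of_mono:
  fixes f g :: "'z \<Rightarrow> real"
  assumes "integrable \<pi> (\<lambda>z. (f z)\<^sup>2)" "integrable \<pi> (\<lambda>z. (g z)\<^sup>2)" "\<And>z. z \<in> space \<pi> \<Longrightarrow> \<bar>f z\<bar> \<le> \<bar>g z\<bar>"
  shows "L2_norm_of \<pi> f \<le> L2_norm_of \<pi> g"
  unfolding L2_norm_of_def
  by (intro real_sqrt_le_mono integral_mono assms) (use assms(3) in \<open>simp add: abs_le_square_iff\<close>)

text \<open>The mean is the best constant in L2, so a centred norm may be bounded with any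
  convenient centre.\<close>

lemma (in prob_space) L2_norm_of_center_le:
  fixes f :: "'a \<Rightarrow> real"
  assumes [measurable]: "f \<in> borel_measurable M" and "integrable M (\<lambda>z. (f z)\<^sup>2)" and f: "integrable M f"
  shows "L2_norm_of M (\<lambda>z. f z - expectation f) \<le> L2_norm_of M (\<lambda>z. f z - c)"
proof -
  have 1: "integrable M (\<lambda>z. (f z - c)\<^sup>2)" "(\<integral>z. (f z - c)\<^sup>2 \<partial>M) = (\<integral>z. (f z)\<^sup>2 \<partial>M) - 2 * c * expectation f + c\<^sup>2" for c
    using assms by (auto simp: power2_diff prob_space mult_ac)
  have "0 \<le> (expectation f - c)\<^sup>2" by simp
  then have "(\<integral>z. (f z - expectation f)\<^sup>2 \<partial>M) \<le> (\<integral>z. (f z - c)\<^sup>2 \<partial>M)"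
    unfolding 1 by (simp add: power2_eq_square algebra_simps)
  then show ?thesis by (simp add: L2_norm_of_def)
qed

lemma exp_le_quadratic:
  fixes u :: real assumes "\<bar>u\<bar> \<le> 1" shows "exp u \<le> 1 + u + u\<^sup>2"
proof (cases "0 \<le> u")
  case True then show ?thesis using exp_bound[of u] assms by simp
next
  case False
  define t where "t = - u"
  have t: "0 \<le> t" "t \<le> 1" using False assms by (auto simp: t_def)
  have "1 + t \<le> exp t" by (rule exp_ge_add_one_self)
  \<comment> \<open>The claim for \<open>u = - t\<close> multiplied by \<open>exp t\<close>.
    Replacing \<open>exp t\<close> by \<open>1 + t\<close> makes the product
    \<open>1 + t ^ 3\<close>, which is at least 1.\<close>
  then have "1 \<le> (1 - t + t\<^sup>2) * exp t"
  proof -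
    have a: "0 \<le> 1 - t + t\<^sup>2" using t by (smt (verit) zero_le_power2)
    have "(1 - t + t\<^sup>2) * (1 + t) \<le> (1 - t + t\<^sup>2) * exp t" by (intro mult_left_mono exp_ge_add_one_self a)
    moreover have "(1 - t + t\<^sup>2) * (1 + t) = 1 + t ^ 3" by (simp add: algebra_simps power2_eq_square power3_eq_cube)
    ultimately show ?thesis using t by (smt (verit) zero_le_power)
  qed
  then have "exp (- t) \<le> 1 - t + t\<^sup>2" by (simp add: exp_minus field_simps)
  then show ?thesis by (simp add: t_def)
qed

lemma abs_exp_minus_one_le:
  fixes u :: real assumes "\<bar>u\<bar> \<le> 1" shows "\<bar>exp u - 1\<bar> \<le> 2 * \<bar>u\<bar>"
proof -
  have "\<bar>u\<bar> * \<bar>u\<bar> \<le> 1 * \<bar>u\<bar>" using assms by (intro mult_right_mono) auto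
  then have "u\<^sup>2 \<le> \<bar>u\<bar>" by (simp add: power2_eq_square)
  moreover have "1 + u \<le> exp u" by (rule exp_ge_add_one_self)
  ultimately show ?thesis using exp_le_quadratic[OF assms] by linarith
qed

section \<open>Invariant kernels and the spectral gap\<close>

locale invariant_kernel =
  fixes E :: "'z measure" and K :: "'z \<Rightarrow> 'z measure" and \<pi> :: "'z measure"
  assumes K: "K \<in> E \<rightarrow>\<^sub>M prob_algebra E" and inv: "invariant_prob E K \<pi>"
begin

sublocale prob_space \<pi>
  using inv by (simp add: invariant_prob_def space_prob_algebra)

lemma sets_pi[measurable_cong]: "sets \<pi> = sets E"
  using inv by (simp add: invariant_prob_def space_prob_algebra)

lemma space_pi: "space \<pi> = space E"
  by (rule sets_eq_imp_space_eq[OF sets_pi])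

lemma bind_pi: "\<pi> \<bind> K = \<pi>"
  using inv by (simp add: invariant_prob_def)

lemma K_sub: "K \<in> E \<rightarrow>\<^sub>M subprob_algebra E" "K \<in> \<pi> \<rightarrow>\<^sub>M subprob_algebra E"
  using measurable_prob_algebraD[OF K] by (auto simp: measurable_cong_sets[OF sets_pi refl])

lemma K_prob: "z \<in> space E \<Longrightarrow> prob_space (K z)"
  and sets_K: "z \<in> space E \<Longrightarrow> sets (K z) = sets E"
  and space_K: "z \<in> space E \<Longrightarrow> space (K z) = space E"
  using prob_algebraD[OF K] by auto

lemma markov_op_measurable[measurable]:
  assumes "h \<in> borel_measurable E" shows "markov_op K h \<in> borel_measurable E"
  unfolding markov_op_def
  using measurable_compose[OF K_sub(1) integral_measurable_subprob_algebra[OF assms]] .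

lemma nn_integral_kernel:
  assumes "h \<in> borel_measurable E"
  shows "(\<integral>\<^sup>+z. \<integral>\<^sup>+y. h y \<partial>K z \<partial>\<pi>) = (\<integral>\<^sup>+z. h z \<partial>\<pi>)"
  using nn_integral_bind[OF assms K_sub(2)] by (simp add: bind_pi)

lemma integrable_bounded:
  fixes h :: "'z \<Rightarrow> real"
  assumes "h \<in> borel_measurable E" "\<And>z. z \<in> space E \<Longrightarrow> \<bar>h z\<bar> \<le> C"
  shows "integrable \<pi> h"
  by (rule integrable_const_bound[where B=C]) (use assms space_pi in \<open>auto simp: measurable_cong_sets[OF sets_pi refl]\<close>)

lemma integrable_bounded_sq:
  fixes h :: "'z \<Rightarrow> real"
  assumes [measurable]: "h \<in> borel_measurable E" and b: "\<And>z. z \<in> space E \<Longrightarrow> \<bar>h z\<bar> \<le> C"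
  shows "integrable \<pi> (\<lambda>z. (h z)\<^sup>2)"
proof (rule integrable_bounded[where C="C\<^sup>2"])
  fix z assume "z \<in> space E"
  from power_mono[OF b[OF this] abs_ge_zero, of 2] show "\<bar>(h z)\<^sup>2\<bar> \<le> C\<^sup>2" by simp
qed measurable

lemma integrable_bounded_kernel:
  fixes h :: "'z \<Rightarrow> real"
  assumes "h \<in> borel_measurable E" "\<And>z. z \<in> space E \<Longrightarrow> \<bar>h z\<bar> \<le> C" and z: "z \<in> space E"
  shows "integrable (K z) h"
proof -
  interpret Kz: prob_space "K z" by (rule K_prob[OF z])
  show ?thesis
    by (rule Kz.integrable_const_bound[where B=C])
       (use assms space_K[OF z] in \<open>auto simp: measurable_cong_sets[OF sets_K[OF z] refl]\<close>)
qed

lemma markov_op_bounded: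
  assumes "h \<in> borel_measurable E" "\<And>z. z \<in> space E \<Longrightarrow> \<bar>h z\<bar> \<le> C" "z \<in> space E"
  shows "\<bar>markov_op K h z\<bar> \<le> C"
proof -
  interpret Kz: prob_space "K z" by (rule K_prob[OF assms(3)])
  have i: "integrable (K z) h" by (rule integrable_bounded_kernel[OF assms])
  have "\<bar>markov_op K h z\<bar> \<le> (\<integral>y. \<bar>h y\<bar> \<partial>K z)"
    unfolding markov_op_def by (rule integral_abs_bound)
  also have "\<dots> \<le> (\<integral>y. C \<partial>K z)"
    using i assms(2) space_K[OF assms(3)] by (intro integral_mono) auto
  finally show ?thesis by (simp add: Kz.prob_space)
qed

lemma integral_markov_op:
  assumes "h \<in> borel_measurable E" "\<And>z. z \<in> space E \<Longrightarrow> \<bar>h z\<bar> \<le> C"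
  shows "(\<integral>z. markov_op K h z \<partial>\<pi>) = (\<integral>z. h z \<partial>\<pi>)"
proof -
  have "(\<integral>z. h z \<partial>(\<pi> \<bind> K)) = (\<integral>z. markov_op K h z \<partial>\<pi>)"
    unfolding markov_op_def
    by (rule integral_bind[OF assms(1,2) K_sub(2) finite_measure_axioms, where B'=1])
       (use prob_space.emeasure_space_1[OF K_prob] space_pi in \<open>auto intro!: AE_I2\<close>)
  then show ?thesis by (simp add: bind_pi)
qed

text \<open>Cauchy-Schwarz under each \<open>K z\<close> is a pointwise Jensen inequality, and
  invariance integrates it. It is also what makes the supremum in \<open>markov_op_norm\<close>
  bounded.\<close>

lemma markov_op_L2_contraction:
  fixes h :: "'z \<Rightarrow> real"
  assumes h[measurable]: "h \<in> borel_measurable E" and h2: "integrable \<pi> (\<lambda>z. (h z)\<^sup>2)"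
  shows "L2_norm_of \<pi> (markov_op K h) \<le> L2_norm_of \<pi> h"
proof -
  have pt: "ennreal ((markov_op K h z)\<^sup>2) \<le> (\<integral>\<^sup>+y. ennreal ((h y)\<^sup>2) \<partial>K z)" if z: "z \<in> space E" for z
  proof (cases "integrable (K z) h")
    case True
    interpret Kz: prob_space "K z" by (rule K_prob[OF z])
    have [measurable]: "h \<in> borel_measurable (K z)" by (simp add: measurable_cong_sets[OF sets_K[OF z] refl])
    have "ennreal \<bar>markov_op K h z\<bar> \<le> (\<integral>\<^sup>+y. ennreal \<bar>h y\<bar> * 1 \<partial>K z)"
      unfolding markov_op_def using integral_norm_bound_ennreal[OF True] by simp
    then have "(ennreal \<bar>markov_op K h z\<bar>)\<^sup>2 \<le> (\<integral>\<^sup>+y. ennreal \<bar>h y\<bar> * 1 \<partial>K z)\<^sup>2" by (rule power_mono) simp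
    also have "\<dots> \<le> (\<integral>\<^sup>+y. (ennreal \<bar>h y\<bar>)\<^sup>2 \<partial>K z) * (\<integral>\<^sup>+y. 1\<^sup>2 \<partial>K z)"
      by (rule Cauchy_Schwarz_nn_integral) auto
    finally show ?thesis by (simp add: ennreal_power Kz.emeasure_space_1)
  next
    \<comment> \<open>The integral of a function that is not integrable is 0 by convention, so the
      pointwise bound is trivial here.\<close>
    case False then show ?thesis by (simp add: markov_op_def not_integrable_integral_eq)
  qed
  have "(\<integral>\<^sup>+z. ennreal ((markov_op K h z)\<^sup>2) \<partial>\<pi>) \<le> (\<integral>\<^sup>+z. \<integral>\<^sup>+y. ennreal ((h y)\<^sup>2) \<partial>K z \<partial>\<pi>)"
    by (rule nn_integral_mono) (use pt space_pi in auto)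
  also have "\<dots> = (\<integral>\<^sup>+z. ennreal ((h z)\<^sup>2) \<partial>\<pi>)" by (rule nn_integral_kernel) measurable
  also have "\<dots> = ennreal (\<integral>z. (h z)\<^sup>2 \<partial>\<pi>)" by (rule nn_integral_eq_integral[OF h2]) auto
  finally have le: "(\<integral>\<^sup>+z. ennreal ((markov_op K h z)\<^sup>2) \<partial>\<pi>) \<le> ennreal (\<integral>z. (h z)\<^sup>2 \<partial>\<pi>)" .
  \<comment> \<open>Going through \<open>enn2real\<close> avoids a separate proof that the image is
    square integrable.\<close>
  have "(\<integral>z. (markov_op K h z)\<^sup>2 \<partial>\<pi>) = enn2real (\<integral>\<^sup>+z. ennreal ((markov_op K h z)\<^sup>2) \<partial>\<pi>)"
    by (rule integral_eq_nn_integral) auto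
  also have "\<dots> \<le> (\<integral>z. (h z)\<^sup>2 \<partial>\<pi>)"
    using enn2real_mono[OF le] by simp
  finally show ?thesis by (simp add: L2_norm_of_def)
qed

lemma markov_op_norm_bdd:
  "bdd_above ((\<lambda>h. L2_norm_of \<pi> (markov_op K h)) ` {h \<in> mean_zero_L2 \<pi>. L2_norm_of \<pi> h \<le> 1})"
proof (rule bdd_aboveI2)
  fix h assume "h \<in> {h \<in> mean_zero_L2 \<pi>. L2_norm_of \<pi> h \<le> 1}"
  then show "L2_norm_of \<pi> (markov_op K h) \<le> 1"
    using markov_op_L2_contraction[of h]
    by (auto simp: mean_zero_L2_def measurable_cong_sets[OF sets_pi refl])
qed

lemma markov_op_norm_nonneg: "0 \<le> markov_op_norm K \<pi>"
proof -
  have "(\<lambda>_. 0) \<in> {h \<in> mean_zero_L2 \<pi>. L2_norm_of \<pi> h \<le> 1}" by (simp add: mean_zero_L2_def L2_norm_of_def)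
  from cSUP_upper[OF this markov_op_norm_bdd] show ?thesis
    unfolding markov_op_norm_def using L2_norm_of_nonneg order_trans by blast
qed

text \<open>Homogeneity reduces to the unit ball of the supremum. A function of norm zero cannot be
  normalised; for it plain contraction gives 0.\<close>

lemma markov_op_gap:
  assumes h: "h \<in> mean_zero_L2 \<pi>"
  shows "L2_norm_of \<pi> (markov_op K h) \<le> markov_op_norm K \<pi> * L2_norm_of \<pi> h"
proof (cases "L2_norm_of \<pi> h = 0")
  case True
  then show ?thesis using markov_op_L2_contraction[of h] h
    by (simp add: mean_zero_L2_def measurable_cong_sets[OF sets_pi refl])
next
  case False
  define N where "N = L2_norm_of \<pi> h"
  have N: "0 < N" using False L2_norm_of_nonneg[of \<pi> h] by (simp add: N_def)
  define h' where "h' = (\<lambda>z. (1 / N) * h z)"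
  have "L2_norm_of \<pi> h' = 1" using N unfolding h'_def L2_norm_of_scale by (simp add: N_def[symmetric])
  then have "h' \<in> {h \<in> mean_zero_L2 \<pi>. L2_norm_of \<pi> h \<le> 1}"
    using h by (auto simp: h'_def mean_zero_L2_def power_divide)
  from cSUP_upper[OF this markov_op_norm_bdd]
  have "L2_norm_of \<pi> (markov_op K h') \<le> markov_op_norm K \<pi>" unfolding markov_op_norm_def .
  moreover have "markov_op K h' = (\<lambda>z. (1 / N) * markov_op K h z)"
    unfolding h'_def markov_op_def by simp
  ultimately have "L2_norm_of \<pi> (markov_op K h) / N \<le> markov_op_norm K \<pi>"
    using N by (simp only: L2_norm_of_scale) simp
  then show ?thesis using N by (simp add: N_def[symmetric] field_simps)
qed

text \<open>
  The potential \<open>mean + w \<sqdot> (centred L2 norm)\<close> with \<open>w = 4\<theta>v/(1 - \<gamma>)\<close>: tilting by \<open>exp (\<theta>h)\<close> leaks mass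
  \<open>O(\<theta>v)\<close> between the constant and the centred component, and the spectral gap absorbs the leak.
\<close>

definition tilt_potential :: "real \<Rightarrow> ('z \<Rightarrow> real) \<Rightarrow> real" where
  "tilt_potential w \<phi> = expectation \<phi> + w * L2_norm_of \<pi> (\<lambda>z. \<phi> z - expectation \<phi>)"

text \<open>Tilting couples the mean \<open>a\<close> and the centred norm \<open>b\<close> in both
  directions with amplitude \<open>2 * \<theta> * v\<close>. With the given \<open>w\<close>, the
  leak from \<open>b\<close> to \<open>a\<close> is paid by the gap, while the leak from
  \<open>a\<close> to \<open>b\<close> returns multiplied by \<open>w\<close>, hence of second order
  in \<open>\<theta>\<close>. The first conclusion serves the stationary start of the chain, the
  second each transition.\<close>

lemma tilt_potential_step:
  fixes h \<phi> :: "'z \<Rightarrow> real"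
  assumes h[measurable]: "h \<in> borel_measurable E" and hH: "\<And>z. z \<in> space E \<Longrightarrow> \<bar>h z\<bar> \<le> H"
    and h0: "expectation h = 0" and hv: "(\<integral>z. (h z)\<^sup>2 \<partial>\<pi>) \<le> v\<^sup>2" and v: "0 \<le> v"
    and \<gamma>: "\<gamma> = markov_op_norm K \<pi>" "\<gamma> < 1"
    and \<theta>: "0 \<le> \<theta>" "\<theta> * H \<le> (1 - \<gamma>) / 4"
    and \<phi>[measurable]: "\<phi> \<in> borel_measurable E" and \<phi>0: "\<And>z. z \<in> space E \<Longrightarrow> 0 \<le> \<phi> z"
    and \<phi>C: "\<And>z. z \<in> space E \<Longrightarrow> \<phi> z \<le> C"
    and w: "w = 4 * \<theta> * v / (1 - \<gamma>)"
  defines "\<psi> \<equiv> \<lambda>z. exp (\<theta> * h z) * \<phi> z"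
  shows "expectation \<psi> \<le> (1 + 9 * \<theta>\<^sup>2 * v\<^sup>2 / (1 - \<gamma>)) * tilt_potential w \<phi>"
    and "tilt_potential w (markov_op K \<psi>) \<le> (1 + 9 * \<theta>\<^sup>2 * v\<^sup>2 / (1 - \<gamma>)) * tilt_potential w \<phi>"
proof -
  have \<gamma>0: "0 \<le> \<gamma>" by (simp add: \<gamma>(1) markov_op_norm_nonneg)
  have C: "\<And>z. z \<in> space E \<Longrightarrow> \<bar>\<phi> z\<bar> \<le> C" using \<phi>0 \<phi>C by auto
  have u: "\<bar>\<theta> * h z\<bar> \<le> (1 - \<gamma>) / 4" if "z \<in> space E" for z
    using mult_left_mono[OF hH[OF that] \<theta>(1)] \<theta> by (simp add: abs_mult)
  have u1: "\<bar>\<theta> * h z\<bar> \<le> 1" if "z \<in> space E" for z using u[OF that] \<gamma>0 by simp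
  have e_le: "exp (\<theta> * h z) \<le> 1 + (1 - \<gamma>) / 2" if "z \<in> space E" for z
    using abs_exp_minus_one_le[OF u1[OF that]] u[OF that] by linarith
  \<comment> \<open>Half of the gap is conceded to the growth of the centred part under the tilt;
    this is why \<open>\<theta> * H\<close> is limited to a quarter of the gap.\<close>
  define G where "G = 1 + (1 - \<gamma>) / 2"
  have G: "0 \<le> G" "G \<le> 2" using \<gamma>(2) \<gamma>0 by (auto simp: G_def)
  define e where "e = (\<lambda>z. exp (\<theta> * h z))"
  have e[measurable]: "e \<in> borel_measurable E" unfolding e_def by measurable
  have eG: "\<bar>e z\<bar> \<le> G" if "z \<in> space E" for z using e_le[OF that] by (simp add: e_def G_def)
  have eG1: "\<bar>e z - 1\<bar> \<le> G + 1" if "z \<in> space E" for z using eG[OF that] by linarith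
  define a where "a = expectation \<phi>"
  define \<phi>' where "\<phi>' = (\<lambda>z. \<phi> z - a)"
  have \<phi>'[measurable]: "\<phi>' \<in> borel_measurable E" unfolding \<phi>'_def by measurable
  have C': "\<bar>\<phi>' z\<bar> \<le> C + \<bar>a\<bar>" if "z \<in> space E" for z using C[OF that] unfolding \<phi>'_def by linarith
  define b where "b = L2_norm_of \<pi> \<phi>'"
  have b0: "0 \<le> b" by (simp add: b_def L2_norm_of_nonneg)
  have a0: "0 \<le> a" unfolding a_def by (rule integral_nonneg_AE) (use \<phi>0 space_pi in \<open>auto intro!: AE_I2\<close>)
  have i\<phi>: "integrable \<pi> \<phi>" by (rule integrable_bounded[OF \<phi> C])
  have \<phi>'0: "expectation \<phi>' = 0" unfolding \<phi>'_def using i\<phi> by (simp add: a_def prob_space)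
  have mp: "f \<in> borel_measurable \<pi>" if "f \<in> borel_measurable E" for f :: "'z \<Rightarrow> real"
    using that by (simp add: measurable_cong_sets[OF sets_pi refl])
  have sq: "integrable \<pi> (\<lambda>z. (e z - 1)\<^sup>2)" "integrable \<pi> (\<lambda>z. (\<phi>' z)\<^sup>2)" "integrable \<pi> (\<lambda>z. (h z)\<^sup>2)"
    using eG1 C' hH by (auto intro!: integrable_bounded_sq)
  have i: "integrable \<pi> h" "integrable \<pi> e" "integrable \<pi> \<phi>'"
    using hH eG C' by (auto intro!: integrable_bounded)
  have en: "L2_norm_of \<pi> (\<lambda>z. e z - 1) \<le> 2 * \<theta> * v"
  proof -
    have "L2_norm_of \<pi> (\<lambda>z. e z - 1) \<le> L2_norm_of \<pi> (\<lambda>z. (2 * \<theta>) * h z)"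
    proof (rule L2_norm_of_mono[OF sq(1)])
      show "integrable \<pi> (\<lambda>z. (2 * \<theta> * h z)\<^sup>2)" using sq(3) by (simp add: power_mult_distrib)
      fix z assume "z \<in> space \<pi>"
      then show "\<bar>e z - 1\<bar> \<le> \<bar>2 * \<theta> * h z\<bar>"
        using abs_exp_minus_one_le[OF u1] space_pi by (simp add: e_def abs_mult mult_ac)
    qed
    also have "\<dots> = 2 * \<theta> * L2_norm_of \<pi> h" using \<theta>(1) unfolding L2_norm_of_scale by simp
    also have "\<dots> \<le> 2 * \<theta> * v"
      using hv v \<theta>(1) by (intro mult_left_mono) (auto simp: L2_norm_of_def real_le_lsqrt)
    finally show ?thesis .
  qed
  \<comment> \<open>As \<open>h\<close> has mean zero, the first-order term vanishes and the mean
    grows only quadratically in \<open>\<theta>\<close>.\<close>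
  have Ee: "expectation e \<le> 1 + \<theta>\<^sup>2 * v\<^sup>2"
  proof -
    have "expectation e \<le> expectation (\<lambda>z. 1 + \<theta> * h z + \<theta>\<^sup>2 * (h z)\<^sup>2)"
      by (rule integral_mono)
         (use i sq exp_le_quadratic[OF u1] space_pi in \<open>auto simp: e_def power_mult_distrib\<close>)
    also have "\<dots> = 1 + \<theta> * expectation h + \<theta>\<^sup>2 * expectation (\<lambda>z. (h z)\<^sup>2)"
      using i sq by (simp add: prob_space)
    also have "\<dots> \<le> 1 + \<theta>\<^sup>2 * v\<^sup>2" using hv h0 by (simp add: mult_left_mono)
    finally show ?thesis .
  qed
  have \<psi>[measurable]: "\<psi> \<in> borel_measurable E" unfolding \<psi>_def by measurable
  have \<psi>C: "\<bar>\<psi> z\<bar> \<le> G * C" if "z \<in> space E" for z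
    using mult_mono[OF eG[OF that] C[OF that]] G by (simp add: \<psi>_def e_def abs_mult)
  \<comment> \<open>The last summand has mean zero, so only the small factor \<open>e z - 1\<close>
    lets the centred part influence the mean.\<close>
  have \<psi>_eq: "\<psi> z = a * e z + ((e z - 1) * \<phi>' z + \<phi>' z)" for z
    by (simp add: \<psi>_def e_def \<phi>'_def algebra_simps)
  have ie\<phi>: "integrable \<pi> (\<lambda>z. (e z - 1) * \<phi>' z)"
    by (rule integrable_mult_L2) (use sq mp in auto)
  have "expectation \<psi> = a * expectation e + expectation (\<lambda>z. (e z - 1) * \<phi>' z)"
    unfolding \<psi>_eq using i ie\<phi> \<phi>'0 by simp
  moreover have "expectation (\<lambda>z. (e z - 1) * \<phi>' z) \<le> 2 * \<theta> * v * b"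
  proof -
    have "\<bar>expectation (\<lambda>z. (e z - 1) * \<phi>' z)\<bar> \<le> L2_norm_of \<pi> (\<lambda>z. e z - 1) * L2_norm_of \<pi> \<phi>'"
      by (rule Cauchy_Schwarz_integral) (use sq mp in auto)
    also have "\<dots> \<le> 2 * \<theta> * v * b" unfolding b_def[symmetric] by (rule mult_right_mono[OF en b0])
    finally show ?thesis by simp
  qed
  ultimately have a\<psi>: "expectation \<psi> \<le> a * (1 + \<theta>\<^sup>2 * v\<^sup>2) + 2 * \<theta> * v * b"
    using mult_left_mono[OF Ee a0] by linarith
  define b\<psi> where "b\<psi> = L2_norm_of \<pi> (\<lambda>z. \<psi> z - expectation \<psi>)"
  have i\<psi>: "integrable \<pi> \<psi>" "integrable \<pi> (\<lambda>z. (\<psi> z)\<^sup>2)"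
    using \<psi>C by (auto intro!: integrable_bounded integrable_bounded_sq)
  have b\<psi>: "b\<psi> \<le> 2 * \<theta> * v * a + G * b"
  proof -
    \<comment> \<open>Centred at \<open>a\<close> instead of its own mean, \<open>\<psi>\<close>
      splits into \<open>a\<close> times the small function \<open>e - 1\<close> and a multiple of
      \<open>\<phi>'\<close> with factor at most \<open>G\<close>.\<close>
    have "b\<psi> \<le> L2_norm_of \<pi> (\<lambda>z. \<psi> z - a)"
      unfolding b\<psi>_def by (rule L2_norm_of_center_le) (use mp i\<psi> in auto)
    also have "(\<lambda>z. \<psi> z - a) = (\<lambda>z. a * (e z - 1) + e z * \<phi>' z)"
      by (rule ext) (simp add: \<psi>_eq algebra_simps)
    also have "L2_norm_of \<pi> \<dots> \<le> L2_norm_of \<pi> (\<lambda>z. a * (e z - 1)) + L2_norm_of \<pi> (\<lambda>z. e z * \<phi>' z)"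
    proof (rule L2_norm_of_triangle)
      show "integrable \<pi> (\<lambda>z. (a * (e z - 1))\<^sup>2)" using sq(1) by (simp add: power_mult_distrib)
      have "\<bar>e z * \<phi>' z\<bar> \<le> G * (C + \<bar>a\<bar>)" if "z \<in> space E" for z
        using mult_mono[OF eG[OF that] C'[OF that]] G by (simp add: abs_mult)
      then show "integrable \<pi> (\<lambda>z. (e z * \<phi>' z)\<^sup>2)" by (intro integrable_bounded_sq) auto
    qed (auto intro!: mp)
    also have "L2_norm_of \<pi> (\<lambda>z. a * (e z - 1)) \<le> a * (2 * \<theta> * v)"
      unfolding L2_norm_of_scale using a0 en by (simp add: mult_left_mono)
    also have "L2_norm_of \<pi> (\<lambda>z. e z * \<phi>' z) \<le> L2_norm_of \<pi> (\<lambda>z. G * \<phi>' z)"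
    proof (rule L2_norm_of_mono)
      have "\<bar>e z * \<phi>' z\<bar> \<le> G * (C + \<bar>a\<bar>)" if "z \<in> space E" for z
        using mult_mono[OF eG[OF that] C'[OF that]] G by (simp add: abs_mult)
      then show "integrable \<pi> (\<lambda>z. (e z * \<phi>' z)\<^sup>2)" by (intro integrable_bounded_sq) auto
      show "integrable \<pi> (\<lambda>z. (G * \<phi>' z)\<^sup>2)" using sq(2) by (simp add: power_mult_distrib)
      fix z assume "z \<in> space \<pi>"
      then show "\<bar>e z * \<phi>' z\<bar> \<le> \<bar>G * \<phi>' z\<bar>"
        using eG[of z] G by (simp add: space_pi abs_mult mult_right_mono)
    qed
    also have "\<dots> = G * b" using G unfolding L2_norm_of_scale b_def by simp
    finally show ?thesis by (simp add: mult_ac)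
  qed
  have g1: "0 < 1 - \<gamma>" using \<gamma> by simp
  have w0: "0 \<le> w" using \<theta>(1) v g1 by (simp add: w)
  define R where "R = \<theta>\<^sup>2 * v\<^sup>2 / (1 - \<gamma>)"
  have R0: "0 \<le> R" using g1 by (simp add: R_def)
  have R1: "\<theta>\<^sup>2 * v\<^sup>2 \<le> R"
    unfolding R_def using g1 \<gamma>0 mult_left_mono[of "1 - \<gamma>" 1 "\<theta>\<^sup>2 * v\<^sup>2"] by (simp add: field_simps)
  have pot: "tilt_potential w \<phi> = a + w * b" by (simp add: tilt_potential_def a_def b_def \<phi>'_def)
  have wg: "2 * \<theta> * v = w * ((1 - \<gamma>) / 2)" using g1 by (simp add: w field_simps)
  have wR: "w * (2 * \<theta> * v) = 8 * R" using g1 by (simp add: w R_def field_simps power2_eq_square)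
  \<comment> \<open>The tilt inflates the centred part by \<open>G\<close> and the kernel shrinks it
    by \<open>\<gamma>\<close>. The remaining slack covers \<open>2 * \<theta> * v\<close>, which
    the choice of \<open>w\<close> makes equal to \<open>w * (1 - \<gamma>) / 2\<close>.\<close>
  have coefb: "2 * \<theta> * v + w * (\<gamma> * G) \<le> w"
  proof -
    have "\<gamma> * G + (1 - \<gamma>) / 2 = 1 - (1 - \<gamma>)\<^sup>2 / 2" by (simp add: G_def field_simps power2_eq_square)
    then have "\<gamma> * G + (1 - \<gamma>) / 2 \<le> 1" by simp
    from mult_left_mono[OF this w0] show ?thesis unfolding wg by (simp add: algebra_simps)
  qed
  \<comment> \<open>The 9 is 8 from the returned leak \<open>w * (2 * \<theta> * v) = 8 * R\<close>
    plus 1 from \<open>\<theta>\<^sup>2 * v\<^sup>2 \<le> R\<close>.\<close>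
  have main: "expectation \<psi> + w * (\<gamma> * b\<psi>) \<le> (1 + 9 * \<theta>\<^sup>2 * v\<^sup>2 / (1 - \<gamma>)) * (a + w * b)"
  proof -
    have "w * (\<gamma> * b\<psi>) \<le> w * (\<gamma> * (2 * \<theta> * v * a + G * b))"
      by (intro mult_left_mono b\<psi> \<gamma>0 w0)
    also have "\<dots> = \<gamma> * (w * (2 * \<theta> * v)) * a + w * (\<gamma> * G) * b" by (simp add: algebra_simps)
    also have "\<dots> \<le> 8 * R * a + w * (\<gamma> * G) * b"
      unfolding wR using \<gamma> a0 R0 \<gamma>0 by (intro add_right_mono mult_right_mono) (auto simp: mult_left_le_one_le)
    finally have "expectation \<psi> + w * (\<gamma> * b\<psi>)
        \<le> a * (1 + \<theta>\<^sup>2 * v\<^sup>2) + 8 * R * a + (2 * \<theta> * v + w * (\<gamma> * G)) * b"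
      using a\<psi> by (simp add: algebra_simps)
    also have "\<dots> \<le> a * (1 + R) + 8 * R * a + w * b"
      using R1 coefb a0 b0 by (intro add_mono mult_left_mono mult_right_mono) auto
    also have "\<dots> \<le> (1 + 9 * R) * (a + w * b)"
      using R0 w0 b0 by (simp add: algebra_simps)
    finally show ?thesis by (simp add: R_def mult.assoc)
  qed
  have "0 \<le> w * (\<gamma> * b\<psi>)" using w0 \<gamma>0 by (simp add: b\<psi>_def L2_norm_of_nonneg)
  then show "expectation \<psi> \<le> (1 + 9 * \<theta>\<^sup>2 * v\<^sup>2 / (1 - \<gamma>)) * tilt_potential w \<phi>"
    using main pot by simp
  have E\<psi>: "expectation (markov_op K \<psi>) = expectation \<psi>" by (rule integral_markov_op[OF \<psi> \<psi>C])
  have "L2_norm_of \<pi> (\<lambda>z. markov_op K \<psi> z - expectation \<psi>)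
      = L2_norm_of \<pi> (markov_op K (\<lambda>z. \<psi> z - expectation \<psi>))"
  proof -
    have "markov_op K \<psi> z - expectation \<psi> = markov_op K (\<lambda>z. \<psi> z - expectation \<psi>) z" if z: "z \<in> space \<pi>" for z
    proof -
      interpret Kz: prob_space "K z" using z space_pi by (simp add: K_prob)
      show ?thesis unfolding markov_op_def
        using integrable_bounded_kernel[OF \<psi> \<psi>C] z space_pi by (simp add: Kz.prob_space)
    qed
    then show ?thesis unfolding L2_norm_of_def by (intro arg_cong[where f=sqrt] Bochner_Integration.integral_cong) auto
  qed
  also have "\<dots> \<le> \<gamma> * b\<psi>"
    unfolding \<gamma>(1) b\<psi>_def
  proof (rule markov_op_gap)
    have "integrable \<pi> (\<lambda>z. (\<psi> z - expectation \<psi>)\<^sup>2)"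
      using i\<psi> by (simp add: power2_diff)
    then show "(\<lambda>z. \<psi> z - expectation \<psi>) \<in> mean_zero_L2 \<pi>"
      using mp[OF \<psi>] i\<psi> by (auto simp: mean_zero_L2_def prob_space)
  qed
  finally have "tilt_potential w (markov_op K \<psi>) \<le> expectation \<psi> + w * (\<gamma> * b\<psi>)"
    unfolding tilt_potential_def E\<psi> using w0 by (simp add: mult_left_mono)
  then show "tilt_potential w (markov_op K \<psi>) \<le> (1 + 9 * \<theta>\<^sup>2 * v\<^sup>2 / (1 - \<gamma>)) * tilt_potential w \<phi>"
    using main pot by simp
qed

end

section \<open>Bernstein inequality for Markov chains\<close>

lemma generated_by_compose:
  assumes "\<And>i. i \<in> I \<Longrightarrow> Z i \<in> P \<rightarrow>\<^sub>M E" and "F \<in> (\<Pi>\<^sub>M i\<in>I. E) \<rightarrow>\<^sub>M N"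
  shows "(\<lambda>\<omega>. F (\<lambda>i\<in>I. Z i \<omega>)) \<in> generated_by P E I Z \<rightarrow>\<^sub>M N"
  using measurable_compose[OF generated_by_measurable[OF assms(1)] assms(2)] .

lemma stationary_markov_chainD:
  assumes "stationary_markov_chain P E K \<pi> n Z"
  shows "invariant_kernel E K \<pi>" "\<And>i. i \<in> {1..n} \<Longrightarrow> Z i \<in> P \<rightarrow>\<^sub>M E"
    and "\<And>i. i \<in> {1..n} \<Longrightarrow> distr P E (Z i) = \<pi>"
  using assms by (auto simp: stationary_markov_chain_def invariant_kernel_def)

text \<open>The chain hypothesis concerns single events. Under the measure \<open>D\<close>, whose
  density depends only on the states up to \<open>i\<close>, it says that the law of the next state
  is the law of the current one followed by \<open>K\<close>; this identity of measures covers all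
  nonnegative \<open>\<phi>\<close> at once.\<close>

lemma markov_transition:
  assumes P: "prob_space P" and chain: "stationary_markov_chain P E K \<pi> n Z" and i: "1 \<le> i" "i < n"
    and W: "W \<in> borel_measurable (generated_by P E {1..i} Z)"
    and Wb: "\<And>\<omega>. 0 \<le> W \<omega>" "\<And>\<omega>. \<omega> \<in> space P \<Longrightarrow> W \<omega> \<le> C"
    and \<phi>: "\<phi> \<in> borel_measurable E"
  shows "(\<integral>\<^sup>+\<omega>. ennreal (W \<omega>) * \<phi> (Z (Suc i) \<omega>) \<partial>P)
    = (\<integral>\<^sup>+\<omega>. ennreal (W \<omega>) * (\<integral>\<^sup>+y. \<phi> y \<partial>K (Z i \<omega>)) \<partial>P)"
proof -
  interpret prob_space P by fact
  interpret \<pi>: invariant_kernel E K \<pi> by (rule stationary_markov_chainD[OF chain])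
  have Zm: "Z k \<in> P \<rightarrow>\<^sub>M E" if "k \<in> {1..n}" for k by (rule stationary_markov_chainD(2)[OF chain that])
  have Zi[measurable]: "Z i \<in> P \<rightarrow>\<^sub>M E" and Zs[measurable]: "Z (Suc i) \<in> P \<rightarrow>\<^sub>M E"
    using i by (auto intro!: Zm)
  let ?F = "generated_by P E {1..i} Z"
  have sub: "subalgebra P ?F" by (rule generated_by_subalgebra) (use i Zm in auto)
  interpret F: sigma_finite_subalgebra P ?F by (rule prob_space_sigma_finite_subalgebra) fact+
  have WP[measurable]: "W \<in> borel_measurable P" by (rule measurable_from_subalg[OF sub W])
  define D where "D = density P (\<lambda>\<omega>. ennreal (W \<omega>))"
  have D: "sets D = sets P" by (simp add: D_def)
  have ne: "space (distr D E (Z i)) \<noteq> {}"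
    using not_empty measurable_space[OF Zi] by (metis all_not_in_conv space_distr)
  have ZD: "Z i \<in> D \<rightarrow>\<^sub>M E" "Z (Suc i) \<in> D \<rightarrow>\<^sub>M E" by (simp_all only: measurable_cong_sets[OF D refl] Zi Zs)
  have KD: "K \<in> distr D E (Z i) \<rightarrow>\<^sub>M subprob_algebra E" using \<pi>.K_sub(1) by (simp only: measurable_distr_eq1)
  have law: "distr D E (Z (Suc i)) = distr D E (Z i) \<bind> K"
  proof (rule measure_eqI)
    show "sets (distr D E (Z (Suc i))) = sets (distr D E (Z i) \<bind> K)"
      using sets_bind[OF sets_kernel[OF KD] ne] by simp
    fix A assume "A \<in> sets (distr D E (Z (Suc i)))"
    then have A[measurable]: "A \<in> sets E" by simp
    let ?B = "Z (Suc i) -` A \<inter> space P"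
    have B[measurable]: "?B \<in> sets P" by measurable
    have int: "integrable P (\<lambda>\<omega>. W \<omega> * indicat_real ?B \<omega>)"
    proof (rule integrable_const_bound[where B=C])
      have "norm (W \<omega> * indicat_real ?B \<omega>) \<le> C" if "\<omega> \<in> space P" for \<omega>
        using Wb(1)[of \<omega>] Wb(2)[OF that] by (simp split: split_indicator)
      then show "AE \<omega> in P. norm (W \<omega> * indicat_real ?B \<omega>) \<le> C" by (rule AE_I2)
    qed measurable
    have ae: "AE \<omega> in P. real_cond_exp P ?F (indicat_real ?B) \<omega> = measure (K (Z i \<omega>)) A"
      using chain i A by (simp add: stationary_markov_chain_def)
    have "emeasure (distr D E (Z (Suc i))) A = emeasure D ?B"
      using emeasure_distr[OF ZD(2) A] by (simp add: D_def)
    also have "\<dots> = (\<integral>\<^sup>+\<omega>. ennreal (W \<omega>) * indicator ?B \<omega> \<partial>P)"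
      unfolding D_def by (rule emeasure_density) auto
    also have "\<dots> = (\<integral>\<^sup>+\<omega>. ennreal (W \<omega> * indicat_real ?B \<omega>) \<partial>P)"
      by (intro nn_integral_cong) (auto split: split_indicator)
    also have "\<dots> = ennreal (\<integral>\<omega>. W \<omega> * indicat_real ?B \<omega> \<partial>P)"
      by (rule nn_integral_eq_integral[OF int]) (use Wb in \<open>auto intro!: AE_I2\<close>)
    also have "(\<integral>\<omega>. W \<omega> * indicat_real ?B \<omega> \<partial>P) = (\<integral>\<omega>. W \<omega> * real_cond_exp P ?F (indicat_real ?B) \<omega> \<partial>P)"
      by (rule F.real_cond_exp_intg(2)[OF int W, symmetric]) auto
    also have "ennreal \<dots> = (\<integral>\<^sup>+\<omega>. ennreal (W \<omega> * real_cond_exp P ?F (indicat_real ?B) \<omega>) \<partial>P)"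
    proof (rule nn_integral_eq_integral[symmetric])
      show "integrable P (\<lambda>\<omega>. W \<omega> * real_cond_exp P ?F (indicat_real ?B) \<omega>)"
        by (rule F.real_cond_exp_intg(1)[OF int W]) auto
      show "AE \<omega> in P. 0 \<le> W \<omega> * real_cond_exp P ?F (indicat_real ?B) \<omega>"
        using ae by eventually_elim (use Wb(1) in auto)
    qed
    also have "\<dots> = (\<integral>\<^sup>+\<omega>. ennreal (W \<omega>) * emeasure (K (Z i \<omega>)) A \<partial>P)"
    proof (rule nn_integral_cong_AE)
      show "AE \<omega> in P. ennreal (W \<omega> * real_cond_exp P ?F (indicat_real ?B) \<omega>) = ennreal (W \<omega>) * emeasure (K (Z i \<omega>)) A"
        using ae AE_space
      proof eventually_elim
        case (elim \<omega>)
        interpret k: prob_space "K (Z i \<omega>)" by (rule \<pi>.K_prob[OF measurable_space[OF Zi elim(2)]])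
        show ?case using elim(1) Wb(1) by (simp add: k.emeasure_eq_measure ennreal_mult)
      qed
    qed
    also have "\<dots> = (\<integral>\<^sup>+\<omega>. emeasure (K (Z i \<omega>)) A \<partial>D)"
      unfolding D_def using measurable_compose[OF Zi measurable_emeasure_kernel[OF \<pi>.K_sub(1) A]]
      by (intro nn_integral_density[symmetric]) auto
    also have "\<dots> = (\<integral>\<^sup>+z. emeasure (K z) A \<partial>distr D E (Z i))"
      using measurable_emeasure_kernel[OF \<pi>.K_sub(1) A] by (intro nn_integral_distr[OF ZD(1), symmetric]) simp
    also have "\<dots> = emeasure (distr D E (Z i) \<bind> K) A" by (rule emeasure_bind[OF ne KD A, symmetric])
    finally show "emeasure (distr D E (Z (Suc i))) A = emeasure (distr D E (Z i) \<bind> K) A" .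
  qed
  have K\<phi>: "(\<lambda>z. \<integral>\<^sup>+y. \<phi> y \<partial>K z) \<in> borel_measurable E"
    using measurable_compose[OF \<pi>.K_sub(1) nn_integral_measurable_subprob_algebra[OF \<phi>]] .
  have "(\<integral>\<^sup>+\<omega>. ennreal (W \<omega>) * \<phi> (Z (Suc i) \<omega>) \<partial>P) = (\<integral>\<^sup>+\<omega>. \<phi> (Z (Suc i) \<omega>) \<partial>D)"
    unfolding D_def using measurable_compose[OF Zs \<phi>] by (intro nn_integral_density[symmetric]) auto
  also have "\<dots> = (\<integral>\<^sup>+z. \<phi> z \<partial>distr D E (Z (Suc i)))"
    using \<phi> by (intro nn_integral_distr[OF ZD(2), symmetric]) simp
  also have "\<dots> = (\<integral>\<^sup>+z. \<integral>\<^sup>+y. \<phi> y \<partial>K z \<partial>distr D E (Z i))"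
    unfolding law by (rule nn_integral_bind[OF \<phi> KD])
  also have "\<dots> = (\<integral>\<^sup>+\<omega>. \<integral>\<^sup>+y. \<phi> y \<partial>K (Z i \<omega>) \<partial>D)"
    using K\<phi> by (intro nn_integral_distr[OF ZD(1)]) simp
  also have "\<dots> = (\<integral>\<^sup>+\<omega>. ennreal (W \<omega>) * (\<integral>\<^sup>+y. \<phi> y \<partial>K (Z i \<omega>)) \<partial>P)"
    unfolding D_def using measurable_compose[OF Zi K\<phi>] by (intro nn_integral_density) auto
  finally show ?thesis .
qed

text \<open>\<open>\<phi>\<close> stands for what is left of the steps after \<open>m\<close> once
  they are integrated out. It has to be arbitrary: the induction peels off the last factor, replaces
  \<open>\<phi>\<close> by \<open>markov_op K\<close> of the tilted \<open>\<phi>\<close>, and pays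
  one growth factor of \<open>tilt_potential\<close>. The bound \<open>C\<close> only secures
  integrability and does not enter the estimate.\<close>

lemma markov_chain_mgf_step:
  fixes h :: "nat \<Rightarrow> 'z \<Rightarrow> real"
  assumes P: "prob_space P" and chain: "stationary_markov_chain P E K \<pi> n Z"
    and h: "\<And>k. h k \<in> borel_measurable E" and hH: "\<And>k z. z \<in> space E \<Longrightarrow> \<bar>h k z\<bar> \<le> H"
    and h0: "\<And>k. (\<integral>z. h k z \<partial>\<pi>) = 0" and hv: "\<And>k. (\<integral>z. (h k z)\<^sup>2 \<partial>\<pi>) \<le> v\<^sup>2" and v: "0 \<le> v"
    and \<gamma>: "\<gamma> = markov_op_norm K \<pi>" "\<gamma> < 1"
    and \<theta>: "0 \<le> \<theta>" "\<theta> * H \<le> (1 - \<gamma>) / 4"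
    and w: "w = 4 * \<theta> * v / (1 - \<gamma>)"
    and m: "1 \<le> m" "m \<le> n"
    and \<phi>: "\<phi> \<in> borel_measurable E" and \<phi>0: "\<And>z. z \<in> space E \<Longrightarrow> 0 \<le> \<phi> z"
    and \<phi>C: "\<And>z. z \<in> space E \<Longrightarrow> \<phi> z \<le> C"
  shows "(\<integral>\<^sup>+\<omega>. ennreal (exp (\<theta> * (\<Sum>k=1..m. h k (Z k \<omega>))) * \<phi> (Z m \<omega>)) \<partial>P)
    \<le> ennreal ((1 + 9 * \<theta>\<^sup>2 * v\<^sup>2 / (1 - \<gamma>)) ^ m * invariant_kernel.tilt_potential \<pi> w \<phi>)"
  using m \<phi> \<phi>0 \<phi>C
proof (induction m arbitrary: \<phi> C rule: nat_induct_at_least)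
  case base
  interpret prob_space P by fact
  interpret \<pi>: invariant_kernel E K \<pi> by (rule stationary_markov_chainD[OF chain])
  note [measurable] = h base.prems(2)
  have Z[measurable]: "Z 1 \<in> P \<rightarrow>\<^sub>M E" and dZ: "distr P E (Z 1) = \<pi>"
    using stationary_markov_chainD[OF chain] base by auto
  define \<psi> where "\<psi> = (\<lambda>z. exp (\<theta> * h 1 z) * \<phi> z)"
  have [measurable]: "\<psi> \<in> borel_measurable E" unfolding \<psi>_def by measurable
  have pos: "0 \<le> \<psi> z" if "z \<in> space E" for z using base.prems(3)[OF that] by (simp add: \<psi>_def)
  have b: "\<bar>\<psi> z\<bar> \<le> exp (\<theta> * H) * C" if "z \<in> space E" for z
  proof -
    have "\<theta> * h 1 z \<le> \<theta> * H" using hH[OF that, of 1] \<theta>(1) by (intro mult_left_mono) auto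
    then show ?thesis using base.prems(3,4)[OF that] unfolding \<psi>_def abs_mult
      by (intro mult_mono) auto
  qed
  have "(\<integral>\<^sup>+\<omega>. ennreal (exp (\<theta> * (\<Sum>k=1..1. h k (Z k \<omega>))) * \<phi> (Z 1 \<omega>)) \<partial>P) = (\<integral>\<^sup>+\<omega>. ennreal (\<psi> (Z 1 \<omega>)) \<partial>P)"
    by (simp add: \<psi>_def)
  also have "\<dots> = (\<integral>\<^sup>+z. ennreal (\<psi> z) \<partial>distr P E (Z 1))"
    by (rule nn_integral_distr[OF Z, symmetric]) measurable
  also have "\<dots> = ennreal (\<integral>z. \<psi> z \<partial>\<pi>)"
    unfolding dZ by (rule nn_integral_eq_integral[OF \<pi>.integrable_bounded[OF _ b]])
      (use pos \<pi>.space_pi in \<open>auto intro!: AE_I2\<close>)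
  also have "\<dots> \<le> ennreal ((1 + 9 * \<theta>\<^sup>2 * v\<^sup>2 / (1 - \<gamma>)) ^ 1 * \<pi>.tilt_potential w \<phi>)"
    using \<pi>.tilt_potential_step(1)[OF h hH h0 hv v \<gamma> \<theta> base.prems(2-4) w]
    by (intro ennreal_leI) (simp add: \<psi>_def)
  finally show ?case .
next
  case (Suc m)
  interpret prob_space P by fact
  interpret \<pi>: invariant_kernel E K \<pi> by (rule stationary_markov_chainD[OF chain])
  note [measurable] = h Suc.prems(2)
  define \<psi> where "\<psi> = (\<lambda>z. exp (\<theta> * h (Suc m) z) * \<phi> z)"
  have \<psi>[measurable]: "\<psi> \<in> borel_measurable E" unfolding \<psi>_def by measurable
  have pos: "0 \<le> \<psi> z" if "z \<in> space E" for z using Suc.prems(3)[OF that] by (simp add: \<psi>_def)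
  have b: "\<bar>\<psi> z\<bar> \<le> exp (\<theta> * H) * C" if "z \<in> space E" for z
  proof -
    have "\<theta> * h (Suc m) z \<le> \<theta> * H" using hH[OF that, of "Suc m"] \<theta>(1) by (intro mult_left_mono) auto
    then show ?thesis using Suc.prems(3,4)[OF that] unfolding \<psi>_def abs_mult
      by (intro mult_mono) auto
  qed
  define W where "W = (\<lambda>\<omega>. exp (\<theta> * (\<Sum>k=1..m. h k (Z k \<omega>))))"
  have Zm: "Z k \<in> P \<rightarrow>\<^sub>M E" if "k \<in> {1..n}" for k by (rule stationary_markov_chainD(2)[OF chain that])
  have W: "W \<in> borel_measurable (generated_by P E {1..m} Z)"
  proof -
    have "(\<lambda>\<omega>. (\<lambda>x. exp (\<theta> * (\<Sum>k=1..m. h k (x k)))) (\<lambda>k\<in>{1..m}. Z k \<omega>)) \<in> borel_measurable (generated_by P E {1..m} Z)"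
    proof (rule generated_by_compose)
      show "(\<lambda>x. exp (\<theta> * (\<Sum>k=1..m. h k (x k)))) \<in> borel_measurable (\<Pi>\<^sub>M k\<in>{1..m}. E)"
        by measurable
    qed (use Zm Suc.prems in auto)
    then show ?thesis by (simp add: W_def)
  qed
  have WC: "W \<omega> \<le> exp (\<theta> * (real m * H))" if "\<omega> \<in> space P" for \<omega>
  proof -
    have "(\<Sum>k=1..m. h k (Z k \<omega>)) \<le> (\<Sum>k=1..m. H)"
    proof (rule sum_mono)
      fix k assume "k \<in> {1..m}"
      then have "Z k \<omega> \<in> space E" using measurable_space[OF Zm that] Suc.prems by auto
      from hH[OF this, of k] show "h k (Z k \<omega>) \<le> H" by linarith
    qed
    then show ?thesis using \<theta>(1) by (simp add: W_def mult_left_mono)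
  qed
  have "(\<integral>\<^sup>+\<omega>. ennreal (exp (\<theta> * (\<Sum>k=1..Suc m. h k (Z k \<omega>))) * \<phi> (Z (Suc m) \<omega>)) \<partial>P)
      = (\<integral>\<^sup>+\<omega>. ennreal (W \<omega>) * ennreal (\<psi> (Z (Suc m) \<omega>)) \<partial>P)"
    by (simp add: W_def \<psi>_def ennreal_mult'[symmetric] distrib_left exp_add mult.assoc)
  also have "\<dots> = (\<integral>\<^sup>+\<omega>. ennreal (W \<omega>) * (\<integral>\<^sup>+y. ennreal (\<psi> y) \<partial>K (Z m \<omega>)) \<partial>P)"
    by (rule markov_transition[OF P chain _ _ W _ WC]) (use Suc in \<open>auto simp: W_def\<close>)
  also have "\<dots> = (\<integral>\<^sup>+\<omega>. ennreal (W \<omega> * markov_op K \<psi> (Z m \<omega>)) \<partial>P)"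
  proof (rule nn_integral_cong)
    fix \<omega> assume "\<omega> \<in> space P"
    then have z: "Z m \<omega> \<in> space E" using measurable_space[OF Zm] Suc by auto
    have "(\<integral>\<^sup>+y. ennreal (\<psi> y) \<partial>K (Z m \<omega>)) = ennreal (markov_op K \<psi> (Z m \<omega>))"
      unfolding markov_op_def using pos \<pi>.space_K[OF z]
      by (intro nn_integral_eq_integral \<pi>.integrable_bounded_kernel[OF \<psi> b z]) (auto intro!: AE_I2)
    then show "ennreal (W \<omega>) * (\<integral>\<^sup>+y. ennreal (\<psi> y) \<partial>K (Z m \<omega>)) = ennreal (W \<omega> * markov_op K \<psi> (Z m \<omega>))"
      by (simp add: ennreal_mult' W_def)
  qed
  also have "\<dots> \<le> ennreal ((1 + 9 * \<theta>\<^sup>2 * v\<^sup>2 / (1 - \<gamma>)) ^ m * \<pi>.tilt_potential w (markov_op K \<psi>))"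
    unfolding W_def
  proof (rule Suc.IH)
    show "m \<le> n" using Suc.prems by simp
    show "markov_op K \<psi> \<in> borel_measurable E" by measurable
    fix z assume z: "z \<in> space E"
    show "markov_op K \<psi> z \<le> exp (\<theta> * H) * C" using \<pi>.markov_op_bounded[OF \<psi> b z] by linarith
    show "0 \<le> markov_op K \<psi> z" unfolding markov_op_def
      by (rule integral_nonneg_AE) (use pos \<pi>.space_K[OF z] in \<open>auto intro!: AE_I2\<close>)
  qed
  also have "\<dots> \<le> ennreal ((1 + 9 * \<theta>\<^sup>2 * v\<^sup>2 / (1 - \<gamma>)) ^ m * ((1 + 9 * \<theta>\<^sup>2 * v\<^sup>2 / (1 - \<gamma>)) * \<pi>.tilt_potential w \<phi>))"
    using \<pi>.tilt_potential_step(2)[OF h hH h0 hv v \<gamma> \<theta> Suc.prems(2-4) w] \<gamma>(2)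
    by (intro ennreal_leI mult_left_mono zero_le_power) (auto simp: \<psi>_def)
  finally show ?case by (simp only: power_Suc mult_ac)
qed

text \<open>The backward recursion starts at the constant 1, which has mean 1 and centred norm 0;
  its potential is 1, so no prefactor appears.\<close>

lemma markov_chain_mgf:
  fixes h :: "nat \<Rightarrow> 'z \<Rightarrow> real"
  assumes P: "prob_space P" and chain: "stationary_markov_chain P E K \<pi> n Z" and n: "1 \<le> n"
    and h: "\<And>k. h k \<in> borel_measurable E" and hH: "\<And>k z. z \<in> space E \<Longrightarrow> \<bar>h k z\<bar> \<le> H"
    and h0: "\<And>k. (\<integral>z. h k z \<partial>\<pi>) = 0" and hv: "\<And>k. (\<integral>z. (h k z)\<^sup>2 \<partial>\<pi>) \<le> v\<^sup>2" and v: "0 \<le> v"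
    and \<gamma>: "\<gamma> = markov_op_norm K \<pi>" "\<gamma> < 1"
    and \<theta>: "0 \<le> \<theta>" "\<theta> * H \<le> (1 - \<gamma>) / 4"
  shows "(\<integral>\<^sup>+\<omega>. ennreal (exp (\<theta> * (\<Sum>k=1..n. h k (Z k \<omega>)))) \<partial>P)
    \<le> ennreal (exp (9 * real n * \<theta>\<^sup>2 * v\<^sup>2 / (1 - \<gamma>)))"
proof -
  interpret \<pi>: invariant_kernel E K \<pi> by (rule stationary_markov_chainD[OF chain])
  let ?x = "9 * \<theta>\<^sup>2 * v\<^sup>2 / (1 - \<gamma>)"
  have "(\<integral>\<^sup>+\<omega>. ennreal (exp (\<theta> * (\<Sum>k=1..n. h k (Z k \<omega>)))) \<partial>P)
      \<le> ennreal ((1 + ?x) ^ n * \<pi>.tilt_potential (4 * \<theta> * v / (1 - \<gamma>)) (\<lambda>_. 1))"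
    using markov_chain_mgf_step[OF P chain h hH h0 hv v \<gamma> \<theta> refl n order_refl, of "\<lambda>_. 1" 1] by simp
  also have "\<pi>.tilt_potential (4 * \<theta> * v / (1 - \<gamma>)) (\<lambda>_. 1) = 1"
    by (simp add: \<pi>.tilt_potential_def \<pi>.prob_space L2_norm_of_def)
  also have "(1 + ?x) ^ n * 1 \<le> exp (real n * ?x)"
    unfolding exp_of_nat_mult using \<gamma>(2) by (simp add: power_mono exp_ge_add_one_self)
  finally show ?thesis by (simp add: mult_ac ennreal_leI)
qed

text \<open>Centring at most doubles the bound, to \<open>2 * B\<close>, and does not increase the
  second moment; the quarter of the gap in \<open>markov_chain_mgf\<close> thus becomes the 8 in the
  condition on \<open>\<theta>\<close>. The parameter stays free, to be matched later to the
  truncation level.\<close>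

theorem markov_chain_Bernstein:
  fixes f :: "nat \<Rightarrow> 'z \<Rightarrow> real"
  assumes P: "prob_space P" and chain: "stationary_markov_chain P E K \<pi> n Z" and n: "1 \<le> n"
    and f: "\<And>k. f k \<in> borel_measurable E" and fB: "\<And>k z. z \<in> space E \<Longrightarrow> \<bar>f k z\<bar> \<le> B"
    and fv: "\<And>k. (\<integral>z. (f k z)\<^sup>2 \<partial>\<pi>) \<le> v\<^sup>2" and v: "0 \<le> v"
    and \<gamma>: "\<gamma> = markov_op_norm K \<pi>" "\<gamma> < 1"
    and \<theta>: "0 < \<theta>" "8 * \<theta> * B \<le> 1 - \<gamma>"
  shows "measure P {\<omega> \<in> space P. t \<le> \<bar>\<Sum>k=1..n. f k (Z k \<omega>) - (\<integral>z. f k z \<partial>\<pi>)\<bar>}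
    \<le> 2 * exp (9 * real n * \<theta>\<^sup>2 * v\<^sup>2 / (1 - \<gamma>) - \<theta> * t)"
proof -
  interpret prob_space P by fact
  interpret \<pi>: invariant_kernel E K \<pi> by (rule stationary_markov_chainD[OF chain])
  note [measurable] = f
  have [measurable]: "Z k \<in> P \<rightarrow>\<^sub>M E" if "k \<in> {1..n}" for k by (rule stationary_markov_chainD(2)[OF chain that])
  have side: "measure P {\<omega> \<in> space P. t \<le> (\<Sum>k=1..n. h k (Z k \<omega>))} \<le> exp (9 * real n * \<theta>\<^sup>2 * v\<^sup>2 / (1 - \<gamma>) - \<theta> * t)"
    if h_def: "h = (\<lambda>k z. c * (f k z - (\<integral>z. f k z \<partial>\<pi>)))" and c: "\<bar>c\<bar> = 1" for h c
  proof -
    have h[measurable]: "h k \<in> borel_measurable E" for k unfolding h_def by measurable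
    have i: "integrable \<pi> (f k)" "integrable \<pi> (\<lambda>z. (f k z)\<^sup>2)" for k
      using fB by (auto intro!: \<pi>.integrable_bounded \<pi>.integrable_bounded_sq)
    have "\<bar>\<integral>z. f k z \<partial>\<pi>\<bar> \<le> B" for k
    proof -
      have "\<bar>\<integral>z. f k z \<partial>\<pi>\<bar> \<le> (\<integral>z. \<bar>f k z\<bar> \<partial>\<pi>)" by (rule integral_abs_bound)
      also have "\<dots> \<le> (\<integral>z. B \<partial>\<pi>)" using i fB \<pi>.space_pi by (intro integral_mono) auto
      finally show ?thesis by (simp add: \<pi>.prob_space)
    qed
    then have hH: "\<bar>h k z\<bar> \<le> 2 * B" if "z \<in> space E" for k z
      using fB[OF that, of k] c unfolding h_def abs_mult by (simp add: abs_le_iff) (smt (verit))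
    have h0: "(\<integral>z. h k z \<partial>\<pi>) = 0" for k using i unfolding h_def by (simp add: \<pi>.prob_space)
    have hv: "(\<integral>z. (h k z)\<^sup>2 \<partial>\<pi>) \<le> v\<^sup>2" for k
    proof -
      have "c\<^sup>2 = 1" using c by (metis power2_abs power_one)
      then have "L2_norm_of \<pi> (h k) = L2_norm_of \<pi> (\<lambda>z. f k z - (\<integral>z. f k z \<partial>\<pi>))"
        by (simp add: L2_norm_of_def h_def power_mult_distrib)
      also have "\<dots> \<le> L2_norm_of \<pi> (\<lambda>z. f k z - 0)"
        by (rule \<pi>.L2_norm_of_center_le) (use i in \<open>auto simp: measurable_cong_sets[OF \<pi>.sets_pi refl]\<close>)
      finally have "(L2_norm_of \<pi> (h k))\<^sup>2 \<le> (L2_norm_of \<pi> (f k))\<^sup>2"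
        by (simp add: L2_norm_of_nonneg power_mono)
      then show ?thesis using fv[of k] by (simp add: L2_norm_of_sq)
    qed
    have "emeasure P {\<omega> \<in> space P. t \<le> (\<Sum>k=1..n. h k (Z k \<omega>))}
      \<le> ennreal (exp (- \<theta> * t)) * (\<integral>\<^sup>+\<omega>. ennreal (exp (\<theta> * (\<Sum>k=1..n. h k (Z k \<omega>)))) * indicator (space P) \<omega> \<partial>P)"
      by (rule Chernoff_ineq_nn_integral_ge) (use \<theta> in measurable)
    also have "(\<integral>\<^sup>+\<omega>. ennreal (exp (\<theta> * (\<Sum>k=1..n. h k (Z k \<omega>)))) * indicator (space P) \<omega> \<partial>P)
        = (\<integral>\<^sup>+\<omega>. ennreal (exp (\<theta> * (\<Sum>k=1..n. h k (Z k \<omega>)))) \<partial>P)"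
      by (rule nn_integral_cong) auto
    also have "\<dots> \<le> ennreal (exp (9 * real n * \<theta>\<^sup>2 * v\<^sup>2 / (1 - \<gamma>)))"
      by (rule markov_chain_mgf[OF P chain n h hH h0 hv v \<gamma>]) (use \<theta> in auto)
    finally have "emeasure P {\<omega> \<in> space P. t \<le> (\<Sum>k=1..n. h k (Z k \<omega>))}
      \<le> ennreal (exp (- \<theta> * t)) * ennreal (exp (9 * real n * \<theta>\<^sup>2 * v\<^sup>2 / (1 - \<gamma>)))"
      by (simp add: mult_left_mono)
    also have "\<dots> = ennreal (exp (9 * real n * \<theta>\<^sup>2 * v\<^sup>2 / (1 - \<gamma>) - \<theta> * t))"
      by (simp add: ennreal_mult[symmetric] exp_add[symmetric])
    finally show ?thesis by (simp add: emeasure_eq_measure)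
  qed
  define h where "h k z = f k z - (\<integral>z. f k z \<partial>\<pi>)" for k z
  have [measurable]: "h k \<in> borel_measurable E" for k unfolding h_def by measurable
  let ?S = "\<lambda>\<omega>. \<Sum>k=1..n. h k (Z k \<omega>)"
  have "{\<omega> \<in> space P. t \<le> \<bar>?S \<omega>\<bar>} \<subseteq> {\<omega> \<in> space P. t \<le> ?S \<omega>} \<union> {\<omega> \<in> space P. t \<le> (\<Sum>k=1..n. - 1 * h k (Z k \<omega>))}"
    by (auto simp: sum_negf)
  then have "measure P {\<omega> \<in> space P. t \<le> \<bar>?S \<omega>\<bar>}
      \<le> measure P ({\<omega> \<in> space P. t \<le> ?S \<omega>} \<union> {\<omega> \<in> space P. t \<le> (\<Sum>k=1..n. - 1 * h k (Z k \<omega>))})"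
    by (intro finite_measure_mono) measurable
  also have "\<dots> \<le> measure P {\<omega> \<in> space P. t \<le> ?S \<omega>} + measure P {\<omega> \<in> space P. t \<le> (\<Sum>k=1..n. - 1 * h k (Z k \<omega>))}"
    by (rule measure_Un_le) measurable
  also have "\<dots> \<le> 2 * exp (9 * real n * \<theta>\<^sup>2 * v\<^sup>2 / (1 - \<gamma>) - \<theta> * t)"
    using side[of "\<lambda>k z. 1 * h k z" 1] side[of "\<lambda>k z. - 1 * h k z" "-1"] unfolding h_def by simp
  finally show ?thesis by (simp add: h_def)
qed

section \<open>Conditional moments of the errors\<close>

lemma cond_indep_prod:
  fixes F :: "nat \<Rightarrow> 'z \<times> real \<Rightarrow> ennreal"
  assumes P: "prob_space P" and Z: "\<And>i. i \<in> {1..n} \<Longrightarrow> Z i \<in> P \<rightarrow>\<^sub>M E"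
    and err: "cond_indep_errors P E n Z g \<epsilon>"
    and F: "\<And>i. i \<in> {1..n} \<Longrightarrow> F i \<in> borel_measurable (E \<Otimes>\<^sub>M borel)"
  shows "(\<integral>\<^sup>+\<omega>. (\<Prod>i=1..n. F i (Z i \<omega>, \<epsilon> i \<omega>)) \<partial>P)
    = (\<integral>\<^sup>+\<omega>. (\<Prod>i=1..n. \<integral>\<^sup>+e. F i (Z i \<omega>, e) \<partial>g (Z i \<omega>)) \<partial>P)"
proof -
  have g: "g \<in> E \<rightarrow>\<^sub>M prob_algebra borel" using err by (simp add: cond_indep_errors_def)
  define \<Phi> where "\<Phi> = (\<lambda>(z, e). \<Prod>i=1..n. F i (z i, e i))"
  have "(\<lambda>p. F i (fst p i, snd p i)) \<in> borel_measurable ((\<Pi>\<^sub>M i\<in>{1..n}. E) \<Otimes>\<^sub>M (\<Pi>\<^sub>M i\<in>{1..n}. borel))"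
    if i: "i \<in> {1..n}" for i
    by (rule measurable_compose[OF _ F[OF i]]) (use i in measurable)
  then have Phi: "\<Phi> \<in> borel_measurable ((\<Pi>\<^sub>M i\<in>{1..n}. E) \<Otimes>\<^sub>M (\<Pi>\<^sub>M i\<in>{1..n}. borel))"
    unfolding \<Phi>_def split_beta' by (intro borel_measurable_prod_ennreal) auto
  have "(\<integral>\<^sup>+\<omega>. (\<Prod>i=1..n. F i (Z i \<omega>, \<epsilon> i \<omega>)) \<partial>P)
      = (\<integral>\<^sup>+\<omega>. \<Phi> (\<lambda>i\<in>{1..n}. Z i \<omega>, \<lambda>i\<in>{1..n}. \<epsilon> i \<omega>) \<partial>P)"
    by (simp add: \<Phi>_def)
  also have "\<dots> = (\<integral>\<^sup>+\<omega>. \<integral>\<^sup>+e. \<Phi> (\<lambda>i\<in>{1..n}. Z i \<omega>, e) \<partial>(\<Pi>\<^sub>M i\<in>{1..n}. g (Z i \<omega>)) \<partial>P)"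
    by (rule cond_indep_nn_integral[OF P Z err Phi])
  also have "\<dots> = (\<integral>\<^sup>+\<omega>. (\<Prod>i=1..n. \<integral>\<^sup>+e. F i (Z i \<omega>, e) \<partial>g (Z i \<omega>)) \<partial>P)"
  proof (rule nn_integral_cong)
    fix \<omega> assume w: "\<omega> \<in> space P"
    have z: "Z i \<omega> \<in> space E" if "i \<in> {1..n}" for i using measurable_space[OF Z[OF that] w] .
    have "(\<integral>\<^sup>+e. \<Phi> (\<lambda>i\<in>{1..n}. Z i \<omega>, e) \<partial>(\<Pi>\<^sub>M i\<in>{1..n}. g (Z i \<omega>)))
        = (\<integral>\<^sup>+e. (\<Prod>i\<in>{1..n}. F i (Z i \<omega>, e i)) \<partial>(\<Pi>\<^sub>M i\<in>{1..n}. g (Z i \<omega>)))"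
      by (simp add: \<Phi>_def)
    also have "\<dots> = (\<Prod>i\<in>{1..n}. \<integral>\<^sup>+e. F i (Z i \<omega>, e) \<partial>g (Z i \<omega>))"
    proof (rule nn_integral_PiM_prod)
      fix i assume i: "i \<in> {1..n}"
      show "prob_space (g (Z i \<omega>))" by (rule prob_algebraD[OF g z[OF i]])
      have "(\<lambda>e. F i (Z i \<omega>, e)) \<in> borel_measurable borel"
        using measurable_compose[OF measurable_Pair1'[OF z[OF i]] F[OF i]] .
      then show "(\<lambda>e. F i (Z i \<omega>, e)) \<in> borel_measurable (g (Z i \<omega>))"
        by (simp only: measurable_cong_sets[OF prob_algebraD(2)[OF g z[OF i]] refl])
    qed simp
    finally show "(\<integral>\<^sup>+e. \<Phi> (\<lambda>i\<in>{1..n}. Z i \<omega>, e) \<partial>(\<Pi>\<^sub>M i\<in>{1..n}. g (Z i \<omega>)))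
        = (\<Prod>i=1..n. \<integral>\<^sup>+e. F i (Z i \<omega>, e) \<partial>g (Z i \<omega>))" .
  qed
  finally show ?thesis .
qed

text \<open>The factors at all other indices are taken to be 1, and so are their kernel
  integrals.\<close>

lemma cond_indep_single:
  fixes F :: "'z \<times> real \<Rightarrow> ennreal"
  assumes P: "prob_space P" and Z: "\<And>i. i \<in> {1..n} \<Longrightarrow> Z i \<in> P \<rightarrow>\<^sub>M E"
    and err: "cond_indep_errors P E n Z g \<epsilon>" and i: "i \<in> {1..n}"
    and F: "F \<in> borel_measurable (E \<Otimes>\<^sub>M borel)"
  shows "(\<integral>\<^sup>+\<omega>. F (Z i \<omega>, \<epsilon> i \<omega>) \<partial>P) = (\<integral>\<^sup>+\<omega>. \<integral>\<^sup>+e. F (Z i \<omega>, e) \<partial>g (Z i \<omega>) \<partial>P)"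
proof -
  have g: "g \<in> E \<rightarrow>\<^sub>M prob_algebra borel" using err by (simp add: cond_indep_errors_def)
  define G where "G j p = (if j = i then F p else 1)" for j p
  have "(\<integral>\<^sup>+\<omega>. (\<Prod>j=1..n. G j (Z j \<omega>, \<epsilon> j \<omega>)) \<partial>P)
      = (\<integral>\<^sup>+\<omega>. (\<Prod>j=1..n. \<integral>\<^sup>+e. G j (Z j \<omega>, e) \<partial>g (Z j \<omega>)) \<partial>P)"
    using F by (intro cond_indep_prod[OF P Z err]) (auto simp: G_def[abs_def])
  also have "\<dots> = (\<integral>\<^sup>+\<omega>. \<integral>\<^sup>+e. F (Z i \<omega>, e) \<partial>g (Z i \<omega>) \<partial>P)"
  proof (rule nn_integral_cong)
    fix \<omega> assume w: "\<omega> \<in> space P"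
    have "(\<integral>\<^sup>+e. G j (Z j \<omega>, e) \<partial>g (Z j \<omega>)) = (if j = i then \<integral>\<^sup>+e. F (Z i \<omega>, e) \<partial>g (Z i \<omega>) else 1)"
      if j: "j \<in> {1..n}" for j
      using prob_space.emeasure_space_1[OF prob_algebraD(1)[OF g measurable_space[OF Z[OF j] w]]]
      by (simp add: G_def)
    then have "(\<Prod>j=1..n. \<integral>\<^sup>+e. G j (Z j \<omega>, e) \<partial>g (Z j \<omega>))
        = (\<Prod>j=1..n. if j = i then \<integral>\<^sup>+e. F (Z i \<omega>, e) \<partial>g (Z i \<omega>) else 1)"
      by (intro prod.cong) auto
    then show "(\<Prod>j=1..n. \<integral>\<^sup>+e. G j (Z j \<omega>, e) \<partial>g (Z j \<omega>)) = (\<integral>\<^sup>+e. F (Z i \<omega>, e) \<partial>g (Z i \<omega>))"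
      using i by (simp add: prod.delta)
  qed
  also have "(\<integral>\<^sup>+\<omega>. (\<Prod>j=1..n. G j (Z j \<omega>, \<epsilon> j \<omega>)) \<partial>P) = (\<integral>\<^sup>+\<omega>. F (Z i \<omega>, \<epsilon> i \<omega>) \<partial>P)"
  proof (rule nn_integral_cong)
    fix \<omega>
    have "(\<Prod>j=1..n. G j (Z j \<omega>, \<epsilon> j \<omega>)) = (\<Prod>j=1..n. if j = i then F (Z i \<omega>, \<epsilon> i \<omega>) else 1)"
      by (intro prod.cong) (auto simp: G_def)
    then show "(\<Prod>j=1..n. G j (Z j \<omega>, \<epsilon> j \<omega>)) = F (Z i \<omega>, \<epsilon> i \<omega>)" using i by (simp add: prod.delta)
  qed
  finally show ?thesis .
qed

text \<open>Pushing \<open>g z\<close> forward to the law of the pair \<open>(z, e)\<close> makes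
  the integrand free of the parameter, which then occurs only in the kernel.\<close>

lemma borel_measurable_kernel_integral:
  fixes F :: "'z \<times> 'e \<Rightarrow> real"
  assumes g[measurable]: "g \<in> E \<rightarrow>\<^sub>M prob_algebra N" and F[measurable]: "F \<in> borel_measurable (E \<Otimes>\<^sub>M N)"
  shows "(\<lambda>z. \<integral>e. F (z, e) \<partial>g z) \<in> borel_measurable E"
proof -
  have k: "(\<lambda>z. distr (g z) (E \<Otimes>\<^sub>M N) (Pair z)) \<in> E \<rightarrow>\<^sub>M prob_algebra (E \<Otimes>\<^sub>M N)"
    by measurable
  have "(\<lambda>z. \<integral>p. F p \<partial>distr (g z) (E \<Otimes>\<^sub>M N) (Pair z)) \<in> borel_measurable E"
    using measurable_compose[OF measurable_prob_algebraD[OF k] integral_measurable_subprob_algebra[OF F]] .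
  moreover have "(\<integral>p. F p \<partial>distr (g z) (E \<Otimes>\<^sub>M N) (Pair z)) = (\<integral>e. F (z, e) \<partial>g z)" if z: "z \<in> space E" for z
  proof (rule integral_distr[OF _ F])
    show "Pair z \<in> g z \<rightarrow>\<^sub>M E \<Otimes>\<^sub>M N"
      using measurable_Pair1'[OF z] by (simp only: measurable_cong_sets[OF prob_algebraD(2)[OF g z] refl])
  qed
  ultimately show ?thesis by (simp cong: measurable_cong)
qed

lemma cond_indep_single_integral:
  fixes F :: "'z \<times> real \<Rightarrow> real"
  assumes P: "prob_space P" and Z: "\<And>i. i \<in> {1..n} \<Longrightarrow> Z i \<in> P \<rightarrow>\<^sub>M E"
    and err: "cond_indep_errors P E n Z g \<epsilon>" and i: "i \<in> {1..n}"
    and F: "F \<in> borel_measurable (E \<Otimes>\<^sub>M borel)"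
    and int: "integrable P (\<lambda>\<omega>. F (Z i \<omega>, \<epsilon> i \<omega>))"
  shows "(\<integral>\<omega>. F (Z i \<omega>, \<epsilon> i \<omega>) \<partial>P) = (\<integral>\<omega>. \<integral>e. F (Z i \<omega>, e) \<partial>g (Z i \<omega>) \<partial>P)"
    and "integrable P (\<lambda>\<omega>. \<integral>e. F (Z i \<omega>, e) \<partial>g (Z i \<omega>))"
proof -
  have g: "g \<in> E \<rightarrow>\<^sub>M prob_algebra borel" using err by (simp add: cond_indep_errors_def)
  note F[measurable]
  have Zi[measurable]: "Z i \<in> P \<rightarrow>\<^sub>M E" by (rule Z[OF i])
  \<comment> \<open>\<open>ennreal\<close> sends negative numbers to 0, so \<open>p 1\<close> and
    \<open>p (-1)\<close> are the kernel integrals of the positive and the negative part.\<close>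
  define p where "p s \<omega> = (\<integral>\<^sup>+e. ennreal (s * F (Z i \<omega>, e)) \<partial>g (Z i \<omega>))" for s \<omega>
  have p[measurable]: "p s \<in> borel_measurable P" for s
  proof -
    have "(\<lambda>z. \<integral>\<^sup>+e. ennreal (s * F (z, e)) \<partial>g z) \<in> borel_measurable E"
      by (rule nn_integral_measurable_subprob_algebra2[OF _ measurable_prob_algebraD[OF g]]) measurable
    from measurable_compose[OF Zi this] show ?thesis by (simp add: p_def[abs_def])
  qed
  have pint: "(\<integral>\<^sup>+\<omega>. ennreal (s * F (Z i \<omega>, \<epsilon> i \<omega>)) \<partial>P) = (\<integral>\<^sup>+\<omega>. p s \<omega> \<partial>P)" for s
    unfolding p_def by (rule cond_indep_single[OF P Z err i]) measurable
  have fin: "(\<integral>\<^sup>+\<omega>. p s \<omega> \<partial>P) < \<infinity>" for s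
  proof -
    have "integrable P (\<lambda>\<omega>. s * F (Z i \<omega>, \<epsilon> i \<omega>))" using int by simp
    then have lt: "(\<integral>\<^sup>+\<omega>. ennreal (norm (s * F (Z i \<omega>, \<epsilon> i \<omega>))) \<partial>P) < \<infinity>" unfolding integrable_iff_bounded by blast
    have "(\<integral>\<^sup>+\<omega>. ennreal (s * F (Z i \<omega>, \<epsilon> i \<omega>)) \<partial>P) \<le> (\<integral>\<^sup>+\<omega>. ennreal (norm (s * F (Z i \<omega>, \<epsilon> i \<omega>))) \<partial>P)"
      by (intro nn_integral_mono ennreal_leI) simp
    then show ?thesis using lt unfolding pint by (rule order.strict_trans1)
  qed
  have ae: "AE \<omega> in P. p s \<omega> \<noteq> \<infinity>" for s
    by (rule nn_integral_PInf_AE) (use fin[of s] in auto)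
  have inner: "AE \<omega> in P. (\<integral>e. F (Z i \<omega>, e) \<partial>g (Z i \<omega>)) = enn2real (p 1 \<omega>) - enn2real (p (-1) \<omega>)"
    using ae[of 1] ae[of "-1"] AE_space
  proof eventually_elim
    case (elim \<omega>)
    have z: "Z i \<omega> \<in> space E" using measurable_space[OF Zi elim(3)] .
    have "(\<lambda>e. F (Z i \<omega>, e)) \<in> borel_measurable borel"
      using measurable_compose[OF measurable_Pair1'[OF z] F] .
    then have m: "(\<lambda>e. F (Z i \<omega>, e)) \<in> borel_measurable (g (Z i \<omega>))"
      by (simp only: measurable_cong_sets[OF prob_algebraD(2)[OF g z] refl])
    have "integrable (g (Z i \<omega>)) (\<lambda>e. F (Z i \<omega>, e))"
      using elim(1,2) m by (simp add: real_integrable_def p_def)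
    then show ?case by (simp add: real_lebesgue_integral_def p_def)
  qed
  have e2r: "(\<integral>\<^sup>+\<omega>. ennreal (enn2real (p s \<omega>)) \<partial>P) = (\<integral>\<^sup>+\<omega>. p s \<omega> \<partial>P)" for s
    using ae[of s] by (intro nn_integral_cong_AE) (auto simp: ennreal_enn2real top.not_eq_extremum)
  have ip: "integrable P (\<lambda>\<omega>. enn2real (p s \<omega>))" for s
    using fin[of s] e2r[of s] by (simp add: integrable_iff_bounded)
  have vp: "(\<integral>\<omega>. enn2real (p s \<omega>) \<partial>P) = enn2real (\<integral>\<^sup>+\<omega>. p s \<omega> \<partial>P)" for s
    using integral_eq_nn_integral[of "\<lambda>\<omega>. enn2real (p s \<omega>)" P] e2r[of s] by simp
  have mi: "(\<lambda>\<omega>. \<integral>e. F (Z i \<omega>, e) \<partial>g (Z i \<omega>)) \<in> borel_measurable P"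
  proof -
    have "(\<lambda>z. \<integral>e. F (z, e) \<partial>g z) \<in> borel_measurable E"
      by (rule borel_measurable_kernel_integral[OF g F])
    from measurable_compose[OF Zi this] show ?thesis .
  qed
  have "(\<integral>\<omega>. \<integral>e. F (Z i \<omega>, e) \<partial>g (Z i \<omega>) \<partial>P) = (\<integral>\<omega>. enn2real (p 1 \<omega>) - enn2real (p (-1) \<omega>) \<partial>P)"
    by (rule integral_cong_AE[OF mi _ inner]) measurable
  also have "\<dots> = (\<integral>\<omega>. F (Z i \<omega>, \<epsilon> i \<omega>) \<partial>P)"
    using real_lebesgue_integral_def[OF int] pint[of 1] pint[of "-1"] ip vp by simp
  finally show "(\<integral>\<omega>. F (Z i \<omega>, \<epsilon> i \<omega>) \<partial>P) = (\<integral>\<omega>. \<integral>e. F (Z i \<omega>, e) \<partial>g (Z i \<omega>) \<partial>P)" ..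
  show "integrable P (\<lambda>\<omega>. \<integral>e. F (Z i \<omega>, e) \<partial>g (Z i \<omega>))"
    by (rule integrable_cong_AE_imp[OF _ mi]) (use ip inner in \<open>auto simp: eq_commute\<close>)
qed

context
  fixes P :: "'w measure" and E :: "'z measure" and n Z g \<epsilon> and \<delta> v :: real
  assumes P: "prob_space P" and Z: "\<And>i. i \<in> {1..n} \<Longrightarrow> Z i \<in> P \<rightarrow>\<^sub>M E"
    and err: "cond_indep_errors P E n Z g \<epsilon>" and mom: "error_moments P E n Z \<epsilon> \<delta> v"
begin

interpretation prob_space P by (rule P)

lemma sigma_Z_subalgebra:
  assumes i: "i \<in> {1..n}"
  shows "subalgebra P (vimage_algebra (space P) (Z i) E)"
    "sigma_finite_subalgebra P (vimage_algebra (space P) (Z i) E)"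
    "Z i \<in> vimage_algebra (space P) (Z i) E \<rightarrow>\<^sub>M E"
    "sets (vimage_algebra (space P) (Z i) E) = {Z i -` A \<inter> space P |A. A \<in> sets E}"
proof -
  have fs: "Z i \<in> space P \<rightarrow> space E" using measurable_space[OF Z[OF i]] by auto
  show 1: "sets (vimage_algebra (space P) (Z i) E) = {Z i -` A \<inter> space P |A. A \<in> sets E}"
    by (rule sets_vimage_algebra2[OF fs])
  show 2: "subalgebra P (vimage_algebra (space P) (Z i) E)"
    unfolding subalgebra_def 1 using measurable_sets[OF Z[OF i]] by auto
  show "sigma_finite_subalgebra P (vimage_algebra (space P) (Z i) E)"
    by (rule prob_space_sigma_finite_subalgebra[OF P 2])
  show "Z i \<in> vimage_algebra (space P) (Z i) E \<rightarrow>\<^sub>M E"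
    by (rule measurable_vimage_algebra1[OF fs])
qed

text \<open>The moment hypothesis is about the conditional expectation given \<open>Z i\<close>
  alone. The kernel moment is a version of it, because both have the same integrals over preimages
  under \<open>Z i\<close>; the bound can then be read off for \<open>g (Z i \<omega>)\<close>
  itself.\<close>

lemma error_abs_moment:
  assumes i: "i \<in> {1..n}"
  shows "AE \<omega> in P. (\<integral>\<^sup>+e. ennreal (\<bar>e\<bar> powr (1 + \<delta>)) \<partial>g (Z i \<omega>)) \<le> ennreal v"
proof -
  let ?F = "vimage_algebra (space P) (Z i) E"
  have g: "g \<in> E \<rightarrow>\<^sub>M prob_algebra borel" and eps[measurable]: "\<epsilon> i \<in> borel_measurable P"
    using err i by (auto simp: cond_indep_errors_def)
  interpret F: sigma_finite_subalgebra P ?F by (rule sigma_Z_subalgebra[OF i])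
  define Y where "Y z = (\<integral>\<^sup>+e. ennreal (\<bar>e\<bar> powr (1 + \<delta>)) \<partial>g z)" for z
  have Y: "Y \<in> borel_measurable E" unfolding Y_def
    by (rule nn_integral_measurable_subprob_algebra2[OF _ measurable_prob_algebraD[OF g]]) measurable
  have "AE \<omega> in P. Y (Z i \<omega>) = nn_cond_exp P ?F (\<lambda>\<omega>. ennreal (\<bar>\<epsilon> i \<omega>\<bar> powr (1 + \<delta>))) \<omega>"
  proof (rule F.nn_cond_exp_charact)
    show "(\<lambda>\<omega>. Y (Z i \<omega>)) \<in> borel_measurable ?F"
      using measurable_compose[OF sigma_Z_subalgebra(3)[OF i] Y] .
    fix A assume "A \<in> sets ?F"
    then obtain A' where A: "A = Z i -` A' \<inter> space P" and A'[measurable]: "A' \<in> sets E"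
      using sigma_Z_subalgebra(4)[OF i] by auto
    have "(\<integral>\<^sup>+\<omega>\<in>A. ennreal (\<bar>\<epsilon> i \<omega>\<bar> powr (1 + \<delta>)) \<partial>P)
        = (\<integral>\<^sup>+\<omega>. (\<lambda>(z, e). ennreal (\<bar>e\<bar> powr (1 + \<delta>)) * indicator A' z) (Z i \<omega>, \<epsilon> i \<omega>) \<partial>P)"
      unfolding A by (intro nn_integral_cong) (auto split: split_indicator)
    also have "\<dots> = (\<integral>\<^sup>+\<omega>. \<integral>\<^sup>+e. (\<lambda>(z, e). ennreal (\<bar>e\<bar> powr (1 + \<delta>)) * indicator A' z) (Z i \<omega>, e) \<partial>g (Z i \<omega>) \<partial>P)"
      by (rule cond_indep_single[OF P Z err i]) measurable
    also have "\<dots> = (\<integral>\<^sup>+\<omega>\<in>A. Y (Z i \<omega>) \<partial>P)"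
      unfolding A Y_def by (intro nn_integral_cong) (auto split: split_indicator)
    finally show "(\<integral>\<^sup>+\<omega>\<in>A. ennreal (\<bar>\<epsilon> i \<omega>\<bar> powr (1 + \<delta>)) \<partial>P) = (\<integral>\<^sup>+\<omega>\<in>A. Y (Z i \<omega>) \<partial>P)" .
  qed measurable
  moreover have "AE \<omega> in P. nn_cond_exp P ?F (\<lambda>\<omega>. ennreal (\<bar>\<epsilon> i \<omega>\<bar> powr (1 + \<delta>))) \<omega> < ennreal v"
    using mom i by (simp add: error_moments_def)
  ultimately show ?thesis by eventually_elim (simp add: Y_def)
qed

text \<open>The same identification for the mean. The error must first be shown integrable, which
  follows from the moment bound and \<open>\<delta> > 0\<close>.\<close>

lemma error_cond_mean:
  assumes i: "i \<in> {1..n}" and \<delta>: "0 < \<delta>"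
  shows "AE \<omega> in P. (\<integral>e. e \<partial>g (Z i \<omega>)) = 0"
proof -
  let ?F = "vimage_algebra (space P) (Z i) E"
  have g: "g \<in> E \<rightarrow>\<^sub>M prob_algebra borel" and eps[measurable]: "\<epsilon> i \<in> borel_measurable P"
    using err i by (auto simp: cond_indep_errors_def)
  have Zi[measurable]: "Z i \<in> P \<rightarrow>\<^sub>M E" by (rule Z[OF i])
  interpret F: sigma_finite_subalgebra P ?F by (rule sigma_Z_subalgebra[OF i])
  have ple: "\<bar>e\<bar> \<le> 1 + \<bar>e\<bar> powr (1 + \<delta>)" for e :: real
  proof (cases "\<bar>e\<bar> \<le> 1")
    case False
    then have "\<bar>e\<bar> powr 1 \<le> \<bar>e\<bar> powr (1 + \<delta>)" using \<delta> by (intro powr_mono) auto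
    then show ?thesis using False by simp
  qed (smt (verit) powr_ge_zero)
  have int: "integrable P (\<epsilon> i)"
  proof (rule integrableI_bounded)
    have "(\<integral>\<^sup>+\<omega>. ennreal (norm (\<epsilon> i \<omega>)) \<partial>P) \<le> (\<integral>\<^sup>+\<omega>. 1 + ennreal (\<bar>\<epsilon> i \<omega>\<bar> powr (1 + \<delta>)) \<partial>P)"
    proof (rule nn_integral_mono)
      fix \<omega>
      have "ennreal (norm (\<epsilon> i \<omega>)) \<le> ennreal (1 + \<bar>\<epsilon> i \<omega>\<bar> powr (1 + \<delta>))" using ple by (intro ennreal_leI) simp
      then show "ennreal (norm (\<epsilon> i \<omega>)) \<le> 1 + ennreal (\<bar>\<epsilon> i \<omega>\<bar> powr (1 + \<delta>))" by simp
    qed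
    also have "\<dots> = 1 + (\<integral>\<^sup>+\<omega>. ennreal (\<bar>\<epsilon> i \<omega>\<bar> powr (1 + \<delta>)) \<partial>P)"
      by (subst nn_integral_add) (auto simp: emeasure_space_1)
    also have "(\<integral>\<^sup>+\<omega>. ennreal (\<bar>\<epsilon> i \<omega>\<bar> powr (1 + \<delta>)) \<partial>P) = (\<integral>\<^sup>+\<omega>. (\<lambda>(z, e). ennreal (\<bar>e\<bar> powr (1 + \<delta>))) (Z i \<omega>, \<epsilon> i \<omega>) \<partial>P)"
      by simp
    also have "\<dots> = (\<integral>\<^sup>+\<omega>. \<integral>\<^sup>+e. (\<lambda>(z, e). ennreal (\<bar>e\<bar> powr (1 + \<delta>))) (Z i \<omega>, e) \<partial>g (Z i \<omega>) \<partial>P)"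
      by (rule cond_indep_single[OF P Z err i]) measurable
    also have "\<dots> \<le> (\<integral>\<^sup>+\<omega>. ennreal v \<partial>P)"
      using error_abs_moment[OF i] by (intro nn_integral_mono_AE) simp
    also have "1 + \<dots> < \<infinity>" by (simp add: emeasure_space_1)
    finally show "(\<integral>\<^sup>+\<omega>. ennreal (norm (\<epsilon> i \<omega>)) \<partial>P) < \<infinity>" by (simp add: add_left_mono)
  qed measurable
  have m: "(\<lambda>z. \<integral>e. e \<partial>g z) \<in> borel_measurable E"
    using measurable_compose[OF measurable_prob_algebraD[OF g] integral_measurable_subprob_algebra[of "\<lambda>e. e"]] by simp
  have "AE \<omega> in P. real_cond_exp P ?F (\<epsilon> i) \<omega> = (\<integral>e. e \<partial>g (Z i \<omega>))"
  proof (rule F.real_cond_exp_charact[OF _ int])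
    show "integrable P (\<lambda>\<omega>. \<integral>e. e \<partial>g (Z i \<omega>))"
      using cond_indep_single_integral(2)[OF P Z err i, of snd] int by simp
    show "(\<lambda>\<omega>. \<integral>e. e \<partial>g (Z i \<omega>)) \<in> borel_measurable ?F"
      using measurable_compose[OF sigma_Z_subalgebra(3)[OF i] m] .
    fix A assume "A \<in> sets ?F"
    then obtain A' where A: "A = Z i -` A' \<inter> space P" and A'[measurable]: "A' \<in> sets E"
      using sigma_Z_subalgebra(4)[OF i] by auto
    let ?G = "\<lambda>(z, e). indicat_real A' z * e"
    have eq: "?G (Z i \<omega>, \<epsilon> i \<omega>) = indicat_real A \<omega> * \<epsilon> i \<omega>" if "\<omega> \<in> space P" for \<omega>
      using that by (simp add: A split: split_indicator)
    have "integrable P (\<lambda>\<omega>. indicat_real A \<omega> * \<epsilon> i \<omega>)"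
      using integrable_mult_indicator[OF _ int, of A] by (simp add: A)
    moreover have "integrable P (\<lambda>\<omega>. ?G (Z i \<omega>, \<epsilon> i \<omega>)) \<longleftrightarrow> integrable P (\<lambda>\<omega>. indicat_real A \<omega> * \<epsilon> i \<omega>)"
      by (rule Bochner_Integration.integrable_cong[OF refl eq])
    ultimately have G: "integrable P (\<lambda>\<omega>. ?G (Z i \<omega>, \<epsilon> i \<omega>))" by simp
    have "(LINT \<omega>:A|P. \<epsilon> i \<omega>) = (\<integral>\<omega>. ?G (Z i \<omega>, \<epsilon> i \<omega>) \<partial>P)"
      unfolding set_lebesgue_integral_def
      by (rule Bochner_Integration.integral_cong[OF refl]) (simp only: eq real_scaleR_def)
    also have "\<dots> = (\<integral>\<omega>. \<integral>e. ?G (Z i \<omega>, e) \<partial>g (Z i \<omega>) \<partial>P)"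
      by (rule cond_indep_single_integral(1)[OF P Z err i _ G]) measurable
    also have "\<dots> = (LINT \<omega>:A|P. \<integral>e. e \<partial>g (Z i \<omega>))"
      unfolding set_lebesgue_integral_def
      by (rule Bochner_Integration.integral_cong[OF refl]) (auto simp: A split: split_indicator)
    finally show "(LINT \<omega>:A|P. \<epsilon> i \<omega>) = (LINT \<omega>:A|P. \<integral>e. e \<partial>g (Z i \<omega>))" .
  qed
  moreover have "AE \<omega> in P. real_cond_exp P ?F (\<epsilon> i) \<omega> = 0"
    using mom i by (simp add: error_moments_def)
  ultimately show ?thesis by eventually_elim simp
qed

end

section \<open>Truncation of heavy-tailed errors\<close>

lemma powr_minus_Suc: "0 < t \<Longrightarrow> t powr (- 1 - a) = t powr (- a) / t" for t a :: real
  using powr_diff[of t "- a" 1] by (simp add: minus_diff_commute)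

text \<open>To be applied to \<open>g (Z i \<omega>)\<close>, the law of one error with the chain
  frozen. As \<open>a \<le> 1\<close>, the exponent \<open>1 - a\<close> is nonnegative, so the
  moment of order \<open>1 + a\<close> controls the second moment of a clipped error.\<close>

locale heavy_tailed = prob_space \<mu> for \<mu> :: "real measure" +
  fixes a V :: real
  assumes sets_mu[measurable_cong]: "sets \<mu> = sets borel" and a: "0 < a" "a \<le> 1"
    and moment: "(\<integral>\<^sup>+e. ennreal (\<bar>e\<bar> powr (1 + a)) \<partial>\<mu>) \<le> ennreal V" and V: "0 \<le> V"
begin

lemma integrable_moment: "integrable \<mu> (\<lambda>e. \<bar>e\<bar> powr (1 + a))"
  and moment_le: "(\<integral>e. \<bar>e\<bar> powr (1 + a) \<partial>\<mu>) \<le> V"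
proof -
  show i: "integrable \<mu> (\<lambda>e. \<bar>e\<bar> powr (1 + a))"
    by (rule integrableI_bounded) (use moment in \<open>auto intro: order.strict_trans1\<close>)
  have "ennreal (\<integral>e. \<bar>e\<bar> powr (1 + a) \<partial>\<mu>) \<le> ennreal V"
    using moment nn_integral_eq_integral[OF i] by simp
  then show "(\<integral>e. \<bar>e\<bar> powr (1 + a) \<partial>\<mu>) \<le> V" using V by simp
qed

lemma tail_pointwise:
  assumes "0 < t" "t < \<bar>e\<bar>" shows "\<bar>e\<bar> \<le> t powr (- a) * \<bar>e\<bar> powr (1 + a)"
proof -
  have "t powr a \<le> \<bar>e\<bar> powr a" using assms a by (intro powr_mono2) auto
  then have "1 \<le> t powr (- a) * \<bar>e\<bar> powr a" using assms by (simp add: powr_minus field_simps)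
  then have "\<bar>e\<bar> * 1 \<le> \<bar>e\<bar> * (t powr (- a) * \<bar>e\<bar> powr a)" by (intro mult_left_mono) auto
  moreover have "\<bar>e\<bar> powr (1 + a) = \<bar>e\<bar> * \<bar>e\<bar> powr a" using assms by (simp add: powr_add)
  ultimately show ?thesis by (simp add: mult_ac)
qed

lemma nn_integral_tail_le:
  assumes t: "0 < t" and c: "0 \<le> c"
  shows "(\<integral>\<^sup>+e. ennreal (c * \<bar>e\<bar> * of_bool (t < \<bar>e\<bar>)) \<partial>\<mu>) \<le> ennreal (c * (V * t powr (- a)))"
proof -
  have "(\<integral>\<^sup>+e. ennreal (c * \<bar>e\<bar> * of_bool (t < \<bar>e\<bar>)) \<partial>\<mu>)
      \<le> (\<integral>\<^sup>+e. ennreal (c * t powr (- a)) * ennreal (\<bar>e\<bar> powr (1 + a)) \<partial>\<mu>)"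
  proof (rule nn_integral_mono)
    fix e
    have "c * \<bar>e\<bar> * of_bool (t < \<bar>e\<bar>) \<le> c * t powr (- a) * \<bar>e\<bar> powr (1 + a)"
      using tail_pointwise[OF t, of e] c by (auto simp: mult.assoc intro!: mult_left_mono)
    then show "ennreal (c * \<bar>e\<bar> * of_bool (t < \<bar>e\<bar>)) \<le> ennreal (c * t powr (- a)) * ennreal (\<bar>e\<bar> powr (1 + a))"
      using c by (subst ennreal_mult[symmetric]) (auto intro!: ennreal_leI)
  qed
  also have "\<dots> = ennreal (c * t powr (- a)) * (\<integral>\<^sup>+e. ennreal (\<bar>e\<bar> powr (1 + a)) \<partial>\<mu>)"
    by (rule nn_integral_cmult) measurable
  also have "\<dots> \<le> ennreal (c * t powr (- a)) * ennreal V" by (rule mult_left_mono[OF moment]) simp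
  also have "\<dots> = ennreal (c * (V * t powr (- a)))"
    using c V by (simp add: ennreal_mult[symmetric] mult_ac)
  finally show ?thesis .
qed

lemma nn_integral_exceed_le:
  assumes t: "0 < t" and c: "0 \<le> c"
  shows "(\<integral>\<^sup>+e. ennreal (c * of_bool (t < \<bar>e\<bar>)) \<partial>\<mu>) \<le> ennreal (c * (V * t powr (- (1 + a))))"
proof -
  have "(\<integral>\<^sup>+e. ennreal (c * of_bool (t < \<bar>e\<bar>)) \<partial>\<mu>) \<le> (\<integral>\<^sup>+e. ennreal (c / t * \<bar>e\<bar> * of_bool (t < \<bar>e\<bar>)) \<partial>\<mu>)"
    using t c by (intro nn_integral_mono ennreal_leI) (auto simp: field_simps intro!: mult_left_mono)
  also have "\<dots> \<le> ennreal (c / t * (V * t powr (- a)))" using t c by (intro nn_integral_tail_le) auto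
  also have "c / t * (V * t powr (- a)) = c * (V * t powr (- (1 + a)))"
    using t by (simp add: powr_minus_Suc[OF t])
  finally show ?thesis .
qed

lemma integrable_id: "integrable \<mu> (\<lambda>e. e)"
proof (rule Bochner_Integration.integrable_bound)
  show "integrable \<mu> (\<lambda>e. 1 + \<bar>e\<bar> powr (1 + a))" using integrable_moment by simp
  have "\<bar>e\<bar> \<le> 1 + \<bar>e\<bar> powr (1 + a)" for e :: real
  proof (cases "1 < \<bar>e\<bar>")
    case True then show ?thesis using tail_pointwise[of 1 e] by simp
  next
    case False then show ?thesis using powr_ge_zero[of "\<bar>e\<bar>" "1 + a"] by linarith
  qed
  then show "AE e in \<mu>. norm e \<le> norm (1 + \<bar>e\<bar> powr (1 + a))" by simp
qed measurable

lemma huber_score_sq_le: "0 < t \<Longrightarrow> (huber_score t e)\<^sup>2 \<le> t\<^sup>2"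
  using power_mono[OF abs_huber_score_le abs_ge_zero, of t e 2] by simp

text \<open>The zero mean turns the bias into the integral of \<open>huber_score t e - e\<close>,
  which lives on the tail \<open>\<bar>e\<bar> > t\<close>.\<close>

lemma truncated_mean_le:
  assumes t: "0 < t" and mean: "(\<integral>e. e \<partial>\<mu>) = 0"
  shows "\<bar>\<integral>e. huber_score t e \<partial>\<mu>\<bar> \<le> V * t powr (- a)"
proof -
  have [measurable]: "huber_score t \<in> borel_measurable borel" unfolding huber_score_def[abs_def] by measurable
  have i: "integrable \<mu> (huber_score t)"
    by (rule integrable_const_bound[where B=t]) (use abs_huber_score_le[OF t] in auto)
  have "(\<integral>e. huber_score t e \<partial>\<mu>) = (\<integral>e. huber_score t e - e \<partial>\<mu>)"
    using i integrable_id mean by simp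
  also have "\<bar>\<dots>\<bar> \<le> (\<integral>e. \<bar>huber_score t e - e\<bar> \<partial>\<mu>)" by (rule integral_abs_bound)
  also have "\<dots> \<le> (\<integral>e. t powr (- a) * \<bar>e\<bar> powr (1 + a) \<partial>\<mu>)"
  proof (rule integral_mono)
    show "integrable \<mu> (\<lambda>e. \<bar>huber_score t e - e\<bar>)" using i integrable_id by simp
    show "integrable \<mu> (\<lambda>e. t powr (- a) * \<bar>e\<bar> powr (1 + a))" using integrable_moment by simp
    fix e
    show "\<bar>huber_score t e - e\<bar> \<le> t powr (- a) * \<bar>e\<bar> powr (1 + a)"
    proof (cases "t < \<bar>e\<bar>")
      case True
      have "\<bar>huber_score t e - e\<bar> \<le> \<bar>e\<bar>" using True t by (auto simp: huber_score_def)
      then show ?thesis using tail_pointwise[OF t True] by linarith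
    next
      case False
      then have "huber_score t e = e" using t by (auto simp: huber_score_def)
      then show ?thesis by simp
    qed
  qed
  also have "\<dots> = t powr (- a) * (\<integral>e. \<bar>e\<bar> powr (1 + a) \<partial>\<mu>)" by simp
  also have "\<dots> \<le> V * t powr (- a)" using mult_left_mono[OF moment_le, of "t powr (- a)"] by (simp add: mult.commute)
  finally show ?thesis .
qed

lemma truncated_second_moment_le:
  assumes t: "0 < t"
  shows "(\<integral>e. (huber_score t e)\<^sup>2 \<partial>\<mu>) \<le> V * t powr (1 - a)"
proof -
  have [measurable]: "huber_score t \<in> borel_measurable borel" unfolding huber_score_def[abs_def] by measurable
  have "(\<integral>e. (huber_score t e)\<^sup>2 \<partial>\<mu>) \<le> (\<integral>e. t powr (1 - a) * \<bar>e\<bar> powr (1 + a) \<partial>\<mu>)"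
  proof (rule integral_mono)
    show "integrable \<mu> (\<lambda>e. (huber_score t e)\<^sup>2)"
    proof (rule integrable_const_bound[where B="t\<^sup>2"])
      show "AE e in \<mu>. norm ((huber_score t e)\<^sup>2) \<le> t\<^sup>2"
        using huber_score_sq_le[OF t] by simp
    qed measurable
    show "integrable \<mu> (\<lambda>e. t powr (1 - a) * \<bar>e\<bar> powr (1 + a))" using integrable_moment by simp
    fix e
    \<comment> \<open>The clipped size \<open>s\<close> satisfies
      \<open>s\<^sup>2 = s powr (1 - a) * s powr (1 + a)\<close>; the level bounds the first factor
      and \<open>\<bar>e\<bar>\<close> the second.\<close>
    define s where "s = min t \<bar>e\<bar>"
    have s: "0 \<le> s" "s \<le> t" "s \<le> \<bar>e\<bar>" and "\<bar>huber_score t e\<bar> = s"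
      using t by (auto simp: s_def huber_score_def min_def max_def)
    then have eq: "(huber_score t e)\<^sup>2 = s\<^sup>2" by (metis power2_abs)
    show "(huber_score t e)\<^sup>2 \<le> t powr (1 - a) * \<bar>e\<bar> powr (1 + a)"
    proof (cases "s = 0")
      case False
      then have "s\<^sup>2 = s powr (1 - a) * s powr (1 + a)" using s by (simp add: powr_add[symmetric] powr_numeral)
      also have "\<dots> \<le> t powr (1 - a) * \<bar>e\<bar> powr (1 + a)"
        using s a by (intro mult_mono powr_mono2) auto
      finally show ?thesis unfolding eq .
    qed (simp add: eq)
  qed
  also have "\<dots> = t powr (1 - a) * (\<integral>e. \<bar>e\<bar> powr (1 + a) \<partial>\<mu>)" by simp
  also have "\<dots> \<le> V * t powr (1 - a)" using mult_left_mono[OF moment_le, of "t powr (1 - a)"] by (simp add: mult.commute)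
  finally show ?thesis .
qed

text \<open>At scale \<open>1 / t\<close> the clipping bias and the clipped second moment are both
  at most \<open>V * t powr (- (1 + a))\<close>, whence the factor 2.\<close>

lemma truncated_mgf_le:
  assumes t: "0 < t" and mean: "(\<integral>e. e \<partial>\<mu>) = 0" and c: "\<bar>c\<bar> \<le> 1 / t"
  shows "(\<integral>\<^sup>+e. ennreal (exp (c * huber_score t e)) \<partial>\<mu>) \<le> ennreal (exp (2 * V * t powr (- (1 + a))))"
proof -
  have [measurable]: "huber_score t \<in> borel_measurable borel" unfolding huber_score_def[abs_def] by measurable
  have u1: "\<bar>c * huber_score t e\<bar> \<le> 1" for e
    using mult_mono[OF c abs_huber_score_le[OF t, of e]] t by (simp add: abs_mult)
  have i: "integrable \<mu> (huber_score t)" "integrable \<mu> (\<lambda>e. (huber_score t e)\<^sup>2)"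
    by (rule integrable_const_bound[where B=t], use abs_huber_score_le[OF t] in \<open>auto\<close>)
       (rule integrable_const_bound[where B="t\<^sup>2"], use huber_score_sq_le[OF t] in \<open>auto\<close>)
  have ie: "integrable \<mu> (\<lambda>e. exp (c * huber_score t e))"
    by (rule integrable_const_bound[where B="exp 1"]) (use u1 abs_le_D1 in auto)
  have "(\<integral>e. exp (c * huber_score t e) \<partial>\<mu>) \<le> (\<integral>e. 1 + c * huber_score t e + c\<^sup>2 * (huber_score t e)\<^sup>2 \<partial>\<mu>)"
    using exp_le_quadratic[OF u1] i ie by (intro integral_mono) (auto simp: power_mult_distrib)
  also have "\<dots> = 1 + c * (\<integral>e. huber_score t e \<partial>\<mu>) + c\<^sup>2 * (\<integral>e. (huber_score t e)\<^sup>2 \<partial>\<mu>)"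
    using i by (simp add: prob_space)
  also have "\<dots> \<le> 1 + (1 / t) * (V * t powr (- a)) + (1 / t)\<^sup>2 * (V * t powr (1 - a))"
  proof (intro add_mono order_refl)
    have "c * (\<integral>e. huber_score t e \<partial>\<mu>) \<le> \<bar>c\<bar> * \<bar>\<integral>e. huber_score t e \<partial>\<mu>\<bar>" by (metis abs_ge_self abs_mult)
    also have "\<dots> \<le> (1 / t) * (V * t powr (- a))"
      using t by (intro mult_mono c truncated_mean_le[OF t mean]) auto
    finally show "c * (\<integral>e. huber_score t e \<partial>\<mu>) \<le> (1 / t) * (V * t powr (- a))" .
    have "c\<^sup>2 \<le> (1 / t)\<^sup>2" using power_mono[OF c abs_ge_zero, of 2] by simp
    then show "c\<^sup>2 * (\<integral>e. (huber_score t e)\<^sup>2 \<partial>\<mu>) \<le> (1 / t)\<^sup>2 * (V * t powr (1 - a))"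
      by (intro mult_mono truncated_second_moment_le[OF t]) auto
  qed
  also have "\<dots> = 1 + 2 * V * t powr (- (1 + a))"
  proof -
    have "(1 / t) * t powr (- a) = t powr (- (1 + a))"
      using t by (simp add: powr_minus_Suc[OF t])
    moreover have "(1 / t)\<^sup>2 * t powr (1 - a) = t powr (- (1 + a))"
      using t by (simp add: powr_minus_Suc[OF t] powr_diff powr_minus field_simps power2_eq_square)
    ultimately show ?thesis by (simp add: algebra_simps)
  qed
  also have "\<dots> \<le> exp (2 * V * t powr (- (1 + a)))" by (rule exp_ge_add_one_self)
  finally have "ennreal (\<integral>e. exp (c * huber_score t e) \<partial>\<mu>) \<le> ennreal (exp (2 * V * t powr (- (1 + a))))"
    by (rule ennreal_leI)
  then show ?thesis using nn_integral_eq_integral[OF ie] by simp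
qed

text \<open>No centring takes place: the variable is nonnegative with mean at most
  \<open>V * t powr (- a)\<close>, and normalising by its upper bound \<open>k * t\<close> gains the
  factor \<open>1 / k\<close>.\<close>

lemma middle_mgf_le:
  assumes t: "0 < t" and k: "1 \<le> k"
  shows "(\<integral>\<^sup>+e. ennreal (exp (\<bar>e\<bar> * of_bool (t < \<bar>e\<bar> \<and> \<bar>e\<bar> \<le> k * t) / (k * t))) \<partial>\<mu>)
    \<le> ennreal (exp (2 * V / k * t powr (- (1 + a))))"
proof -
  have kt: "0 < k * t" using t k by simp
  have "(\<integral>\<^sup>+e. ennreal (exp (\<bar>e\<bar> * of_bool (t < \<bar>e\<bar> \<and> \<bar>e\<bar> \<le> k * t) / (k * t))) \<partial>\<mu>)
      \<le> (\<integral>\<^sup>+e. 1 + ennreal (2 / (k * t) * \<bar>e\<bar> * of_bool (t < \<bar>e\<bar>)) \<partial>\<mu>)"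
  proof (rule nn_integral_mono)
    fix e
    define u where "u = \<bar>e\<bar> * of_bool (t < \<bar>e\<bar> \<and> \<bar>e\<bar> \<le> k * t) / (k * t)"
    have u: "0 \<le> u" "\<bar>u\<bar> \<le> 1" using kt by (auto simp: u_def)
    have "exp u \<le> 1 + 2 * u" using abs_exp_minus_one_le[OF u(2)] u by linarith
    also have "\<dots> \<le> 1 + 2 / (k * t) * \<bar>e\<bar> * of_bool (t < \<bar>e\<bar>)" using kt by (auto simp: u_def)
    finally have "ennreal (exp u) \<le> ennreal (1 + 2 / (k * t) * \<bar>e\<bar> * of_bool (t < \<bar>e\<bar>))" by (rule ennreal_leI)
    also have "\<dots> = 1 + ennreal (2 / (k * t) * \<bar>e\<bar> * of_bool (t < \<bar>e\<bar>))"
      using kt by (subst ennreal_plus) auto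
    finally show "ennreal (exp (\<bar>e\<bar> * of_bool (t < \<bar>e\<bar> \<and> \<bar>e\<bar> \<le> k * t) / (k * t)))
        \<le> 1 + ennreal (2 / (k * t) * \<bar>e\<bar> * of_bool (t < \<bar>e\<bar>))" by (simp add: u_def)
  qed
  also have "\<dots> = 1 + (\<integral>\<^sup>+e. ennreal (2 / (k * t) * \<bar>e\<bar> * of_bool (t < \<bar>e\<bar>)) \<partial>\<mu>)"
    by (subst nn_integral_add) (auto simp: emeasure_space_1)
  also have "\<dots> \<le> 1 + ennreal (2 / (k * t) * (V * t powr (- a)))"
    using kt by (intro add_left_mono nn_integral_tail_le[OF t]) auto
  also have "\<dots> = ennreal (1 + 2 / (k * t) * (V * t powr (- a)))"
    using kt V by (subst ennreal_plus) auto
  also have "1 + 2 / (k * t) * (V * t powr (- a)) = 1 + 2 * V / k * t powr (- (1 + a))"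
    using t k by (simp add: powr_minus_Suc[OF t])
  also have "ennreal \<dots> \<le> ennreal (exp (2 * V / k * t powr (- (1 + a))))"
    by (intro ennreal_leI exp_ge_add_one_self)
  finally show ?thesis .
qed

end

text \<open>
  The score is split at \<open>\<tau>/m\<close> and \<open>k\<tau>/m\<close>: the first part admits a union bound over coordinates, the
  other two are dominated by the envelope and are shared by all coordinates.
\<close>

lemma huber_score_split:
  assumes \<tau>: "0 < \<tau>" and m: "1 \<le> m" and x: "\<bar>x\<bar> \<le> m" and t: "t = \<tau> / m"
  shows "\<bar>x * huber_score \<tau> e - x * huber_score t e\<bar>
      \<le> m * \<bar>e\<bar> * of_bool (t < \<bar>e\<bar> \<and> \<bar>e\<bar> \<le> k * t) + m * \<bar>e\<bar> * of_bool (k * t < \<bar>e\<bar>)"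
proof -
  have t0: "0 < t" "t \<le> \<tau>" using \<tau> m by (auto simp: t field_simps)
  have d: "\<bar>huber_score \<tau> e - huber_score t e\<bar> \<le> \<bar>e\<bar> * of_bool (t < \<bar>e\<bar>)"
    using t0 by (auto simp: huber_score_def min_def max_def abs_if)
  have "\<bar>x * huber_score \<tau> e - x * huber_score t e\<bar> = \<bar>x\<bar> * \<bar>huber_score \<tau> e - huber_score t e\<bar>"
    by (simp add: right_diff_distrib[symmetric] abs_mult)
  also have "\<dots> \<le> m * (\<bar>e\<bar> * of_bool (t < \<bar>e\<bar>))" using d x m by (intro mult_mono) auto
  finally have 1: "\<bar>x * huber_score \<tau> e - x * huber_score t e\<bar> \<le> m * \<bar>e\<bar> * of_bool (t < \<bar>e\<bar>)" by (simp add: mult.assoc)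
  have "m * \<bar>e\<bar> * of_bool (t < \<bar>e\<bar>) \<le> m * \<bar>e\<bar> * of_bool (t < \<bar>e\<bar> \<and> \<bar>e\<bar> \<le> k * t) + m * \<bar>e\<bar> * of_bool (k * t < \<bar>e\<bar>)"
    using m by auto
  with 1 show "\<bar>x * huber_score \<tau> e - x * huber_score t e\<bar>
      \<le> m * \<bar>e\<bar> * of_bool (t < \<bar>e\<bar> \<and> \<bar>e\<bar> \<le> k * t) + m * \<bar>e\<bar> * of_bool (k * t < \<bar>e\<bar>)" by linarith
qed

section \<open>Concentration at a fixed sample size\<close>

lemma prod_ennreal_exp:
  "(\<Prod>i\<in>I. ennreal (exp (F i))) = ennreal (exp (\<Sum>i\<in>I. F i))" if "finite I" for F :: "'i \<Rightarrow> real"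
  using that by (simp add: prod_ennreal exp_sum)

text \<open>Each \<open>F i\<close> is meant to carry its own compensator, a bound on a conditional
  log moment generating function. The conditional variance may then be random while the threshold
  \<open>c\<close> is not.\<close>

lemma cond_indep_Chernoff:
  fixes F :: "nat \<Rightarrow> 'z \<times> real \<Rightarrow> real"
  assumes P: "prob_space P" and Z: "\<And>i. i \<in> {1..n} \<Longrightarrow> Z i \<in> P \<rightarrow>\<^sub>M E"
    and err: "cond_indep_errors P E n Z g \<epsilon>"
    and F: "\<And>i. i \<in> {1..n} \<Longrightarrow> F i \<in> borel_measurable (E \<Otimes>\<^sub>M borel)"
    and le1: "AE \<omega> in P. \<forall>i\<in>{1..n}. (\<integral>\<^sup>+e. ennreal (exp (F i (Z i \<omega>, e))) \<partial>g (Z i \<omega>)) \<le> 1"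
  shows "measure P {\<omega> \<in> space P. c \<le> (\<Sum>i=1..n. F i (Z i \<omega>, \<epsilon> i \<omega>))} \<le> exp (- c)"
proof -
  interpret prob_space P by fact
  have eps: "\<epsilon> i \<in> borel_measurable P" if "i \<in> {1..n}" for i
    using err that by (auto simp: cond_indep_errors_def)
  have Fm: "(\<lambda>\<omega>. F i (Z i \<omega>, \<epsilon> i \<omega>)) \<in> borel_measurable P" if i: "i \<in> {1..n}" for i
    by (rule measurable_compose[OF measurable_Pair[OF Z[OF i] eps[OF i]] F[OF i]])
  have m: "(\<lambda>\<omega>. \<Sum>i=1..n. F i (Z i \<omega>, \<epsilon> i \<omega>)) \<in> borel_measurable P"
    using Fm by (intro borel_measurable_sum) auto
  have "emeasure P {\<omega> \<in> space P. c \<le> (\<Sum>i=1..n. F i (Z i \<omega>, \<epsilon> i \<omega>))}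
      \<le> ennreal (exp (- 1 * c)) * (\<integral>\<^sup>+\<omega>. ennreal (exp (1 * (\<Sum>i=1..n. F i (Z i \<omega>, \<epsilon> i \<omega>)))) * indicator (space P) \<omega> \<partial>P)"
    by (rule Chernoff_ineq_nn_integral_ge) (use m in measurable)
  also have "(\<integral>\<^sup>+\<omega>. ennreal (exp (1 * (\<Sum>i=1..n. F i (Z i \<omega>, \<epsilon> i \<omega>)))) * indicator (space P) \<omega> \<partial>P)
      = (\<integral>\<^sup>+\<omega>. (\<Prod>i=1..n. ennreal (exp (F i (Z i \<omega>, \<epsilon> i \<omega>)))) \<partial>P)"
    by (intro nn_integral_cong) (simp add: prod_ennreal_exp)
  also have "\<dots> = (\<integral>\<^sup>+\<omega>. (\<Prod>i=1..n. \<integral>\<^sup>+e. ennreal (exp (F i (Z i \<omega>, e))) \<partial>g (Z i \<omega>)) \<partial>P)"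
    using F by (intro cond_indep_prod[OF P Z err, of "\<lambda>i p. ennreal (exp (F i p))"]) measurable
  also have "\<dots> \<le> (\<integral>\<^sup>+\<omega>. 1 \<partial>P)"
  proof (rule nn_integral_mono_AE)
    show "AE \<omega> in P. (\<Prod>i=1..n. \<integral>\<^sup>+e. ennreal (exp (F i (Z i \<omega>, e))) \<partial>g (Z i \<omega>)) \<le> 1"
      using le1 by eventually_elim (intro prod_le_1, auto)
  qed
  also have "\<dots> = 1" by (simp add: emeasure_space_1)
  finally have "emeasure P {\<omega> \<in> space P. c \<le> (\<Sum>i=1..n. F i (Z i \<omega>, \<epsilon> i \<omega>))} \<le> ennreal (exp (- c))"
    by (simp add: mult_left_mono)
  then show ?thesis by (simp add: emeasure_eq_measure)
qed

lemma (in prob_space) Markov_inequality_nn: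
  fixes U :: "'a \<Rightarrow> real"
  assumes [measurable]: "U \<in> borel_measurable M" and c: "0 < c" and b: "0 \<le> b"
    and le: "(\<integral>\<^sup>+\<omega>. ennreal (U \<omega>) \<partial>M) \<le> ennreal b"
  shows "measure M {\<omega> \<in> space M. c \<le> U \<omega>} \<le> b / c"
proof -
  have "emeasure M {\<omega> \<in> space M. c \<le> U \<omega>} \<le> emeasure M {\<omega> \<in> space M. 1 \<le> ennreal (1 / c) * ennreal (U \<omega>)}"
  proof (rule emeasure_mono)
    show "{\<omega> \<in> space M. c \<le> U \<omega>} \<subseteq> {\<omega> \<in> space M. 1 \<le> ennreal (1 / c) * ennreal (U \<omega>)}"
    proof safe
      fix \<omega> assume "c \<le> U \<omega>"
      then have "ennreal 1 \<le> ennreal (1 / c * U \<omega>)" using c by (intro ennreal_leI) (simp add: field_simps)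
      then show "1 \<le> ennreal (1 / c) * ennreal (U \<omega>)"
        using c \<open>c \<le> U \<omega>\<close> by (subst ennreal_mult[symmetric]) auto
    qed
  qed measurable
  also have "\<dots> \<le> ennreal (1 / c) * (\<integral>\<^sup>+\<omega>. ennreal (U \<omega>) * indicator (space M) \<omega> \<partial>M)"
    by (rule nn_integral_Markov_inequality) measurable
  also have "(\<integral>\<^sup>+\<omega>. ennreal (U \<omega>) * indicator (space M) \<omega> \<partial>M) = (\<integral>\<^sup>+\<omega>. ennreal (U \<omega>) \<partial>M)"
    by (intro nn_integral_cong) auto
  also have "ennreal (1 / c) * \<dots> \<le> ennreal (1 / c) * ennreal b" by (intro mult_left_mono le) simp
  also have "\<dots> = ennreal (b / c)" using b c by (simp add: ennreal_mult[symmetric])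
  finally show ?thesis using b c by (simp add: emeasure_eq_measure)
qed

section \<open>The model at a fixed sample size\<close>

locale markov_huber_model =
  fixes P :: "'w measure" and E :: "'z measure" and K :: "'z \<Rightarrow> 'z measure" and \<pi> :: "'z measure"
    and n d :: nat and Z :: "nat \<Rightarrow> 'w \<Rightarrow> 'z" and g :: "'z \<Rightarrow> real measure" and \<epsilon> :: "nat \<Rightarrow> 'w \<Rightarrow> real"
    and f :: "nat \<Rightarrow> nat \<Rightarrow> 'z \<Rightarrow> real" and M :: "'z \<Rightarrow> real" and \<gamma> \<sigma> \<delta> v :: real
  assumes P: "prob_space P" and n: "1 \<le> n" and d: "3 \<le> d"
    and chain: "stationary_markov_chain P E K \<pi> n Z"
    and err: "cond_indep_errors P E n Z g \<epsilon>"
    and f_meas: "\<And>i j. i \<in> {1..n} \<Longrightarrow> j \<in> {1..d} \<Longrightarrow> f i j \<in> borel_measurable E"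
    and gamma: "\<gamma> = markov_op_norm K \<pi>" and gap: "\<gamma> < 1"
    and M_meas: "M \<in> borel_measurable E"
    and envelope: "AE z in \<pi>. \<forall>i\<in>{1..n}. \<forall>j\<in>{1..d}. \<bar>f i j z\<bar> \<le> M z"
    and M_int: "integrable \<pi> (\<lambda>z. M z ^ 4)" and M_moment: "(\<integral>z. M z ^ 4 \<partial>\<pi>) = \<sigma> ^ 4"
    and delta: "0 < \<delta>" and v: "0 < v"
    and moments: "error_moments P E n Z \<epsilon> \<delta> v"
    and rate_le: "(1 + \<gamma>) / (1 - \<gamma>) * (ln (real d) / real n) \<le> 1"
begin

sublocale prob_space P by (rule P)
sublocale \<pi>: invariant_kernel E K \<pi> by (rule stationary_markov_chainD[OF chain])

definition "\<rho> = (1 + \<gamma>) / (1 - \<gamma>) * (ln (real d) / real n)"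
definition "a = min \<delta> 1"
definition "V = 1 + v"
definition "Q = 1 + \<sigma> ^ 4"
definition "\<tau> = \<rho> powr (- (1 / (1 + a)))"
definition "\<l> = \<rho> powr (a / (1 + a))"
definition "B = 1 / sqrt \<rho>"
definition "k = sqrt (ln (real d))"
text \<open>Large enough that \<open>9 * Q / 64 - D / 8 \<le> - 3\<close>, which gives the
  probability \<open>2 / d ^ 3\<close> in \<open>Bernstein_rate\<close>.\<close>

definition "D = 24 + 2 * Q"
text \<open>This is \<open>D + Q + 1\<close>: the deviation and the mean of the truncated average of
  \<open>m\<^sup>2\<close>, and an allowance of 1 for its tail.\<close>

definition "C\<^sub>1 = 25 + 3 * Q"
definition "m z = max 1 (M z)"
text \<open>Here \<open>huber_score\<close> merely clips to \<open>[- m z, m z]\<close>. The almost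
  sure envelope becomes a bound at every state, and the value 0 outside the index ranges gives a
  measurable, bounded function for all indices, as the Bernstein inequality expects.\<close>

definition "fc i j z = (if i \<in> {1..n} \<and> j \<in> {1..d} then huber_score (m z) (f i j z) else 0)"

lemma gamma_nonneg: "0 \<le> \<gamma>" by (simp add: gamma \<pi>.markov_op_norm_nonneg)

lemma ln_d: "1 \<le> ln (real d)"
proof -
  have "exp 1 \<le> real d" using exp_le d by (meson le_trans of_nat_mono of_nat_numeral order_trans of_nat_le_iff numeral_le_real_of_nat_iff)
  then show ?thesis using d by (subst ln_ge_iff) auto
qed

text \<open>The last bound is for chain averages, whose effective sample size is reduced by the gap;
  the third is for the errors, which are independent given the chain.\<close>

lemma rho: "0 < \<rho>" "\<rho> \<le> 1" "ln (real d) \<le> real n * \<rho>" "ln (real d) \<le> real n * (1 - \<gamma>) * \<rho>"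
proof -
  have g: "0 < 1 - \<gamma>" using gap by simp
  show "0 < \<rho>" using g gamma_nonneg ln_d n by (simp add: \<rho>_def)
  show "\<rho> \<le> 1" using rate_le by (simp add: \<rho>_def)
  have "real n * (1 - \<gamma>) * \<rho> = (1 + \<gamma>) * ln (real d)" using g n by (simp add: \<rho>_def)
  then show 1: "ln (real d) \<le> real n * (1 - \<gamma>) * \<rho>" using gamma_nonneg ln_d by simp
  have "real n * (1 - \<gamma>) * \<rho> \<le> real n * 1 * \<rho>" using gamma_nonneg \<open>0 < \<rho>\<close> by (intro mult_right_mono mult_left_mono) auto
  with 1 show "ln (real d) \<le> real n * \<rho>" by simp
qed

lemma a: "0 < a" "a \<le> 1" using delta by (auto simp: a_def)
lemma V: "1 \<le> V" using v by (simp add: V_def)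
lemma Q: "1 \<le> Q" by (simp add: Q_def)
lemma k: "1 \<le> k" using ln_d by (simp add: k_def)

text \<open>The exponent in \<open>\<tau>\<close> is tuned so that
  \<open>\<tau> powr (- (1 + a))\<close> is exactly the rate \<open>\<rho>\<close>. Bias and
  fluctuation of the gradient are then both of size \<open>\<tau> * \<rho> = \<l>\<close>.\<close>

lemma tau: "0 < \<tau>" "\<tau> * \<rho> = \<l>" "\<tau> powr (- (1 + a)) = \<rho>" "0 < \<l>"
proof -
  show "0 < \<tau>" "0 < \<l>" using rho by (auto simp: \<tau>_def \<l>_def)
  have "\<tau> * \<rho> = \<rho> powr (- (1 / (1 + a)) + 1)" using rho powr_add[of \<rho> "- (1 / (1 + a))" 1] unfolding \<tau>_def by simp
  also have "- (1 / (1 + a)) + 1 = a / (1 + a)" using a by (simp add: field_simps)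
  finally show "\<tau> * \<rho> = \<l>" by (simp add: \<l>_def)
  have "- (1 / (1 + a)) * (- (1 + a)) = 1" using a by (simp add: field_simps)
  then show "\<tau> powr (- (1 + a)) = \<rho>" using rho unfolding \<tau>_def powr_powr by simp
qed

lemma Z_meas[measurable]: "i \<in> {1..n} \<Longrightarrow> Z i \<in> P \<rightarrow>\<^sub>M E"
  and distr_Z: "i \<in> {1..n} \<Longrightarrow> distr P E (Z i) = \<pi>"
  using stationary_markov_chainD[OF chain] by auto

lemma eps_meas[measurable]: "i \<in> {1..n} \<Longrightarrow> \<epsilon> i \<in> borel_measurable P"
  using err by (auto simp: cond_indep_errors_def)

lemma m_meas[measurable]: "m \<in> borel_measurable E"
  unfolding m_def[abs_def] using M_meas by measurable

lemma fc_meas[measurable]: "fc i j \<in> borel_measurable E"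
proof (cases "i \<in> {1..n} \<and> j \<in> {1..d}")
  case True
  then have [measurable]: "f i j \<in> borel_measurable E" using f_meas by auto
  show ?thesis using True unfolding fc_def[abs_def] huber_score_def by simp
qed (auto simp: fc_def[abs_def])

lemma m_ge1: "1 \<le> m z" by (simp add: m_def)

lemma fc_le: "\<bar>fc i j z\<bar> \<le> m z"
  using abs_huber_score_le[of "m z"] m_ge1[of z] by (auto simp: fc_def)

lemma fc_eq: "AE \<omega> in P. \<forall>i\<in>{1..n}. \<forall>j\<in>{1..d}. f i j (Z i \<omega>) = fc i j (Z i \<omega>)"
proof -
  have "AE \<omega> in P. \<forall>j\<in>{1..d}. f i j (Z i \<omega>) = fc i j (Z i \<omega>)" if i: "i \<in> {1..n}" for i
  proof -
    have "AE z in distr P E (Z i). \<forall>j\<in>{1..d}. \<bar>f i j z\<bar> \<le> M z"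
      unfolding distr_Z[OF i] using envelope by eventually_elim (use i in auto)
    then have "AE \<omega> in P. \<forall>j\<in>{1..d}. \<bar>f i j (Z i \<omega>)\<bar> \<le> M (Z i \<omega>)"
      using AE_distrD[OF Z_meas[OF i]] by blast
    then show ?thesis
    proof eventually_elim
      case (elim \<omega>)
      show ?case
      proof
        fix j assume j: "j \<in> {1..d}"
        then have "\<bar>f i j (Z i \<omega>)\<bar> \<le> M (Z i \<omega>)" using elim by blast
        then have "\<bar>f i j (Z i \<omega>)\<bar> \<le> m (Z i \<omega>)" by (simp add: m_def)
        then show "f i j (Z i \<omega>) = fc i j (Z i \<omega>)" using i j by (auto simp: fc_def huber_score_def)
      qed
    qed
  qed
  then show ?thesis by (subst AE_finite_all) auto
qed

lemma m4: "integrable \<pi> (\<lambda>z. m z ^ 4)" "(\<integral>z. m z ^ 4 \<partial>\<pi>) \<le> Q"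
proof -
  have le: "m z ^ 4 \<le> 1 + M z ^ 4" for z by (auto simp: m_def max_def)
  have i: "integrable \<pi> (\<lambda>z. 1 + M z ^ 4)" using M_int by simp
  show 1: "integrable \<pi> (\<lambda>z. m z ^ 4)"
    by (rule Bochner_Integration.integrable_bound[OF i]) (use le in \<open>auto intro!: AE_I2 simp: measurable_cong_sets[OF \<pi>.sets_pi refl]\<close>)
  have "(\<integral>z. m z ^ 4 \<partial>\<pi>) \<le> (\<integral>z. 1 + M z ^ 4 \<partial>\<pi>)" by (rule integral_mono[OF 1 i le])
  also have "\<dots> = Q" using M_int M_moment by (simp add: Q_def \<pi>.prob_space)
  finally show "(\<integral>z. m z ^ 4 \<partial>\<pi>) \<le> Q" .
qed

lemma m_pow_le: "(m z)\<^sup>2 \<le> m z ^ 4"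
  using power_increasing[of 2 4 "m z"] m_ge1[of z] by auto

lemma integrable_m4:
  fixes q :: "'z \<Rightarrow> real"
  assumes [measurable]: "q \<in> borel_measurable E" and "\<And>z. \<bar>q z\<bar> \<le> m z ^ 4"
  shows "integrable \<pi> q"
  by (rule Bochner_Integration.integrable_bound[OF m4(1)])
     (use assms in \<open>auto intro!: AE_I2 simp: measurable_cong_sets[OF \<pi>.sets_pi refl]\<close>)

lemma integral_m4:
  fixes q :: "'z \<Rightarrow> real"
  assumes [measurable]: "q \<in> borel_measurable E" and b: "\<And>z. \<bar>q z\<bar> \<le> c * m z ^ 4" and c: "0 < c"
  shows "integrable \<pi> q" "\<bar>\<integral>z. q z \<partial>\<pi>\<bar> \<le> c * Q"
proof -
  have i: "integrable \<pi> (\<lambda>z. c * m z ^ 4)" using m4(1) by simp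
  show q: "integrable \<pi> q"
    by (rule Bochner_Integration.integrable_bound[OF i])
       (use b c in \<open>auto intro!: AE_I2 simp: measurable_cong_sets[OF \<pi>.sets_pi refl]\<close>)
  have "\<bar>\<integral>z. q z \<partial>\<pi>\<bar> \<le> (\<integral>z. \<bar>q z\<bar> \<partial>\<pi>)" by (rule integral_abs_bound)
  also have "\<dots> \<le> (\<integral>z. c * m z ^ 4 \<partial>\<pi>)" using q i b by (intro integral_mono) auto
  also have "\<dots> \<le> c * Q" using m4(2) c by simp
  finally show "\<bar>\<integral>z. q z \<partial>\<pi>\<bar> \<le> c * Q" .
qed

lemma nn_integral_Z:
  fixes q :: "'z \<Rightarrow> real"
  assumes q[measurable]: "q \<in> borel_measurable E" and q0: "\<And>z. 0 \<le> q z" and b: "\<And>z. q z \<le> c * m z ^ 4" and c: "0 < c"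
    and i: "i \<in> {1..n}"
  shows "(\<integral>\<^sup>+\<omega>. ennreal (q (Z i \<omega>)) \<partial>P) \<le> ennreal (c * Q)"
proof -
  have iq: "integrable \<pi> q" "\<bar>\<integral>z. q z \<partial>\<pi>\<bar> \<le> c * Q" using integral_m4[OF q _ c] q0 b by auto
  have "(\<integral>\<^sup>+\<omega>. ennreal (q (Z i \<omega>)) \<partial>P) = (\<integral>\<^sup>+z. ennreal (q z) \<partial>distr P E (Z i))"
    by (rule nn_integral_distr[OF Z_meas[OF i], symmetric]) measurable
  also have "\<dots> = ennreal (\<integral>z. q z \<partial>\<pi>)"
    unfolding distr_Z[OF i] by (rule nn_integral_eq_integral[OF iq(1)]) (simp add: q0)
  also have "\<dots> \<le> ennreal (c * Q)" using iq(2) by (intro ennreal_leI) simp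
  finally show ?thesis .
qed

text \<open>The dominance by \<open>(m z)\<^sup>2\<close> bounds the second moment by
  \<open>Q\<close>, which is where the fourth moment of the envelope enters. The third power of
  \<open>d\<close> leaves room for a union over all pairs of coordinates.\<close>

lemma Bernstein_rate:
  fixes q :: "nat \<Rightarrow> 'z \<Rightarrow> real"
  assumes q: "\<And>i. q i \<in> borel_measurable E" and qB: "\<And>i z. \<bar>q i z\<bar> \<le> B" and qm: "\<And>i z. \<bar>q i z\<bar> \<le> (m z)\<^sup>2"
  shows "measure P {\<omega> \<in> space P. real n * (D * sqrt \<rho>) \<le> \<bar>\<Sum>i=1..n. q i (Z i \<omega>) - (\<integral>z. q i z \<partial>\<pi>)\<bar>} \<le> 2 / real d ^ 3"
proof -
  have q2: "(\<integral>z. (q i z)\<^sup>2 \<partial>\<pi>) \<le> (sqrt Q)\<^sup>2" for i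
  proof -
    have "\<bar>(q i z)\<^sup>2\<bar> \<le> 1 * m z ^ 4" for z
      using power_mono[OF qm[of i z] abs_ge_zero, of 2] by (simp add: power_mult[symmetric])
    then have "\<bar>\<integral>z. (q i z)\<^sup>2 \<partial>\<pi>\<bar> \<le> 1 * Q" using q by (intro integral_m4(2)) auto
    then show ?thesis using Q by simp
  qed
  have g1: "0 < 1 - \<gamma>" using gap by simp
  have sr: "0 < sqrt \<rho>" "sqrt \<rho> * sqrt \<rho> = \<rho>" using rho by auto
  \<comment> \<open>The largest parameter that \<open>8 * \<theta> * B \<le> 1 - \<gamma>\<close>
    permits, as \<open>B * sqrt \<rho> = 1\<close>.\<close>
  define \<theta> where "\<theta> = sqrt \<rho> * (1 - \<gamma>) / 8"
  have th: "0 < \<theta>" "8 * \<theta> * B \<le> 1 - \<gamma>" using sr g1 by (auto simp: \<theta>_def B_def)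
  have "9 * real n * \<theta>\<^sup>2 * (sqrt Q)\<^sup>2 / (1 - \<gamma>) - \<theta> * (real n * (D * sqrt \<rho>))
      = (real n * (1 - \<gamma>) * (sqrt \<rho> * sqrt \<rho>)) * (9 * Q / 64 - D / 8)"
    using g1 Q by (simp add: \<theta>_def power2_eq_square field_simps)
  also have "\<dots> = (real n * (1 - \<gamma>) * \<rho>) * (9 * Q / 64 - D / 8)" by (simp only: sr)
  also have "\<dots> \<le> (real n * (1 - \<gamma>) * \<rho>) * (- 3)"
  proof (rule mult_left_mono)
    show "9 * Q / 64 - D / 8 \<le> - 3" unfolding D_def using Q by (simp add: field_simps)
  qed (use g1 rho in simp)
  also have "\<dots> \<le> - 3 * ln (real d)" using rho(4) by simp
  finally have e: "9 * real n * \<theta>\<^sup>2 * (sqrt Q)\<^sup>2 / (1 - \<gamma>) - \<theta> * (real n * (D * sqrt \<rho>)) \<le> - 3 * ln (real d)" .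
  have "measure P {\<omega> \<in> space P. real n * (D * sqrt \<rho>) \<le> \<bar>\<Sum>i=1..n. q i (Z i \<omega>) - (\<integral>z. q i z \<partial>\<pi>)\<bar>}
      \<le> 2 * exp (9 * real n * \<theta>\<^sup>2 * (sqrt Q)\<^sup>2 / (1 - \<gamma>) - \<theta> * (real n * (D * sqrt \<rho>)))"
    by (rule markov_chain_Bernstein[OF P chain n q qB q2 _ gamma gap th]) (use Q in auto)
  also have "\<dots> \<le> 2 * exp (- 3 * ln (real d))" using e by simp
  also have "exp (- 3 * ln (real d)) = 1 / real d ^ 3"
    using d exp_of_nat_mult[of 3 "ln (real d)"] by (simp add: exp_minus inverse_eq_divide)
  finally show ?thesis by simp
qed

lemma card_two_over_cube: "(real d)\<^sup>2 * (2 / real d ^ 3) = 2 / real d" "2 / real d ^ 3 \<le> 2 / real d"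
proof -
  have d1: "1 \<le> real d" using d by simp
  show "(real d)\<^sup>2 * (2 / real d ^ 3) = 2 / real d" using d1 by (simp add: power2_eq_square power3_eq_cube)
  show "2 / real d ^ 3 \<le> 2 / real d" using d1 power_increasing[of 1 3 "real d"] by (intro divide_left_mono) auto
qed

text \<open>The indicator involves the envelope only and not the coordinates, so the truncated Gram
  matrix remains a sum over retained observations and its form a sum of squares.\<close>

definition "q j k' i z = of_bool ((m z)\<^sup>2 \<le> B) * (fc i j z * fc i k' z)"

lemma q_bounds: "\<bar>q j k' i z\<bar> \<le> B" "\<bar>q j k' i z\<bar> \<le> (m z)\<^sup>2"
proof -
  have "\<bar>fc i j z * fc i k' z\<bar> \<le> m z * m z"
    unfolding abs_mult using fc_le m_ge1[of z] by (intro mult_mono) auto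
  then have 1: "\<bar>fc i j z * fc i k' z\<bar> \<le> (m z)\<^sup>2" by (simp add: power2_eq_square)
  have B0: "0 \<le> B" using rho by (simp add: B_def)
  show "\<bar>q j k' i z\<bar> \<le> B" "\<bar>q j k' i z\<bar> \<le> (m z)\<^sup>2"
    using 1 B0 by (auto simp: q_def)
qed

lemma q_meas[measurable]: "q j k' i \<in> borel_measurable E"
  unfolding q_def[abs_def] by measurable

definition "gram_bad = (\<Union>(j, k')\<in>{1..d} \<times> {1..d}. {\<omega> \<in> space P. real n * (D * sqrt \<rho>) \<le> \<bar>\<Sum>i=1..n. q j k' i (Z i \<omega>) - (\<integral>z. q j k' i z \<partial>\<pi>)\<bar>})"

lemma gram_bad: "gram_bad \<in> events" "prob gram_bad \<le> 2 / real d"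
proof -
  let ?A = "\<lambda>p. {\<omega> \<in> space P. real n * (D * sqrt \<rho>) \<le> \<bar>\<Sum>i=1..n. q (fst p) (snd p) i (Z i \<omega>) - (\<integral>z. q (fst p) (snd p) i z \<partial>\<pi>)\<bar>}"
  have eq: "gram_bad = (\<Union>p\<in>{1..d} \<times> {1..d}. ?A p)" by (auto simp: gram_bad_def)
  have A: "?A p \<in> events" for p by measurable
  show "gram_bad \<in> events" unfolding eq using A by (intro sets.finite_UN) auto
  have "prob gram_bad \<le> (\<Sum>p\<in>{1..d} \<times> {1..d}. prob (?A p))"
    unfolding eq using A by (intro finite_measure_subadditive_finite) auto
  also have "\<dots> \<le> (\<Sum>p\<in>{1..d} \<times> {1..d}. 2 / real d ^ 3)"
    by (intro sum_mono Bernstein_rate) (use q_bounds in auto)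
  also have "\<dots> = (real d)\<^sup>2 * (2 / real d ^ 3)" by (simp add: power2_eq_square)
  finally show "prob gram_bad \<le> 2 / real d" by (simp only: card_two_over_cube)
qed

text \<open>The part of \<open>m\<^sup>2\<close> above \<open>B\<close> is unbounded and beyond the
  Bernstein inequality. A crude first-moment bound suffices for it, because only the level
  \<open>n\<close> has to be excluded.\<close>

definition "env_bad = {\<omega> \<in> space P. real n * (D * sqrt \<rho>) \<le> \<bar>\<Sum>i=1..n. of_bool ((m (Z i \<omega>))\<^sup>2 \<le> B) * (m (Z i \<omega>))\<^sup>2 - (\<integral>z. of_bool ((m z)\<^sup>2 \<le> B) * (m z)\<^sup>2 \<partial>\<pi>)\<bar>}
    \<union> {\<omega> \<in> space P. real n \<le> (\<Sum>i=1..n. of_bool (B < (m (Z i \<omega>))\<^sup>2) * (m (Z i \<omega>))\<^sup>2)}"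

text \<open>On the tail \<open>m\<^sup>2 / B\<close> exceeds 1; one more factor of it trades two
  moments for the small number \<open>sqrt \<rho> = 1 / B\<close>.\<close>

lemma tail_m: "of_bool (B < (m z)\<^sup>2) * (m z)\<^sup>2 \<le> sqrt \<rho> * m z ^ 4"
proof (cases "B < (m z)\<^sup>2")
  case True
  then have "1 \<le> sqrt \<rho> * (m z)\<^sup>2" using rho by (simp add: B_def field_simps)
  then have "1 * (m z)\<^sup>2 \<le> sqrt \<rho> * (m z)\<^sup>2 * (m z)\<^sup>2" by (intro mult_right_mono) auto
  then show ?thesis using True by (simp add: mult.assoc power_add[symmetric])
qed (use rho in simp)

lemma env_bad: "env_bad \<in> events" "prob env_bad \<le> 2 / real d + Q * sqrt \<rho>"
proof -
  let ?A = "{\<omega> \<in> space P. real n * (D * sqrt \<rho>) \<le> \<bar>\<Sum>i=1..n. of_bool ((m (Z i \<omega>))\<^sup>2 \<le> B) * (m (Z i \<omega>))\<^sup>2 - (\<integral>z. of_bool ((m z)\<^sup>2 \<le> B) * (m z)\<^sup>2 \<partial>\<pi>)\<bar>}"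
  let ?T = "\<lambda>z. of_bool (B < (m z)\<^sup>2) * (m z)\<^sup>2"
  let ?C = "{\<omega> \<in> space P. real n \<le> (\<Sum>i=1..n. ?T (Z i \<omega>))}"
  have A: "?A \<in> events" "?C \<in> events" by measurable
  then show "env_bad \<in> events" by (simp add: env_bad_def)
  have B0: "0 \<le> B" using rho by (simp add: B_def)
  have "prob ?A \<le> 2 / real d ^ 3"
    by (rule Bernstein_rate[of "\<lambda>i z. of_bool ((m z)\<^sup>2 \<le> B) * (m z)\<^sup>2"]) (use B0 in auto)
  moreover have "prob ?C \<le> (real n * (sqrt \<rho> * Q)) / real n"
  proof (rule Markov_inequality_nn)
    have "(\<integral>\<^sup>+\<omega>. ennreal (\<Sum>i=1..n. ?T (Z i \<omega>)) \<partial>P) = (\<Sum>i=1..n. \<integral>\<^sup>+\<omega>. ennreal (?T (Z i \<omega>)) \<partial>P)"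
      by (subst nn_integral_sum[symmetric]) (auto simp: sum_ennreal)
    also have "\<dots> \<le> (\<Sum>i=1..n. ennreal (sqrt \<rho> * Q))"
      using tail_m rho by (intro sum_mono nn_integral_Z) auto
    also have "\<dots> = ennreal (real n * (sqrt \<rho> * Q))" using Q rho by (simp add: ennreal_mult ennreal_of_nat_eq_real_of_nat)
    finally show "(\<integral>\<^sup>+\<omega>. ennreal (\<Sum>i=1..n. ?T (Z i \<omega>)) \<partial>P) \<le> ennreal (real n * (sqrt \<rho> * Q))" .
    show "(\<lambda>\<omega>. \<Sum>i=1..n. ?T (Z i \<omega>)) \<in> borel_measurable P" by measurable
  qed (use n Q rho in auto)
  moreover have "prob env_bad \<le> prob ?A + prob ?C" unfolding env_bad_def using A by (intro measure_Un_le) auto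
  ultimately show "prob env_bad \<le> 2 / real d + Q * sqrt \<rho>" using card_two_over_cube(2) n by (simp add: mult.commute)
qed

lemma env_good:
  assumes w: "\<omega> \<in> space P" "\<omega> \<notin> env_bad"
  shows "(\<Sum>i=1..n. (m (Z i \<omega>))\<^sup>2) \<le> C\<^sub>1 * real n"
proof -
  let ?S = "\<lambda>z. of_bool ((m z)\<^sup>2 \<le> B) * (m z)\<^sup>2" and ?T = "\<lambda>z. of_bool (B < (m z)\<^sup>2) * (m z)\<^sup>2"
  have "(\<Sum>i=1..n. (m (Z i \<omega>))\<^sup>2) = (\<Sum>i=1..n. (?S (Z i \<omega>) - (\<integral>z. ?S z \<partial>\<pi>)) + (\<integral>z. ?S z \<partial>\<pi>) + ?T (Z i \<omega>))"
    by (intro sum.cong) auto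
  also have "\<dots> = (\<Sum>i=1..n. ?S (Z i \<omega>) - (\<integral>z. ?S z \<partial>\<pi>)) + real n * (\<integral>z. ?S z \<partial>\<pi>) + (\<Sum>i=1..n. ?T (Z i \<omega>))"
    unfolding sum.distrib by simp
  also have "\<dots> \<le> real n * (D * sqrt \<rho>) + real n * (1 * Q) + real n"
  proof (intro add_mono mult_left_mono)
    show "(\<Sum>i=1..n. ?S (Z i \<omega>) - (\<integral>z. ?S z \<partial>\<pi>)) \<le> real n * (D * sqrt \<rho>)" "(\<Sum>i=1..n. ?T (Z i \<omega>)) \<le> real n"
      using w by (auto simp: env_bad_def)
    have "\<bar>\<integral>z. ?S z \<partial>\<pi>\<bar> \<le> 1 * Q" using m_pow_le by (intro integral_m4(2)) auto
    then show "(\<integral>z. ?S z \<partial>\<pi>) \<le> 1 * Q" by simp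
  qed simp
  also have "\<dots> \<le> real n * (D * 1) + real n * (1 * Q) + real n"
    using rho Q by (intro add_mono mult_left_mono) (auto simp: D_def)
  finally show ?thesis by (simp add: C\<^sub>1_def D_def algebra_simps)
qed

end

lemma powr_divide_minus_Suc:
  fixes t x a :: real
  assumes "0 < t" "0 < x"
  shows "(t / x) powr (- 1 - a) = t powr (- 1 - a) * x powr (1 + a)"
proof -
  have "x powr (- 1 - a) = inverse (x powr (1 + a))" using powr_minus[of x "1 + a"] by simp
  then show ?thesis using assms by (simp add: powr_divide field_simps)
qed

section \<open>Error sums given the chain\<close>

context markov_huber_model
begin

text \<open>Lowering the exponent from \<open>1 + \<delta>\<close> to \<open>1 + a\<close> costs an
  additive 1, which is why \<open>V = 1 + v\<close>.\<close>

lemma error_law: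
  "AE \<omega> in P. \<forall>i\<in>{1..n}. heavy_tailed (g (Z i \<omega>)) a V \<and> (\<integral>e. e \<partial>g (Z i \<omega>)) = 0"
proof -
  have g: "g \<in> E \<rightarrow>\<^sub>M prob_algebra borel" using err by (simp add: cond_indep_errors_def)
  have ple: "\<bar>e\<bar> powr (1 + a) \<le> 1 + \<bar>e\<bar> powr (1 + \<delta>)" for e :: real
  proof (cases "\<bar>e\<bar> \<le> 1")
    case True
    have "\<bar>e\<bar> powr (1 + a) \<le> 1" using True a powr_mono2[of "1 + a" "\<bar>e\<bar>" 1] by simp
    then show ?thesis using powr_ge_zero[of "\<bar>e\<bar>" "1 + \<delta>"] by linarith
  next
    case False
    then have "\<bar>e\<bar> powr (1 + a) \<le> \<bar>e\<bar> powr (1 + \<delta>)" by (intro powr_mono) (auto simp: a_def)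
    then show ?thesis by simp
  qed
  have "AE \<omega> in P. heavy_tailed (g (Z i \<omega>)) a V \<and> (\<integral>e. e \<partial>g (Z i \<omega>)) = 0" if i: "i \<in> {1..n}" for i
  proof -
    have "AE \<omega> in P. (\<integral>\<^sup>+e. ennreal (\<bar>e\<bar> powr (1 + \<delta>)) \<partial>g (Z i \<omega>)) \<le> ennreal v"
      by (rule error_abs_moment[OF P _ err moments i]) (rule Z_meas)
    moreover have "AE \<omega> in P. (\<integral>e. e \<partial>g (Z i \<omega>)) = 0"
      by (rule error_cond_mean[OF P _ err moments i delta]) (rule Z_meas)
    ultimately show ?thesis using AE_space
  proof eventually_elim
    case (elim \<omega>)
    have z: "Z i \<omega> \<in> space E" using measurable_space[OF Z_meas[OF i] elim(3)] .
    interpret gi: prob_space "g (Z i \<omega>)" by (rule prob_algebraD[OF g z])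
    have sets[measurable_cong]: "sets (g (Z i \<omega>)) = sets borel" by (rule prob_algebraD[OF g z])
    have "(\<integral>\<^sup>+e. ennreal (\<bar>e\<bar> powr (1 + a)) \<partial>g (Z i \<omega>)) \<le> (\<integral>\<^sup>+e. 1 + ennreal (\<bar>e\<bar> powr (1 + \<delta>)) \<partial>g (Z i \<omega>))"
    proof (rule nn_integral_mono)
      fix e
      have "ennreal (\<bar>e\<bar> powr (1 + a)) \<le> ennreal (1 + \<bar>e\<bar> powr (1 + \<delta>))" by (rule ennreal_leI[OF ple])
      then show "ennreal (\<bar>e\<bar> powr (1 + a)) \<le> 1 + ennreal (\<bar>e\<bar> powr (1 + \<delta>))" by simp
    qed
    also have "\<dots> = 1 + (\<integral>\<^sup>+e. ennreal (\<bar>e\<bar> powr (1 + \<delta>)) \<partial>g (Z i \<omega>))"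
      by (subst nn_integral_add) (auto simp: gi.emeasure_space_1)
    also have "\<dots> \<le> 1 + ennreal v" by (intro add_left_mono elim(1))
    also have "\<dots> = ennreal V" using v by (simp add: V_def)
    finally have "heavy_tailed (g (Z i \<omega>)) a V"
      using a V sets by unfold_locales auto
    then show ?case using elim(2) by simp
  qed
  qed
  then show ?thesis by (subst AE_finite_all) auto
qed

text \<open>Dividing the level by \<open>m\<close> costs \<open>m powr (1 + a)\<close>, at most
  \<open>m\<^sup>2\<close> because \<open>m \<ge> 1\<close> and \<open>a \<le> 1\<close>. All
  compensators below are multiples of this quantity.\<close>

lemma t_powr: "(\<tau> / m z) powr (- 1 - a) \<le> \<rho> * (m z)\<^sup>2"
proof -
  have m: "1 \<le> m z" by (rule m_ge1)
  have "(\<tau> / m z) powr (- 1 - a) = \<rho> * m z powr (1 + a)"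
    using tau m powr_divide_minus_Suc[of \<tau> "m z" a] by simp
  also have "m z powr (1 + a) \<le> m z powr 2" using m a by (intro powr_mono) auto
  also have "m z powr 2 = (m z)\<^sup>2" using m by simp
  finally show ?thesis using rho by simp
qed

lemma t_pos: "0 < \<tau> / m z" using tau m_ge1[of z] by simp

lemma huber_score_measurable[measurable (raw)]:
  assumes [measurable]: "t \<in> borel_measurable N" "e \<in> borel_measurable N"
  shows "(\<lambda>x. huber_score (t x) (e x)) \<in> borel_measurable N"
  unfolding huber_score_def by measurable

text \<open>Coordinate \<open>j\<close> of the clipped gradient in units of \<open>\<tau>\<close>,
  with sign \<open>s\<close>, minus the bound from \<open>truncated_mgf_le\<close> and
  \<open>t_powr\<close> on its conditional log moment generating function.\<close>

definition "score_term s j i p = s * fc i j (fst p) / \<tau> * huber_score (\<tau> / m (fst p)) (snd p) - 2 * V * \<rho> * (m (fst p))\<^sup>2"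

text \<open>The first part is \<open>m * \<bar>e\<bar>\<close> on the middle range in units of
  \<open>k * \<tau>\<close>, since \<open>k * (\<tau> / m)\<close> is the denominator; the
  subtracted part is again the compensator.\<close>

definition "middle_term p = \<bar>snd p\<bar> * of_bool (\<tau> / m (fst p) < \<bar>snd p\<bar> \<and> \<bar>snd p\<bar> \<le> k * (\<tau> / m (fst p))) / (k * (\<tau> / m (fst p)))
    - 2 * V / k * (\<rho> * (m (fst p))\<^sup>2)"

definition "tail_term p = m (fst p) * \<bar>snd p\<bar> * of_bool (k * (\<tau> / m (fst p)) < \<bar>snd p\<bar>)"

text \<open>Mass of the observations given up in \<open>restricted_strong_convexity\<close> because
  their error leaves half of the quadratic zone.\<close>

definition "exceed_term p = (m (fst p))\<^sup>2 * of_bool (\<tau> / 2 < \<bar>snd p\<bar>)"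

lemma term_meas[measurable]:
  "score_term s j i \<in> borel_measurable (E \<Otimes>\<^sub>M borel)" "middle_term \<in> borel_measurable (E \<Otimes>\<^sub>M borel)"
  "tail_term \<in> borel_measurable (E \<Otimes>\<^sub>M borel)" "exceed_term \<in> borel_measurable (E \<Otimes>\<^sub>M borel)"
  unfolding score_term_def[abs_def] middle_term_def[abs_def] tail_term_def[abs_def] exceed_term_def[abs_def]
  by measurable

lemma term_meas_P[measurable]:
  assumes "i \<in> {1..n}" and T: "T \<in> borel_measurable (E \<Otimes>\<^sub>M borel)"
  shows "(\<lambda>\<omega>. T (Z i \<omega>, \<epsilon> i \<omega>)) \<in> borel_measurable P"
  by (rule measurable_compose[OF measurable_Pair[OF Z_meas eps_meas] T]) fact+

text \<open>The compensator leaves a conditional exponential moment of at most 1. At the level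
  \<open>2 * ln d\<close> this gives \<open>1 / d\<^sup>2\<close>, and a union over coordinates and
  signs still tends to 0.\<close>

lemma score_term_prob:
  assumes s: "\<bar>s\<bar> = 1"
  shows "prob {\<omega> \<in> space P. 2 * ln (real d) \<le> (\<Sum>i=1..n. score_term s j i (Z i \<omega>, \<epsilon> i \<omega>))} \<le> 1 / (real d)\<^sup>2"
proof -
  have "prob {\<omega> \<in> space P. 2 * ln (real d) \<le> (\<Sum>i=1..n. score_term s j i (Z i \<omega>, \<epsilon> i \<omega>))} \<le> exp (- (2 * ln (real d)))"
  proof (rule cond_indep_Chernoff[OF P Z_meas err term_meas(1)])
    show "AE \<omega> in P. \<forall>i\<in>{1..n}. (\<integral>\<^sup>+e. ennreal (exp (score_term s j i (Z i \<omega>, e))) \<partial>g (Z i \<omega>)) \<le> 1"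
      using error_law
    proof eventually_elim
      case (elim \<omega>)
      show ?case
      proof
        fix i assume i: "i \<in> {1..n}"
        let ?z = "Z i \<omega>" and ?t = "\<tau> / m (Z i \<omega>)"
        interpret h: heavy_tailed "g ?z" a V using elim i by blast
        have mean: "(\<integral>e. e \<partial>g ?z) = 0" using elim i by blast
        let ?c = "s * fc i j ?z / \<tau>"
        \<comment> \<open>The level was divided by \<open>m\<close> for the sake of this bound: the
          coefficient of the clipped error is at most \<open>m / \<tau> = 1 / t\<close>.\<close>
        have c: "\<bar>?c\<bar> \<le> 1 / ?t"
          using fc_le[of i j ?z] s tau by (simp add: abs_mult divide_right_mono)
        have "(\<integral>\<^sup>+e. ennreal (exp (score_term s j i (?z, e))) \<partial>g ?z)
            = (\<integral>\<^sup>+e. ennreal (exp (- (2 * V * \<rho> * (m ?z)\<^sup>2))) * ennreal (exp (?c * huber_score ?t e)) \<partial>g ?z)"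
          by (simp add: score_term_def exp_diff exp_minus ennreal_mult'[symmetric] field_simps)
        also have "\<dots> = ennreal (exp (- (2 * V * \<rho> * (m ?z)\<^sup>2))) * (\<integral>\<^sup>+e. ennreal (exp (?c * huber_score ?t e)) \<partial>g ?z)"
          by (rule nn_integral_cmult) measurable
        also have "\<dots> \<le> ennreal (exp (- (2 * V * \<rho> * (m ?z)\<^sup>2))) * ennreal (exp (2 * V * ?t powr (- (1 + a))))"
          by (intro mult_left_mono h.truncated_mgf_le[OF t_pos mean c]) simp
        also have "\<dots> = ennreal (exp (2 * V * ?t powr (- (1 + a)) - 2 * V * \<rho> * (m ?z)\<^sup>2))"
          by (simp add: ennreal_mult'[symmetric] exp_add[symmetric])
        also have "\<dots> \<le> ennreal 1"
        proof (intro ennreal_leI)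
          have "2 * V * ?t powr (- 1 - a) \<le> 2 * V * (\<rho> * (m ?z)\<^sup>2)"
            using t_powr[of ?z] V by (intro mult_left_mono) auto
          then show "exp (2 * V * ?t powr (- (1 + a)) - 2 * V * \<rho> * (m ?z)\<^sup>2) \<le> 1" by simp
        qed
        finally show "(\<integral>\<^sup>+e. ennreal (exp (score_term s j i (?z, e))) \<partial>g ?z) \<le> 1" by simp
      qed
    qed
  qed
  also have "exp (- (2 * ln (real d))) = 1 / (real d)\<^sup>2"
    using d exp_of_nat_mult[of 2 "ln (real d)"] by (simp add: exp_minus inverse_eq_divide)
  finally show ?thesis .
qed

text \<open>All coordinates share this sum, so the modest level \<open>ln k\<close> is
  enough.\<close>

lemma middle_term_prob:
  "prob {\<omega> \<in> space P. ln k \<le> (\<Sum>i=1..n. middle_term (Z i \<omega>, \<epsilon> i \<omega>))} \<le> 1 / k"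
proof -
  have "prob {\<omega> \<in> space P. ln k \<le> (\<Sum>i=1..n. middle_term (Z i \<omega>, \<epsilon> i \<omega>))} \<le> exp (- ln k)"
  proof (rule cond_indep_Chernoff[OF P Z_meas err term_meas(2)])
    show "AE \<omega> in P. \<forall>i\<in>{1..n}. (\<integral>\<^sup>+e. ennreal (exp (middle_term (Z i \<omega>, e))) \<partial>g (Z i \<omega>)) \<le> 1"
      using error_law
    proof eventually_elim
      case (elim \<omega>)
      show ?case
      proof
        fix i assume i: "i \<in> {1..n}"
        let ?z = "Z i \<omega>" and ?t = "\<tau> / m (Z i \<omega>)"
        interpret h: heavy_tailed "g ?z" a V using elim i by blast
        let ?u = "\<lambda>e. \<bar>e\<bar> * of_bool (?t < \<bar>e\<bar> \<and> \<bar>e\<bar> \<le> k * ?t) / (k * ?t)"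
        let ?r = "2 * V / k * (\<rho> * (m ?z)\<^sup>2)"
        have "(\<integral>\<^sup>+e. ennreal (exp (middle_term (?z, e))) \<partial>g ?z) = (\<integral>\<^sup>+e. ennreal (exp (- ?r)) * ennreal (exp (?u e)) \<partial>g ?z)"
        proof (rule nn_integral_cong)
          fix e
          have "exp (middle_term (?z, e)) = exp (- ?r) * exp (?u e)"
            unfolding exp_add[symmetric] by (simp add: middle_term_def)
          then show "ennreal (exp (middle_term (?z, e))) = ennreal (exp (- ?r)) * ennreal (exp (?u e))"
            by (simp only: ennreal_mult'[OF exp_ge_zero, symmetric])
        qed
        also have "\<dots> = ennreal (exp (- ?r)) * (\<integral>\<^sup>+e. ennreal (exp (?u e)) \<partial>g ?z)"
          by (rule nn_integral_cmult) measurable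
        also have "\<dots> \<le> ennreal (exp (- ?r)) * ennreal (exp (2 * V / k * ?t powr (- (1 + a))))"
          by (intro mult_left_mono h.middle_mgf_le[OF t_pos k]) simp
        also have "\<dots> = ennreal (exp (2 * V / k * ?t powr (- (1 + a)) - ?r))"
          by (simp add: ennreal_mult'[symmetric] exp_add[symmetric])
        also have "\<dots> \<le> ennreal 1"
        proof (intro ennreal_leI)
          have "2 * V / k * ?t powr (- 1 - a) \<le> ?r"
            using t_powr[of ?z] V k by (intro mult_left_mono) auto
          then show "exp (2 * V / k * ?t powr (- (1 + a)) - ?r) \<le> 1" by simp
        qed
        finally show "(\<integral>\<^sup>+e. ennreal (exp (middle_term (?z, e))) \<partial>g ?z) \<le> 1" by simp
      qed
    qed
  qed
  also have "exp (- ln k) = 1 / k" using k by (simp add: exp_minus inverse_eq_divide)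
  finally show ?thesis .
qed

text \<open>Integrating out the errors leaves \<open>b * m\<^sup>2\<close>; by stationarity and
  \<open>m\<^sup>2 \<le> m ^ 4\<close> its mean is at most \<open>b * Q\<close>.\<close>

lemma term_Markov:
  assumes T: "T \<in> borel_measurable (E \<Otimes>\<^sub>M borel)" and T0: "\<And>p. 0 \<le> T p" and b: "0 < b" and c: "0 < c"
    and le: "AE \<omega> in P. \<forall>i\<in>{1..n}. (\<integral>\<^sup>+e. ennreal (T (Z i \<omega>, e)) \<partial>g (Z i \<omega>)) \<le> ennreal (b * (m (Z i \<omega>))\<^sup>2)"
  shows "prob {\<omega> \<in> space P. real n * c \<le> (\<Sum>i=1..n. T (Z i \<omega>, \<epsilon> i \<omega>))} \<le> b * Q / c"
proof -
  have "prob {\<omega> \<in> space P. real n * c \<le> (\<Sum>i=1..n. T (Z i \<omega>, \<epsilon> i \<omega>))} \<le> (real n * (b * Q)) / (real n * c)"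
  proof (rule Markov_inequality_nn)
    show "(\<lambda>\<omega>. \<Sum>i=1..n. T (Z i \<omega>, \<epsilon> i \<omega>)) \<in> borel_measurable P"
      using T by (intro borel_measurable_sum term_meas_P) auto
    show "0 < real n * c" using n c by simp
    show "0 \<le> real n * (b * Q)" using b Q by simp
    have "(\<integral>\<^sup>+\<omega>. ennreal (\<Sum>i=1..n. T (Z i \<omega>, \<epsilon> i \<omega>)) \<partial>P) = (\<Sum>i=1..n. \<integral>\<^sup>+\<omega>. ennreal (T (Z i \<omega>, \<epsilon> i \<omega>)) \<partial>P)"
      using T0 term_meas_P[OF _ T] by (subst nn_integral_sum[symmetric]) (auto simp: sum_ennreal)
    also have "\<dots> \<le> (\<Sum>i=1..n. ennreal (b * Q))"
    proof (rule sum_mono)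
      fix i assume i: "i \<in> {1..n}"
      have "(\<integral>\<^sup>+\<omega>. ennreal (T (Z i \<omega>, \<epsilon> i \<omega>)) \<partial>P) = (\<integral>\<^sup>+\<omega>. \<integral>\<^sup>+e. ennreal (T (Z i \<omega>, e)) \<partial>g (Z i \<omega>) \<partial>P)"
        using cond_indep_single[OF P Z_meas err i, of "\<lambda>p. ennreal (T p)"] T by simp
      also have "\<dots> \<le> (\<integral>\<^sup>+\<omega>. ennreal (b * (m (Z i \<omega>))\<^sup>2) \<partial>P)"
        by (rule nn_integral_mono_AE) (use le i in \<open>auto elim: eventually_mono\<close>)
      also have "\<dots> \<le> ennreal (b * Q)"
        using b m_pow_le by (intro nn_integral_Z[OF _ _ _ b i, of "\<lambda>z. b * (m z)\<^sup>2"]) auto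
      finally show "(\<integral>\<^sup>+\<omega>. ennreal (T (Z i \<omega>, \<epsilon> i \<omega>)) \<partial>P) \<le> ennreal (b * Q)" .
    qed
    also have "\<dots> = ennreal (real n * (b * Q))" using Q b by (simp add: ennreal_mult ennreal_of_nat_eq_real_of_nat)
    finally show "(\<integral>\<^sup>+\<omega>. ennreal (\<Sum>i=1..n. T (Z i \<omega>, \<epsilon> i \<omega>)) \<partial>P) \<le> ennreal (real n * (b * Q))" .
  qed
  then show ?thesis using n by simp
qed

lemma tail_term_prob:
  "prob {\<omega> \<in> space P. real n * \<l> \<le> (\<Sum>i=1..n. tail_term (Z i \<omega>, \<epsilon> i \<omega>))} \<le> V * Q * k powr (- a)"
proof -
  have "prob {\<omega> \<in> space P. real n * \<l> \<le> (\<Sum>i=1..n. tail_term (Z i \<omega>, \<epsilon> i \<omega>))} \<le> (V * k powr (- a) * \<l>) * Q / \<l>"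
  proof (rule term_Markov[OF term_meas(3)])
    show "0 \<le> tail_term p" for p using m_ge1[of "fst p"] by (simp add: tail_term_def)
    show "0 < V * k powr (- a) * \<l>" using V k tau by simp
    show "AE \<omega> in P. \<forall>i\<in>{1..n}. (\<integral>\<^sup>+e. ennreal (tail_term (Z i \<omega>, e)) \<partial>g (Z i \<omega>)) \<le> ennreal (V * k powr (- a) * \<l> * (m (Z i \<omega>))\<^sup>2)"
      using error_law
    proof eventually_elim
      case (elim \<omega>)
      show ?case
      proof
        fix i assume i: "i \<in> {1..n}"
        let ?z = "Z i \<omega>" and ?t = "\<tau> / m (Z i \<omega>)"
        interpret h: heavy_tailed "g ?z" a V using elim i by blast
        have m: "1 \<le> m ?z" by (rule m_ge1)
        have kt: "0 < k * ?t" using k by (intro mult_pos_pos t_pos) simp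
        have "(\<integral>\<^sup>+e. ennreal (tail_term (?z, e)) \<partial>g ?z) \<le> ennreal (m ?z * (V * (k * ?t) powr (- a)))"
          using h.nn_integral_tail_le[OF kt, of "m ?z"] m by (simp add: tail_term_def)
        also have "m ?z * (V * (k * ?t) powr (- a)) \<le> V * k powr (- a) * \<l> * (m ?z)\<^sup>2"
        proof -
          have t0: "0 < ?t" by (rule t_pos)
          \<comment> \<open>Writing \<open>m\<close> as \<open>\<tau> / t\<close> lowers the
            exponent of \<open>t\<close> from \<open>- a\<close> to \<open>- 1 - a\<close>, where
            \<open>t_powr\<close> applies.\<close>
          have "m ?z * (V * (k * ?t) powr (- a)) = V * k powr (- a) * \<tau> * ?t powr (- 1 - a)"
          proof -
            have "(k * ?t) powr (- a) = k powr (- a) * ?t powr (- a)" using t0 k by (intro powr_mult)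
            then show ?thesis using m tau(1) by (simp only: powr_minus_Suc[OF t0]) simp
          qed
          also have "\<dots> \<le> V * k powr (- a) * \<tau> * (\<rho> * (m ?z)\<^sup>2)"
            using V tau t_powr[of ?z] by (intro mult_left_mono) auto
          also have "\<dots> = V * k powr (- a) * \<l> * (m ?z)\<^sup>2" by (simp add: tau(2)[symmetric])
          finally show ?thesis .
        qed
        finally show "(\<integral>\<^sup>+e. ennreal (tail_term (?z, e)) \<partial>g ?z) \<le> ennreal (V * k powr (- a) * \<l> * (m ?z)\<^sup>2)"
          by (simp add: ennreal_leI)
      qed
    qed
  qed (rule tau)
  then show ?thesis using tau(4) by (simp add: mult_ac)
qed

text \<open>The 4 bounds \<open>2 powr (1 + a)\<close>, the price of halving the level. The
  probability stays small for \<open>W\<close> of order \<open>1 / s\<close>, because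
  \<open>s * \<rho>\<close> tends to 0.\<close>

lemma exceed_term_prob:
  assumes W: "0 < W"
  shows "prob {\<omega> \<in> space P. real n * W \<le> (\<Sum>i=1..n. exceed_term (Z i \<omega>, \<epsilon> i \<omega>))} \<le> 4 * V * Q * \<rho> / W"
proof -
  have "prob {\<omega> \<in> space P. real n * W \<le> (\<Sum>i=1..n. exceed_term (Z i \<omega>, \<epsilon> i \<omega>))} \<le> (4 * V * \<rho>) * Q / W"
  proof (rule term_Markov[OF term_meas(4)])
    show "0 \<le> exceed_term p" for p by (simp add: exceed_term_def)
    show "0 < 4 * V * \<rho>" using V rho by simp
    show "AE \<omega> in P. \<forall>i\<in>{1..n}. (\<integral>\<^sup>+e. ennreal (exceed_term (Z i \<omega>, e)) \<partial>g (Z i \<omega>)) \<le> ennreal (4 * V * \<rho> * (m (Z i \<omega>))\<^sup>2)"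
      using error_law
    proof eventually_elim
      case (elim \<omega>)
      show ?case
      proof
        fix i assume i: "i \<in> {1..n}"
        let ?z = "Z i \<omega>"
        interpret h: heavy_tailed "g ?z" a V using elim i by blast
        have t2: "0 < \<tau> / 2" using tau by simp
        have "(\<integral>\<^sup>+e. ennreal (exceed_term (?z, e)) \<partial>g ?z) \<le> ennreal ((m ?z)\<^sup>2 * (V * (\<tau> / 2) powr (- (1 + a))))"
          using h.nn_integral_exceed_le[OF t2, of "(m ?z)\<^sup>2"] by (simp add: exceed_term_def)
        also have "(\<tau> / 2) powr (- (1 + a)) \<le> 4 * \<rho>"
        proof -
          have "(\<tau> / 2) powr (- (1 + a)) = \<rho> * 2 powr (1 + a)"
            using tau powr_divide_minus_Suc[of \<tau> 2 a] by simp
          also have "2 powr (1 + a) \<le> 2 powr (2 :: real)" using a by (intro powr_mono) auto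
          finally show ?thesis using rho by simp
        qed
        then have "(m ?z)\<^sup>2 * (V * (\<tau> / 2) powr (- (1 + a))) \<le> (m ?z)\<^sup>2 * (V * (4 * \<rho>))"
          using V by (intro mult_left_mono) auto
        finally show "(\<integral>\<^sup>+e. ennreal (exceed_term (?z, e)) \<partial>g ?z) \<le> ennreal (4 * V * \<rho> * (m ?z)\<^sup>2)"
          by (simp add: ennreal_leI mult_ac)
      qed
    qed
  qed (rule W)
  then show ?thesis by (simp add: mult_ac)
qed


definition "score_bad = (\<Union>(j, s)\<in>{1..d} \<times> {1, - 1}. {\<omega> \<in> space P. 2 * ln (real d) \<le> (\<Sum>i=1..n. score_term s j i (Z i \<omega>, \<epsilon> i \<omega>))})"

lemma score_bad: "score_bad \<in> events" "prob score_bad \<le> 2 / real d"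
proof -
  let ?I = "{1..d} \<times> {1, - 1 :: real}"
  let ?A = "\<lambda>p. {\<omega> \<in> space P. 2 * ln (real d) \<le> (\<Sum>i=1..n. score_term (snd p) (fst p) i (Z i \<omega>, \<epsilon> i \<omega>))}"
  have eq: "score_bad = (\<Union>p\<in>?I. ?A p)" by (auto simp: score_bad_def)
  have A: "?A p \<in> events" for p by measurable
  show "score_bad \<in> events" unfolding eq using A by (intro sets.finite_UN) auto
  have "prob score_bad \<le> (\<Sum>p\<in>?I. prob (?A p))"
    unfolding eq using A by (intro finite_measure_subadditive_finite) auto
  also have "\<dots> \<le> (\<Sum>p\<in>?I. 1 / (real d)\<^sup>2)" by (intro sum_mono score_term_prob) auto
  also have "\<dots> = 2 / real d" using d by (simp add: card_cartesian_product power2_eq_square)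
  finally show "prob score_bad \<le> 2 / real d" .
qed

text \<open>Deterministic bookkeeping: undoing the compensators bounds \<open>S\<close>,
  \<open>R\<close> and \<open>T\<close> by \<open>2 + 2 * V * C\<^sub>1\<close>,
  \<open>1 + 2 * V * C\<^sub>1\<close> and 1 times \<open>n * \<l>\<close>, and the three add up to
  the constant of the statement.\<close>

lemma gradient_bound:
  fixes \<omega>
  assumes score: "\<And>s. s \<in> {1, - 1} \<Longrightarrow> (\<Sum>i=1..n. score_term s j i (Z i \<omega>, \<epsilon> i \<omega>)) < 2 * ln (real d)"
    and mid: "(\<Sum>i=1..n. middle_term (Z i \<omega>, \<epsilon> i \<omega>)) < ln k"
    and tail: "(\<Sum>i=1..n. tail_term (Z i \<omega>, \<epsilon> i \<omega>)) < real n * \<l>"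
    and env: "(\<Sum>i=1..n. (m (Z i \<omega>))\<^sup>2) \<le> C\<^sub>1 * real n"
  shows "\<bar>(1 / real n) * (\<Sum>i=1..n. fc i j (Z i \<omega>) * huber_score \<tau> (\<epsilon> i \<omega>))\<bar> \<le> (4 + 4 * V * C\<^sub>1) * \<l>"
proof -
  define t where "t i = \<tau> / m (Z i \<omega>)" for i
  define S where "S = (\<Sum>i=1..n. fc i j (Z i \<omega>) * huber_score (t i) (\<epsilon> i \<omega>))"
  define A where "A = (\<Sum>i=1..n. (m (Z i \<omega>))\<^sup>2)"
  define R where "R = (\<Sum>i=1..n. m (Z i \<omega>) * \<bar>\<epsilon> i \<omega>\<bar> * of_bool (t i < \<bar>\<epsilon> i \<omega>\<bar> \<and> \<bar>\<epsilon> i \<omega>\<bar> \<le> k * t i))"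
  define T where "T = (\<Sum>i=1..n. m (Z i \<omega>) * \<bar>\<epsilon> i \<omega>\<bar> * of_bool (k * t i < \<bar>\<epsilon> i \<omega>\<bar>))"
  have \<tau>d: "\<tau> * ln (real d) \<le> real n * \<l>"
    using mult_left_mono[OF rho(3), of \<tau>] tau(1) by (simp add: tau(2)[symmetric] mult_ac)
  have \<rho>A: "\<tau> * (2 * V * \<rho> * A) \<le> 2 * V * C\<^sub>1 * (real n * \<l>)"
  proof -
    have "2 * V * \<l> * A \<le> 2 * V * \<l> * (C\<^sub>1 * real n)" using env V tau by (intro mult_left_mono) (auto simp: A_def)
    then show ?thesis by (simp add: tau(2)[symmetric] mult_ac)
  qed
  have S_le: "s * S \<le> (2 + 2 * V * C\<^sub>1) * (real n * \<l>)" if s: "s \<in> {1, - 1}" for s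
  proof -
    have "(\<Sum>i=1..n. score_term s j i (Z i \<omega>, \<epsilon> i \<omega>)) = s * S / \<tau> - 2 * V * \<rho> * A"
      by (simp add: score_term_def S_def A_def t_def sum_subtractf sum_distrib_left sum_divide_distrib mult_ac)
    then have "s * S / \<tau> \<le> 2 * ln (real d) + 2 * V * \<rho> * A" using score[OF s] by simp
    from mult_left_mono[OF this, of \<tau>] have "s * S \<le> 2 * (\<tau> * ln (real d)) + \<tau> * (2 * V * \<rho> * A)"
      using tau(1) by (simp add: algebra_simps)
    then show ?thesis using \<tau>d \<rho>A by (simp add: algebra_simps)
  qed
  have absS: "\<bar>S\<bar> \<le> (2 + 2 * V * C\<^sub>1) * (real n * \<l>)" using S_le[of 1] S_le[of "- 1"] by simp
  have R_le: "R \<le> (1 + 2 * V * C\<^sub>1) * (real n * \<l>)"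
  proof -
    have m0: "m (Z i \<omega>) \<noteq> 0" for i using m_ge1[of "Z i \<omega>"] by auto
    have "(\<Sum>i=1..n. middle_term (Z i \<omega>, \<epsilon> i \<omega>)) = R / (k * \<tau>) - 2 * V / k * (\<rho> * A)"
      unfolding R_def A_def sum_distrib_left sum_divide_distrib sum_subtractf[symmetric]
      using m0 by (intro sum.cong refl) (simp add: middle_term_def t_def)
    then have "R / (k * \<tau>) \<le> ln k + 2 * V / k * (\<rho> * A)" using mid by simp
    from mult_left_mono[OF this, of "k * \<tau>"] have "R \<le> \<tau> * (k * ln k) + \<tau> * (2 * V * \<rho> * A)"
      using tau(1) k by (simp add: algebra_simps)
    \<comment> \<open>Here the size of \<open>k\<close> matters: the middle part contributes
      \<open>k * ln k\<close>, and \<open>k * k = ln d\<close> keeps it within the budget of the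
      first part.\<close>
    moreover have "\<tau> * (k * ln k) \<le> \<tau> * ln (real d)"
    proof (rule mult_left_mono)
      have "k * ln k \<le> k * k" using k ln_le_minus_one[of k] by (intro mult_left_mono) auto
      also have "k * k = ln (real d)" using ln_d by (simp add: k_def)
      finally show "k * ln k \<le> ln (real d)" .
    qed (use tau(1) in simp)
    ultimately show ?thesis using \<tau>d \<rho>A by (simp add: algebra_simps)
  qed
  have T_le: "T \<le> real n * \<l>" using tail by (simp add: T_def tail_term_def t_def)
  have "\<bar>(\<Sum>i=1..n. fc i j (Z i \<omega>) * huber_score \<tau> (\<epsilon> i \<omega>)) - S\<bar>
      \<le> (\<Sum>i=1..n. \<bar>fc i j (Z i \<omega>) * huber_score \<tau> (\<epsilon> i \<omega>) - fc i j (Z i \<omega>) * huber_score (t i) (\<epsilon> i \<omega>)\<bar>)"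
    unfolding S_def sum_subtractf[symmetric] by (rule sum_abs)
  also have "\<dots> \<le> R + T"
    unfolding R_def T_def sum.distrib[symmetric]
    by (intro sum_mono huber_score_split[OF tau(1) m_ge1 fc_le t_def])
  finally have "\<bar>\<Sum>i=1..n. fc i j (Z i \<omega>) * huber_score \<tau> (\<epsilon> i \<omega>)\<bar> \<le> \<bar>S\<bar> + (R + T)" by linarith
  also have "\<dots> \<le> (4 + 4 * V * C\<^sub>1) * (real n * \<l>)" using absS R_le T_le by (simp add: algebra_simps)
  finally have "\<bar>\<Sum>i=1..n. fc i j (Z i \<omega>) * huber_score \<tau> (\<epsilon> i \<omega>)\<bar> \<le> (4 + 4 * V * C\<^sub>1) * (real n * \<l>)" .
  then show ?thesis using n by (simp add: abs_mult field_simps)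
qed

section \<open>From the bad events to the estimation error\<close>

lemma second_moment_close:
  assumes x: "\<And>i j \<omega>. i \<in> {1..n} \<Longrightarrow> j \<in> {1..d} \<Longrightarrow> \<omega> \<in> space P \<Longrightarrow> x i j \<omega> = f i j (Z i \<omega>)"
    and j: "j \<in> {1..d}" "j' \<in> {1..d}"
  shows "\<bar>(1 / real n) * (\<Sum>i=1..n. \<integral>z. q j j' i z \<partial>\<pi>) - second_moment_matrix P n x j j'\<bar> \<le> Q * sqrt \<rho>"
proof -
  have "\<bar>(\<integral>z. q j j' i z \<partial>\<pi>) - (\<integral>\<omega>. x i j \<omega> * x i j' \<omega> \<partial>P)\<bar> \<le> sqrt \<rho> * Q" if i: "i \<in> {1..n}" for i
  proof -
    have fb: "\<bar>fc i j z * fc i j' z\<bar> \<le> (m z)\<^sup>2" for z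
      unfolding abs_mult power2_eq_square using fc_le m_ge1[of z] by (intro mult_mono) auto
    have [measurable]: "f i j \<in> borel_measurable E" "f i j' \<in> borel_measurable E" using f_meas i j by auto
    note Z_meas[OF i, measurable]
    have "(\<integral>\<omega>. x i j \<omega> * x i j' \<omega> \<partial>P) = (\<integral>\<omega>. f i j (Z i \<omega>) * f i j' (Z i \<omega>) \<partial>P)"
      using x i j by (intro Bochner_Integration.integral_cong) auto
    also have "\<dots> = (\<integral>\<omega>. fc i j (Z i \<omega>) * fc i j' (Z i \<omega>) \<partial>P)"
    proof (rule integral_cong_AE)
      show "AE \<omega> in P. f i j (Z i \<omega>) * f i j' (Z i \<omega>) = fc i j (Z i \<omega>) * fc i j' (Z i \<omega>)"
        using fc_eq by eventually_elim (use i j in auto)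
    qed measurable
    also have "\<dots> = (\<integral>z. fc i j z * fc i j' z \<partial>distr P E (Z i))"
      by (rule integral_distr[symmetric]) measurable
    also have "\<dots> = (\<integral>z. fc i j z * fc i j' z \<partial>\<pi>)" by (simp only: distr_Z[OF i])
    finally have e1: "(\<integral>\<omega>. x i j \<omega> * x i j' \<omega> \<partial>P) = (\<integral>z. fc i j z * fc i j' z \<partial>\<pi>)" .
    have i1: "integrable \<pi> (q j j' i)" "integrable \<pi> (\<lambda>z. fc i j z * fc i j' z)"
      by (rule integrable_m4[OF q_meas order_trans[OF q_bounds(2) m_pow_le]])
         (rule integrable_m4[OF _ order_trans[OF fb m_pow_le]], measurable)
    have "(\<integral>z. q j j' i z \<partial>\<pi>) - (\<integral>z. fc i j z * fc i j' z \<partial>\<pi>) = (\<integral>z. q j j' i z - fc i j z * fc i j' z \<partial>\<pi>)"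
      using i1 by simp
    also have "\<bar>\<dots>\<bar> \<le> sqrt \<rho> * Q"
    proof (rule integral_m4(2))
      fix z
      \<comment> \<open>The truncated and the full product differ only where
        \<open>m\<^sup>2 > B\<close>, so the bias is the tail estimated in
        \<open>tail_m\<close>.\<close>
      have "\<bar>q j j' i z - fc i j z * fc i j' z\<bar> \<le> of_bool (B < (m z)\<^sup>2) * (m z)\<^sup>2" using fb[of z] by (auto simp: q_def)
      then show "\<bar>q j j' i z - fc i j z * fc i j' z\<bar> \<le> sqrt \<rho> * m z ^ 4" using tail_m[of z] by linarith
    qed (use rho in auto)
    finally show ?thesis unfolding e1 .
  qed
  then have "(\<Sum>i=1..n. \<bar>(\<integral>z. q j j' i z \<partial>\<pi>) - (\<integral>\<omega>. x i j \<omega> * x i j' \<omega> \<partial>P)\<bar>) \<le> (\<Sum>i=1..n. sqrt \<rho> * Q)"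
    by (intro sum_mono) auto
  from order_trans[OF sum_abs this]
  have "\<bar>\<Sum>i=1..n. (\<integral>z. q j j' i z \<partial>\<pi>) - (\<integral>\<omega>. x i j \<omega> * x i j' \<omega> \<partial>P)\<bar> \<le> real n * (sqrt \<rho> * Q)" by simp
  moreover have "(1 / real n) * (\<Sum>i=1..n. \<integral>z. q j j' i z \<partial>\<pi>) - second_moment_matrix P n x j j'
      = (1 / real n) * (\<Sum>i=1..n. (\<integral>z. q j j' i z \<partial>\<pi>) - (\<integral>\<omega>. x i j \<omega> * x i j' \<omega> \<partial>P))"
    unfolding second_moment_matrix_def sum_subtractf by (simp only: right_diff_distrib)
  ultimately show ?thesis using n by (simp add: abs_mult field_simps)
qed

text \<open>Since \<open>m \<le> \<rho> powr (- 1/4)\<close>, the product is at most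
  \<open>\<rho> powr (3/4)\<close>. It serves to keep retained observations in the quadratic zone:
  the l1 radius is of order \<open>s * \<tau> * \<rho>\<close>, so predictions are at most of order
  \<open>\<tau> * s * sqrt \<rho>\<close>.\<close>

lemma envelope_times_radius:
  assumes "(m z)\<^sup>2 \<le> B" shows "m z * \<rho> \<le> sqrt \<rho>"
proof -
  define r where "r = sqrt (sqrt \<rho>)"
  have r: "0 < r" "r \<le> 1" "r\<^sup>2 = sqrt \<rho>" using rho by (auto simp: r_def)
  have rr: "r ^ 4 = \<rho>" using rho power_mult[of r 2 2] by (simp add: r(3))
  have "(m z * r)\<^sup>2 \<le> 1\<^sup>2"
    using assms rho by (simp add: power_mult_distrib r(3) B_def field_simps)
  then have "m z * r \<le> 1" by (rule power2_le_imp_le) simp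
  then have "(m z * r) * r ^ 3 \<le> 1 * r ^ 3" using r by (intro mult_right_mono) auto
  also have "1 * r ^ 3 \<le> r\<^sup>2" using power_decreasing[of 2 3 r] r by simp
  finally show ?thesis unfolding r(3) rr[symmetric] by (simp add: power_numeral_reduce)
qed

text \<open>\<open>lam\<close> is twice the gradient bound. In the failure probability,
  \<open>6 / d\<close> comes from the Gram matrix, the truncated envelope and the score,
  \<open>Q * sqrt \<rho>\<close> from the envelope tail, the two terms in \<open>k\<close> from the
  middle and far errors, and the last from the observations with large errors.\<close>

theorem estimation_error_probability:
  fixes x :: "nat \<Rightarrow> nat \<Rightarrow> 'w \<Rightarrow> real" and y :: "nat \<Rightarrow> 'w \<Rightarrow> real" and \<beta> :: "nat \<Rightarrow> real" and s :: nat
  defines "lam \<equiv> (8 + 8 * V * C\<^sub>1) * \<l>"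
  assumes s: "1 \<le> s" "card (supp_vec d \<beta>) \<le> s" and kappa: "0 < \<kappa>"
    and x: "\<And>i j \<omega>. i \<in> {1..n} \<Longrightarrow> j \<in> {1..d} \<Longrightarrow> \<omega> \<in> space P \<Longrightarrow> x i j \<omega> = f i j (Z i \<omega>)"
    and y: "\<And>i \<omega>. i \<in> {1..n} \<Longrightarrow> \<omega> \<in> space P \<Longrightarrow> y i \<omega> = (\<Sum>j=1..d. x i j \<omega> * \<beta> j) + \<epsilon> i \<omega>"
    and re: "ereal (2 * \<kappa>) \<le> restricted_eigenvalue d (supp_vec d \<beta>) (second_moment_matrix P n x)"
    and est: "huber_estimator P n d \<tau> lam x y bhat"
    and small1: "32 * (D + Q) * (real s * sqrt \<rho>) \<le> \<kappa>"
    and small2: "26 * (8 + 8 * V * C\<^sub>1) * (real s * sqrt \<rho>) \<le> \<kappa>"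
  shows "1 - (6 / real d + Q * sqrt \<rho> + 1 / k + V * Q * k powr (- a) + 128 * V * Q / \<kappa> * (real s * \<rho>))
    \<le> prob {\<omega> \<in> space P. l1_norm_on (\<lambda>j. bhat \<omega> j - \<beta> j) {1..d} \<le> 12 / \<kappa> * real s * lam \<and>
         L2_set (\<lambda>j. bhat \<omega> j - \<beta> j) {1..d} \<le> 12 / \<kappa> * sqrt (real s) * lam}"
proof -
  \<comment> \<open>With this value \<open>16 * s * W\<close> is half of \<open>\<kappa>\<close>;
    \<open>small1\<close> reserves the other half for the Gram error.\<close>
  define W where "W = \<kappa> / (32 * real s)"
  have W: "0 < W" using kappa s by (simp add: W_def)
  have C1: "0 \<le> C\<^sub>1" using Q by (simp add: C\<^sub>1_def)
  have lam: "0 < lam" using tau V C1 by (simp add: lam_def add_pos_nonneg)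
  define mid_bad where "mid_bad = {\<omega> \<in> space P. ln k \<le> (\<Sum>i=1..n. middle_term (Z i \<omega>, \<epsilon> i \<omega>))}"
  define tail_bad where "tail_bad = {\<omega> \<in> space P. real n * \<l> \<le> (\<Sum>i=1..n. tail_term (Z i \<omega>, \<epsilon> i \<omega>))}"
  define exc_bad where "exc_bad = {\<omega> \<in> space P. real n * W \<le> (\<Sum>i=1..n. exceed_term (Z i \<omega>, \<epsilon> i \<omega>))}"
  define bad where "bad = gram_bad \<union> (env_bad \<union> (score_bad \<union> (mid_bad \<union> (tail_bad \<union> exc_bad))))"
  let ?good = "{\<omega> \<in> space P. l1_norm_on (\<lambda>j. bhat \<omega> j - \<beta> j) {1..d} \<le> 12 / \<kappa> * real s * lam \<and>
         L2_set (\<lambda>j. bhat \<omega> j - \<beta> j) {1..d} \<le> 12 / \<kappa> * sqrt (real s) * lam}"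
  have ev: "mid_bad \<in> events" "tail_bad \<in> events" "exc_bad \<in> events"
    unfolding mid_bad_def tail_bad_def exc_bad_def by measurable
  note ev = ev gram_bad(1) env_bad(1) score_bad(1)
  have bad_ev: "bad \<in> events" unfolding bad_def using ev by auto
  have "prob bad \<le> prob gram_bad + (prob env_bad + (prob score_bad + (prob mid_bad + (prob tail_bad + prob exc_bad))))"
    unfolding bad_def using ev
    by (intro order_trans[OF measure_Un_le] add_left_mono) auto
  also have "\<dots> \<le> 2 / real d + ((2 / real d + Q * sqrt \<rho>) + (2 / real d + (1 / k + (V * Q * k powr (- a) + 4 * V * Q * \<rho> / W))))"
    unfolding mid_bad_def tail_bad_def exc_bad_def
    by (intro add_mono gram_bad(2) env_bad(2) score_bad(2) middle_term_prob tail_term_prob exceed_term_prob W)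
  also have "4 * V * Q * \<rho> / W = 128 * V * Q / \<kappa> * (real s * \<rho>)"
    using kappa s by (simp add: W_def field_simps)
  finally have bad_le: "prob bad \<le> 6 / real d + Q * sqrt \<rho> + 1 / k + V * Q * k powr (- a) + 128 * V * Q / \<kappa> * (real s * \<rho>)"
    by simp
  \<comment> \<open>Only almost surely, because the covariates agree with their clipped versions
    \<open>fc\<close> only almost surely.\<close>
  have ae: "AE \<omega> in P. \<omega> \<in> space P - bad \<longrightarrow> \<omega> \<in> ?good"
    using fc_eq
  proof eventually_elim
    case (elim \<omega>)
    show ?case
    proof
      assume w: "\<omega> \<in> space P - bad"
      then have w0: "\<omega> \<in> space P" and nb: "\<omega> \<notin> gram_bad" "\<omega> \<notin> env_bad" "\<omega> \<notin> score_bad" "\<omega> \<notin> mid_bad" "\<omega> \<notin> tail_bad" "\<omega> \<notin> exc_bad"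
        by (auto simp: bad_def)
      have xfc: "x i j \<omega> = fc i j (Z i \<omega>)" if "i \<in> {1..n}" "j \<in> {1..d}" for i j
        using x[OF that w0] elim that by simp
      have grad: "\<bar>(1 / real n) * (\<Sum>i=1..n. x i j \<omega> * huber_score \<tau> (\<epsilon> i \<omega>))\<bar> \<le> lam / 2" if j: "j \<in> {1..d}" for j
      proof -
        have "(\<Sum>i=1..n. x i j \<omega> * huber_score \<tau> (\<epsilon> i \<omega>)) = (\<Sum>i=1..n. fc i j (Z i \<omega>) * huber_score \<tau> (\<epsilon> i \<omega>))"
          using xfc j by (intro sum.cong) auto
        moreover have "\<bar>(1 / real n) * (\<Sum>i=1..n. fc i j (Z i \<omega>) * huber_score \<tau> (\<epsilon> i \<omega>))\<bar> \<le> (4 + 4 * V * C\<^sub>1) * \<l>"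
        proof (rule gradient_bound)
          show "(\<Sum>i=1..n. score_term s' j i (Z i \<omega>, \<epsilon> i \<omega>)) < 2 * ln (real d)" if "s' \<in> {1, - 1}" for s'
            using nb(3) w0 j that unfolding score_bad_def by (auto simp: not_le)
        qed (use nb w0 env_good[OF w0] in \<open>auto simp: mid_bad_def tail_bad_def not_le\<close>)
        ultimately show ?thesis by (simp add: lam_def algebra_simps)
      qed
      \<comment> \<open>Any factor above 12 would do. The 26 in \<open>small2\<close> is twice this
        13, so that a retained prediction stays below \<open>\<tau> / 2\<close>.\<close>
      define r where "r = 13 * real s * lam / \<kappa>"
      have r: "12 * real s * lam / \<kappa> < r" using lam s kappa by (simp add: r_def divide_strict_right_mono)
      have rsc: "\<kappa> / 2 * (L2_set u {1..d})\<^sup>2 \<le> huber_excess n d \<tau> (\<lambda>i j. x i j \<omega>) (\<lambda>i. \<epsilon> i \<omega>) u"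
        if u: "u \<in> lasso_cone d (supp_vec d \<beta>)" "l1_norm_on u {1..d} \<le> r" for u
      proof (rule restricted_strong_convexity[OF tau(1) _ s(2) u, where m="\<lambda>i. m (Z i \<omega>)" and B=B and \<eta>="(D + Q) * sqrt \<rho>" and W=W])
        show "supp_vec d \<beta> \<subseteq> {1..d}" by (auto simp: supp_vec_def)
        show "\<bar>x i j \<omega>\<bar> \<le> m (Z i \<omega>)" if "i \<in> {1..n}" "j \<in> {1..d}" for i j
          unfolding xfc[OF that] by (rule fc_le)
        show "0 \<le> m (Z i \<omega>)" for i using m_ge1[of "Z i \<omega>"] by linarith
        show "m (Z i \<omega>) * r \<le> \<tau> / 2" if "(m (Z i \<omega>))\<^sup>2 \<le> B" for i
        proof -
          have "m (Z i \<omega>) * r = 13 * (8 + 8 * V * C\<^sub>1) * real s / \<kappa> * \<tau> * (m (Z i \<omega>) * \<rho>)"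
            by (simp add: r_def lam_def tau(2)[symmetric])
          also have "\<dots> \<le> 13 * (8 + 8 * V * C\<^sub>1) * real s / \<kappa> * \<tau> * sqrt \<rho>"
            using envelope_times_radius[OF that] tau V C1 kappa by (intro mult_left_mono) auto
          also have "\<dots> = \<tau> / 2 * ((26 * (8 + 8 * V * C\<^sub>1) * (real s * sqrt \<rho>)) / \<kappa>)"
            using kappa by (simp add: field_simps)
          also have "\<dots> \<le> \<tau> / 2 * 1"
            using small2 kappa tau by (intro mult_left_mono) auto
          finally show ?thesis by simp
        qed
        show "ereal (2 * \<kappa>) \<le> restricted_eigenvalue d (supp_vec d \<beta>) (second_moment_matrix P n x)" by (rule re)
        show "\<bar>(1 / real n) * (\<Sum>i=1..n. of_bool ((m (Z i \<omega>))\<^sup>2 \<le> B) * (x i j \<omega> * x i j' \<omega>)) - second_moment_matrix P n x j j'\<bar>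
            \<le> (D + Q) * sqrt \<rho>" if j: "j \<in> {1..d}" "j' \<in> {1..d}" for j j'
        proof -
          have e: "(\<Sum>i=1..n. of_bool ((m (Z i \<omega>))\<^sup>2 \<le> B) * (x i j \<omega> * x i j' \<omega>)) = (\<Sum>i=1..n. q j j' i (Z i \<omega>))"
            using xfc j by (intro sum.cong) (auto simp: q_def)
          have "\<bar>\<Sum>i=1..n. q j j' i (Z i \<omega>) - (\<integral>z. q j j' i z \<partial>\<pi>)\<bar> \<le> real n * (D * sqrt \<rho>)"
            using nb(1) w0 j unfolding gram_bad_def by force
          then have "\<bar>(1 / real n) * (\<Sum>i=1..n. q j j' i (Z i \<omega>)) - (1 / real n) * (\<Sum>i=1..n. \<integral>z. q j j' i z \<partial>\<pi>)\<bar> \<le> D * sqrt \<rho>"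
            using n unfolding right_diff_distrib[symmetric] sum_subtractf[symmetric] by (simp add: abs_mult field_simps)
          then show ?thesis unfolding e using second_moment_close[of x j j', OF x j] by (simp add: algebra_simps)
        qed
        show "(1 / real n) * (\<Sum>i=1..n. (m (Z i \<omega>))\<^sup>2 * of_bool (\<tau> / 2 < \<bar>\<epsilon> i \<omega>\<bar>)) \<le> W"
          using nb(6) w0 n by (simp add: exc_bad_def exceed_term_def not_le field_simps)
        show "16 * real s * ((D + Q) * sqrt \<rho> + W) \<le> \<kappa>"
        proof -
          have "16 * real s * W = \<kappa> / 2" using s by (simp add: W_def)
          then show ?thesis using small1 by (simp add: algebra_simps)
        qed
        show "0 \<le> (D + Q) * sqrt \<rho>" using Q rho by (simp add: D_def)
      qed (use W in auto)
      have opt: "is_arg_min (\<lambda>b. huber_risk n d \<tau> (\<lambda>i j. x i j \<omega>) (\<lambda>i. y i \<omega>) b + lam * l1_norm_on b {1..d}) (\<lambda>b. True) (bhat \<omega>)"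
        using est w0 by (simp add: huber_estimator_def)
      show "\<omega> \<in> ?good"
        using huber_lasso_error_bound[OF tau(1) lam kappa s(2) y[OF _ w0] opt grad rsc r] w0 by simp
    qed
  qed
  \<comment> \<open>The good event must be measurable before its probability can be compared with
    that of the complement of \<open>bad\<close>.\<close>
  have bm: "(\<lambda>\<omega>. bhat \<omega> j) \<in> borel_measurable P" if "j \<in> {1..d}" for j
    using est that by (simp add: huber_estimator_def)
  have [measurable]: "(\<lambda>\<omega>. l1_norm_on (\<lambda>j. bhat \<omega> j - \<beta> j) {1..d}) \<in> borel_measurable P"
    "(\<lambda>\<omega>. L2_set (\<lambda>j. bhat \<omega> j - \<beta> j) {1..d}) \<in> borel_measurable P"
    unfolding l1_norm_on_def L2_set_def using bm by measurable
  have "1 - prob bad = prob (space P - bad)" by (rule prob_compl[OF bad_ev, symmetric])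
  also have "\<dots> \<le> prob ?good"
    by (rule finite_measure_mono_AE[OF ae]) measurable
  finally show ?thesis using bad_le by linarith
qed

end

section \<open>Passage to the limit\<close>

theorem theorem1:
  fixes P :: "nat \<Rightarrow> 'w measure"
    and E :: "nat \<Rightarrow> 'z measure"
    and K :: "nat \<Rightarrow> 'z \<Rightarrow> 'z measure"
    and \<pi> :: "nat \<Rightarrow> 'z measure"
    and Z :: "nat \<Rightarrow> nat \<Rightarrow> 'w \<Rightarrow> 'z"
    and g :: "nat \<Rightarrow> 'z \<Rightarrow> real measure"
    and \<epsilon> y :: "nat \<Rightarrow> nat \<Rightarrow> 'w \<Rightarrow> real"
    and f :: "nat \<Rightarrow> nat \<Rightarrow> nat \<Rightarrow> 'z \<Rightarrow> real"
    and x :: "nat \<Rightarrow> nat \<Rightarrow> nat \<Rightarrow> 'w \<Rightarrow> real"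
    and M :: "nat \<Rightarrow> 'z \<Rightarrow> real"
    and d s :: "nat \<Rightarrow> nat"
    and \<beta> :: "nat \<Rightarrow> nat \<Rightarrow> real"
    and \<gamma> :: "nat \<Rightarrow> real"
    and \<sigma> \<delta> v \<kappa> :: real
  assumes prob: "\<And>n. 1 \<le> n \<Longrightarrow> prob_space (P n)"
    and dim: "\<And>n. 1 \<le> n \<Longrightarrow> n \<le> d n"
    and sparse: "\<And>n. 1 \<le> n \<Longrightarrow> 1 \<le> s n \<and> card (supp_vec (d n) (\<beta> n)) \<le> s n"
    and chain: "\<And>n. 1 \<le> n \<Longrightarrow> stationary_markov_chain (P n) (E n) (K n) (\<pi> n) n (Z n)"
    and errors: "\<And>n. 1 \<le> n \<Longrightarrow> cond_indep_errors (P n) (E n) n (Z n) (g n) (\<epsilon> n)"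
    and f_meas: "\<And>n i j. 1 \<le> n \<Longrightarrow> i \<in> {1..n} \<Longrightarrow> j \<in> {1..d n} \<Longrightarrow>
      f n i j \<in> borel_measurable (E n)"
    and covariates: "\<And>n i j \<omega>. 1 \<le> n \<Longrightarrow> i \<in> {1..n} \<Longrightarrow> j \<in> {1..d n} \<Longrightarrow> \<omega> \<in> space (P n) \<Longrightarrow>
      x n i j \<omega> = f n i j (Z n i \<omega>)"
    and model: "\<And>n i \<omega>. 1 \<le> n \<Longrightarrow> i \<in> {1..n} \<Longrightarrow> \<omega> \<in> space (P n) \<Longrightarrow>
      y n i \<omega> = (\<Sum>j=1..d n. x n i j \<omega> * \<beta> n j) + \<epsilon> n i \<omega>"
    and unique_invariant: "\<And>n \<mu>. 1 \<le> n \<Longrightarrow> invariant_prob (E n) (K n) \<mu> \<Longrightarrow> \<mu> = \<pi> n"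
    and gamma: "\<And>n. 1 \<le> n \<Longrightarrow> \<gamma> n = markov_op_norm (K n) (\<pi> n)"
    and gap: "\<And>n. 1 \<le> n \<Longrightarrow> 1 - \<gamma> n > 0"
    and M_meas: "\<And>n. 1 \<le> n \<Longrightarrow> M n \<in> borel_measurable (E n)"
    and envelope: "\<And>n. 1 \<le> n \<Longrightarrow>
      AE z in \<pi> n. \<forall>i\<in>{1..n}. \<forall>j\<in>{1..d n}. \<bar>f n i j z\<bar> \<le> M n z"
    and M_moment: "\<And>n. 1 \<le> n \<Longrightarrow>
      integrable (\<pi> n) (\<lambda>z. M n z ^ 4) \<and> (\<integral>z. M n z ^ 4 \<partial>(\<pi> n)) = \<sigma> ^ 4"
    and delta: "\<delta> > 0"
    and v: "v > 0"
    and moments: "\<And>n. 1 \<le> n \<Longrightarrow> error_moments (P n) (E n) n (Z n) (\<epsilon> n) \<delta> v"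
    and kappa: "\<kappa> > 0"
    and restricted_ev: "\<forall>\<^sub>F n in sequentially.
      restricted_eigenvalue (d n) (supp_vec (d n) (\<beta> n)) (second_moment_matrix (P n) n (x n))
        \<ge> ereal (2 * \<kappa>)"
    and scaling: "(\<lambda>n. real (s n) * sqrt ((1 + \<gamma> n) / (1 - \<gamma> n) * (ln (real (d n)) / real n)))
      \<in> o(\<lambda>_. 1)"
  shows "\<exists>c_tau>0. \<exists>c_lam>0. \<exists>c0>0. \<forall>tau lam bhat.
    (\<forall>n\<ge>1. tau n = c_tau *
       ((1 - \<gamma> n) / (1 + \<gamma> n) * (real n / ln (real (d n)))) powr (1 / (1 + min \<delta> 1))) \<longrightarrow>
    (\<forall>n\<ge>1. lam n = c_lam *
       ((1 + \<gamma> n) / (1 - \<gamma> n) * (ln (real (d n)) / real n)) powr (min \<delta> 1 / (1 + min \<delta> 1))) \<longrightarrow>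
    (\<forall>n\<ge>1. huber_estimator (P n) n (d n) (tau n) (lam n) (x n) (y n) (bhat n)) \<longrightarrow>
    (\<lambda>n. measure (P n) {\<omega> \<in> space (P n).
       l1_norm_on (\<lambda>j. bhat n \<omega> j - \<beta> n j) {1..d n} \<le> c0 * real (s n) * lam n \<and>
       L2_set (\<lambda>j. bhat n \<omega> j - \<beta> n j) {1..d n} \<le> c0 * sqrt (real (s n)) * lam n})
      \<longlonglongrightarrow> 1"
proof -
  define a where "a = min \<delta> 1"
  have a: "0 < a" "a \<le> 1" using delta by (auto simp: a_def)
  define V where "V = 1 + v"
  define Q where "Q = 1 + \<sigma> ^ 4"
  \<comment> \<open>This is \<open>8 + 8 * V * C\<^sub>1\<close> with \<open>C\<^sub>1\<close>
    written out, so that it visibly depends only on \<open>v\<close> and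
    \<open>\<sigma>\<close>.\<close>
  define cl where "cl = 8 + 8 * V * (25 + 3 * Q)"
  have VQ: "1 \<le> V" "1 \<le> Q" using v by (auto simp: V_def Q_def)
  then have cl: "0 < cl" by (simp add: cl_def add_pos_nonneg)
  define \<rho> where "\<rho> n = (1 + \<gamma> n) / (1 - \<gamma> n) * (ln (real (d n)) / real n)" for n
  define k where "k n = sqrt (ln (real (d n)))" for n
  have \<gamma>0: "0 \<le> \<gamma> n" if "1 \<le> n" for n
    using invariant_kernel.markov_op_norm_nonneg[OF stationary_markov_chainD(1)[OF chain[OF that]]] gamma[OF that] by simp
  have \<rho>0: "0 \<le> \<rho> n" if "1 \<le> n" for n
    using \<gamma>0[OF that] gap[OF that] dim[OF that] that by (auto simp: \<rho>_def intro!: mult_nonneg_nonneg divide_nonneg_nonneg)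
  have lim_s: "(\<lambda>n. real (s n) * sqrt (\<rho> n)) \<longlonglongrightarrow> 0"
    using smalloD_tendsto[OF scaling] by (simp add: \<rho>_def)
  \<comment> \<open>As \<open>s n \<ge> 1\<close>, the scaling hypothesis also forces the rate
    without the factor \<open>s\<close> to vanish.\<close>
  have lim_sqrt: "(\<lambda>n. sqrt (\<rho> n)) \<longlonglongrightarrow> 0"
  proof (rule tendsto_sandwich[OF _ _ tendsto_const lim_s])
    show "\<forall>\<^sub>F n in sequentially. 0 \<le> sqrt (\<rho> n)"
      using \<rho>0 by (intro eventually_sequentiallyI[of 1]) auto
    show "\<forall>\<^sub>F n in sequentially. sqrt (\<rho> n) \<le> real (s n) * sqrt (\<rho> n)"
    proof (rule eventually_sequentiallyI[of 1])
      fix n :: nat assume "1 \<le> n"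
      then show "sqrt (\<rho> n) \<le> real (s n) * sqrt (\<rho> n)"
        using sparse[of n] \<rho>0[of n] mult_right_mono[of 1 "real (s n)" "sqrt (\<rho> n)"] by simp
    qed
  qed
  have lim_s\<rho>: "(\<lambda>n. real (s n) * \<rho> n) \<longlonglongrightarrow> 0"
  proof -
    have "(\<lambda>n. (real (s n) * sqrt (\<rho> n)) * sqrt (\<rho> n)) \<longlonglongrightarrow> 0 * 0" by (rule tendsto_mult[OF lim_s lim_sqrt])
    moreover have "\<forall>\<^sub>F n in sequentially. (real (s n) * sqrt (\<rho> n)) * sqrt (\<rho> n) = real (s n) * \<rho> n"
      using \<rho>0 by (intro eventually_sequentiallyI[of 1]) (simp add: mult.assoc)
    ultimately show ?thesis by (simp add: tendsto_cong)
  qed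
  \<comment> \<open>The regime \<open>d \<ge> n\<close> makes \<open>d\<close>, and with it the
    level \<open>k\<close>, tend to infinity; the terms \<open>1 / k\<close> and
    \<open>k powr (- a)\<close> depend on this.\<close>
  have d_inf: "filterlim (\<lambda>n. real (d n)) at_top sequentially"
    by (rule filterlim_at_top_mono[OF filterlim_real_sequentially])
       (use dim in \<open>auto intro!: eventually_sequentiallyI[of 1]\<close>)
  have k_inf: "filterlim k at_top sequentially"
    unfolding k_def by (rule filterlim_compose[OF sqrt_at_top filterlim_compose[OF ln_at_top d_inf]])
  define bound where "bound n = 6 / real (d n) + Q * sqrt (\<rho> n) + 1 / k n + V * Q * k n powr (- a)
      + 128 * V * Q / \<kappa> * (real (s n) * \<rho> n)" for n
  have lim_bound: "bound \<longlonglongrightarrow> 0"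
  proof -
    have 1: "(\<lambda>n. 6 / real (d n)) \<longlonglongrightarrow> 0" by (rule tendsto_divide_0[OF tendsto_const filterlim_at_top_imp_at_infinity[OF d_inf]])
    have 2: "(\<lambda>n. 1 / k n) \<longlonglongrightarrow> 0" by (rule tendsto_divide_0[OF tendsto_const filterlim_at_top_imp_at_infinity[OF k_inf]])
    have 3: "(\<lambda>n. k n powr (- a)) \<longlonglongrightarrow> 0" by (rule tendsto_neg_powr[OF _ k_inf]) (use a in simp)
    have "(\<lambda>n. 6 / real (d n) + Q * sqrt (\<rho> n) + 1 / k n + V * Q * k n powr (- a)
      + 128 * V * Q / \<kappa> * (real (s n) * \<rho> n)) \<longlonglongrightarrow> 0 + Q * 0 + 0 + V * Q * 0 + 128 * V * Q / \<kappa> * 0"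
      by (intro tendsto_add tendsto_mult tendsto_const 1 2 3 lim_sqrt lim_s\<rho>)
    then show ?thesis by (simp add: bound_def[abs_def])
  qed
  \<comment> \<open>Witnesses: \<open>c_tau = 1\<close>, \<open>c_lam = cl\<close>, twice the
    gradient constant, and \<open>c0 = 12 / \<kappa>\<close> from
    \<open>huber_lasso_error_bound\<close>.\<close>
  show ?thesis
  proof (rule exI[of _ 1], rule conjI, simp, rule exI[of _ cl], rule conjI, rule cl,
      rule exI[of _ "12 / \<kappa>"], rule conjI, use kappa in simp, intro allI impI)
    fix tau lam :: "nat \<Rightarrow> real" and bhat :: "nat \<Rightarrow> 'w \<Rightarrow> nat \<Rightarrow> real"
    assume tau: "\<forall>n\<ge>1. tau n = 1 * ((1 - \<gamma> n) / (1 + \<gamma> n) * (real n / ln (real (d n)))) powr (1 / (1 + min \<delta> 1))"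
      and lam: "\<forall>n\<ge>1. lam n = cl * ((1 + \<gamma> n) / (1 - \<gamma> n) * (ln (real (d n)) / real n)) powr (min \<delta> 1 / (1 + min \<delta> 1))"
      and est: "\<forall>n\<ge>1. huber_estimator (P n) n (d n) (tau n) (lam n) (x n) (y n) (bhat n)"
    let ?good = "\<lambda>n. {\<omega> \<in> space (P n). l1_norm_on (\<lambda>j. bhat n \<omega> j - \<beta> n j) {1..d n} \<le> 12 / \<kappa> * real (s n) * lam n \<and>
       L2_set (\<lambda>j. bhat n \<omega> j - \<beta> n j) {1..d n} \<le> 12 / \<kappa> * sqrt (real (s n)) * lam n}"
    have ev1: "\<forall>\<^sub>F n in sequentially. sqrt (\<rho> n) < 1"
      by (rule order_tendstoD(2)[OF lim_sqrt]) simp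
    \<comment> \<open>Used for the two smallness conditions of
      \<open>estimation_error_probability\<close>, with the constants of the Gram error and of the
      localisation radius.\<close>
    have ev_small: "\<forall>\<^sub>F n in sequentially. c * (real (s n) * sqrt (\<rho> n)) < \<kappa>" for c
      using order_tendstoD(2)[OF tendsto_mult_left[OF lim_s, of c], of \<kappa>] kappa by simp
    have lower: "\<forall>\<^sub>F n in sequentially. 1 - bound n \<le> measure (P n) (?good n)"
      using restricted_ev ev1 ev_small[of "32 * (24 + 2 * Q + Q)"] ev_small[of "26 * cl"] eventually_ge_at_top[of 3]
    proof eventually_elim
      case (elim n)
      then have n: "1 \<le> n" by simp
      interpret mod: markov_huber_model "P n" "E n" "K n" "\<pi> n" n "d n" "Z n" "g n" "\<epsilon> n" "f n" "M n" "\<gamma> n" \<sigma> \<delta> v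
      proof (rule markov_huber_model.intro)
        show "prob_space (P n)" by (rule prob[OF n])
        show "AE z in \<pi> n. \<forall>i\<in>{1..n}. \<forall>j\<in>{1..d n}. \<bar>f n i j z\<bar> \<le> M n z" by (rule envelope[OF n])
        show "3 \<le> d n" using dim[OF n] elim(5) by simp
        show "(1 + \<gamma> n) / (1 - \<gamma> n) * (ln (real (d n)) / real n) \<le> 1"
          using elim(2) by (simp add: \<rho>_def)
      qed (use n gap[OF n] M_moment[OF n] delta v in \<open>auto intro: chain errors f_meas gamma M_meas moments\<close>)
      \<comment> \<open>The constants of the fixed-size model turn out to be the same for every
        \<open>n\<close>; only \<open>\<rho>\<close> and \<open>k\<close> vary.\<close>
      have eqs: "mod.\<rho> = \<rho> n" "mod.V = V" "mod.Q = Q" "mod.k = k n" "mod.a = a" "mod.D = 24 + 2 * Q" "mod.C\<^sub>1 = 25 + 3 * Q"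
        by (simp_all add: mod.\<rho>_def \<rho>_def mod.V_def V_def mod.Q_def Q_def mod.k_def k_def mod.a_def a_def mod.D_def mod.C\<^sub>1_def)
      have "(1 - \<gamma> n) / (1 + \<gamma> n) * (real n / ln (real (d n))) = inverse (\<rho> n)"
        by (simp add: \<rho>_def)
      then have tau_eq: "tau n = mod.\<tau>"
        using tau n mod.rho(1) by (simp add: mod.\<tau>_def eqs a_def powr_minus inverse_powr)
      have lam_eq: "lam n = (8 + 8 * mod.V * mod.C\<^sub>1) * mod.\<l>"
        using lam n by (simp add: mod.\<l>_def eqs cl_def \<rho>_def a_def)
      have "1 - bound n \<le> measure (P n) {\<omega> \<in> space (P n).
          l1_norm_on (\<lambda>j. bhat n \<omega> j - \<beta> n j) {1..d n} \<le> 12 / \<kappa> * real (s n) * ((8 + 8 * mod.V * mod.C\<^sub>1) * mod.\<l>) \<and>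
          L2_set (\<lambda>j. bhat n \<omega> j - \<beta> n j) {1..d n} \<le> 12 / \<kappa> * sqrt (real (s n)) * ((8 + 8 * mod.V * mod.C\<^sub>1) * mod.\<l>)}"
        unfolding bound_def eqs[symmetric]
      proof (rule mod.estimation_error_probability[OF _ _ kappa, where x="x n" and y="y n"])
        show "1 \<le> s n" "card (supp_vec (d n) (\<beta> n)) \<le> s n" using sparse[OF n] by auto
        show "huber_estimator (P n) n (d n) mod.\<tau> ((8 + 8 * mod.V * mod.C\<^sub>1) * mod.\<l>) (x n) (y n) (bhat n)"
          using est n tau_eq lam_eq by metis
      qed (use n elim covariates model in \<open>auto simp: eqs cl_def\<close>)
      then show "1 - bound n \<le> measure (P n) (?good n)" unfolding lam_eq .
    qed
    have upper: "\<forall>\<^sub>F n in sequentially. measure (P n) (?good n) \<le> 1"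
      using prob by (intro eventually_sequentiallyI[of 1] prob_space.prob_le_1) auto
    have "(\<lambda>n. 1 - bound n) \<longlonglongrightarrow> 1 - 0" by (intro tendsto_diff tendsto_const lim_bound)
    then have "(\<lambda>n. 1 - bound n) \<longlonglongrightarrow> 1" by simp
    from tendsto_sandwich[OF lower upper this tendsto_const]
    show "(\<lambda>n. measure (P n) (?good n)) \<longlonglongrightarrow> 1" .
  qed
qed

end
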